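(* The Precoloring Extension problem can be solved in time $O(q^{2.5q+o(q)}\cdot n)$, where $q=2^{2k}$ and $n$ is the input size, on graphs of neighborhood diversity at most $k$.
   Context: Precoloring Extension problem: the input is a graph $G$, a positive integer $r$, and a partial proper coloring of $G$ (a proper coloring, with colors from $\{1,\dots,r\}$, of a subset of the vertices). The question is whether this partial coloring can be extended to a proper coloring of all of $G$ with $r$ colors. Two vertices $v,v'$ of a graph $G$ have the same type iff $N(v)\setminus\{v'\}=N(v')\setminus\{v\}$, where $N(v)$ denotes the neighborhood of $v$. A graph $G=(V,E)$ has neighborhood diversity at most $w$ if there exists a partition of $V$ into at most $w$ sets such that all vertices in each set have the same type. *)

theory Defs
  imports Complex_Main "HOL-Library.Landau_Symbols" "HOL-Library.Disjoint_Sets"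
begin

section \<open>Graphs, types and neighborhood diversity\<close>

definition simple_graph :: "'a set \<Rightarrow> 'a set set \<Rightarrow> bool" where
  "simple_graph V E \<longleftrightarrow> finite V \<and> E \<subseteq> {{u, v} | u v. u \<in> V \<and> v \<in> V \<and> u \<noteq> v}"

definition nbh :: "'a set set \<Rightarrow> 'a \<Rightarrow> 'a set" where
  "nbh E v = {u. {v, u} \<in> E}"

definition same_type :: "'a set set \<Rightarrow> 'a \<Rightarrow> 'a \<Rightarrow> bool" where
  "same_type E v v' \<longleftrightarrow> nbh E v - {v'} = nbh E v' - {v}"

definition nd_at_most :: "'a set \<Rightarrow> 'a set set \<Rightarrow> nat \<Rightarrow> bool" where
  "nd_at_most V E w \<longleftrightarrow>
     (\<exists>P. partition_on V P \<and> finite P \<and> card P \<le> w \<and>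
          (\<forall>S\<in>P. \<forall>v\<in>S. \<forall>v'\<in>S. same_type E v v'))"

section \<open>Precoloring extension\<close>

text \<open>The domain of the map is the set of colored vertices.\<close>

definition proper_partial_coloring ::
    "'a set \<Rightarrow> 'a set set \<Rightarrow> nat \<Rightarrow> ('a \<rightharpoonup> nat) \<Rightarrow> bool" where
  "proper_partial_coloring V E r p \<longleftrightarrow>
     dom p \<subseteq> V \<and> ran p \<subseteq> {1..r} \<and>
     (\<forall>u\<in>dom p. \<forall>v\<in>dom p. {u, v} \<in> E \<longrightarrow> p u \<noteq> p v)"

definition precol_instance ::
    "'a set \<Rightarrow> 'a set set \<Rightarrow> nat \<Rightarrow> ('a \<rightharpoonup> nat) \<Rightarrow> bool" where
  "precol_instance V E r p \<longleftrightarrow>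
     simple_graph V E \<and> r > 0 \<and> proper_partial_coloring V E r p"

definition precol_extendible ::
    "'a set \<Rightarrow> 'a set set \<Rightarrow> nat \<Rightarrow> ('a \<rightharpoonup> nat) \<Rightarrow> bool" where
  "precol_extendible V E r p \<longleftrightarrow>
     (\<exists>f. proper_partial_coloring V E r f \<and> dom f = V \<and> p \<subseteq>\<^sub>m f)"

text \<open>
  Input format for a graph on the vertices \<open>0, \<dots>, N - 1\<close>: the numbers \<open>N\<close>, \<open>r\<close> and
  \<open>|E|\<close>, then the color of each vertex (\<open>0\<close> meaning uncolored), then the end points
  of the edges, every edge being listed once, in arbitrary order and orientation.
  The input thus consists of \<open>3 + N + 2|E|\<close> words.
\<close>

definition encodes ::
    "nat list \<Rightarrow> nat \<Rightarrow> nat set set \<Rightarrow> nat \<Rightarrow> (nat \<rightharpoonup> nat) \<Rightarrow> bool" where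
  "encodes xs N E r p \<longleftrightarrow>
     (\<exists>es. distinct (map (\<lambda>(u, v). {u, v}) es) \<and> (\<lambda>(u, v). {u, v}) ` set es = E \<and>
        xs = [N, r, length es]
             @ map (\<lambda>v. case p v of None \<Rightarrow> 0 | Some c \<Rightarrow> c) [0..<N]
             @ concat (map (\<lambda>(u, v). [u, v]) es))"

section \<open>Word RAM programs\<close>

text \<open>
  Structured programs over registers and arrays of machine words. A program mentions only
  finitely many registers and arrays; arrays are unbounded and initially zero. Every
  elementary instruction and every test takes one unit of time.
\<close>

datatype binop = Add | Sub | Mul | Div

fun eval_op :: "binop \<Rightarrow> nat \<Rightarrow> nat \<Rightarrow> nat" where
  "eval_op Add m n = m + n"
| "eval_op Sub m n = m - n"
| "eval_op Mul m n = m * n"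
| "eval_op Div m n = m div n"

type_synonym reg_id = nat
type_synonym arr_id = nat

datatype com =
    Skip
  | Const reg_id nat
  | Move reg_id reg_id
  | Arith binop reg_id reg_id reg_id
  | Load reg_id arr_id reg_id
  | Store arr_id reg_id reg_id
  | Seq com com
  | If reg_id com com
  | While reg_id com

record state =
  reg :: "reg_id \<Rightarrow> nat"
  arr :: "arr_id \<Rightarrow> nat \<Rightarrow> nat"

text \<open>
  \<open>exec B c s t s'\<close>: started in \<open>s\<close>, the program \<open>c\<close> halts in \<open>s'\<close> after \<open>t\<close> units of time,
  on a machine whose words hold exactly the numbers below \<open>B\<close>. There is no rule for an
  instruction that overflows, so a program has to avoid overflow in order to
  halt. Without such a limit, unit-cost arithmetic would be unreasonably powerful.
\<close>

inductive exec :: "nat \<Rightarrow> com \<Rightarrow> state \<Rightarrow> nat \<Rightarrow> state \<Rightarrow> bool" for B :: nat where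
  Skip: "exec B Skip s 1 s"
| Const: "n < B \<Longrightarrow> exec B (Const x n) s 1 (s\<lparr>reg := (reg s)(x := n)\<rparr>)"
| Move: "exec B (Move x y) s 1 (s\<lparr>reg := (reg s)(x := reg s y)\<rparr>)"
| Arith: "eval_op f (reg s y) (reg s z) < B \<Longrightarrow>
    exec B (Arith f x y z) s 1 (s\<lparr>reg := (reg s)(x := eval_op f (reg s y) (reg s z))\<rparr>)"
| Load: "exec B (Load x a i) s 1 (s\<lparr>reg := (reg s)(x := arr s a (reg s i))\<rparr>)"
| Store: "exec B (Store a i x) s 1
    (s\<lparr>arr := (arr s)(a := (arr s a)(reg s i := reg s x))\<rparr>)"
| Seq: "exec B c1 s t1 s1 \<Longrightarrow> exec B c2 s1 t2 s2 \<Longrightarrow> exec B (Seq c1 c2) s (t1 + t2) s2"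
| IfTrue: "reg s x \<noteq> 0 \<Longrightarrow> exec B c1 s t s1 \<Longrightarrow> exec B (If x c1 c2) s (t + 1) s1"
| IfFalse: "reg s x = 0 \<Longrightarrow> exec B c2 s t s1 \<Longrightarrow> exec B (If x c1 c2) s (t + 1) s1"
| WhileFalse: "reg s x = 0 \<Longrightarrow> exec B (While x c) s 1 s"
| WhileTrue: "reg s x \<noteq> 0 \<Longrightarrow> exec B c s t1 s1 \<Longrightarrow> exec B (While x c) s1 t2 s2 \<Longrightarrow>
    exec B (While x c) s (t1 + t2 + 1) s2"

text \<open>The input is stored in array \<open>0\<close> and its length in register \<open>0\<close>.\<close>

definition init_state :: "nat list \<Rightarrow> state" where
  "init_state xs =
     \<lparr>reg = (\<lambda>_. 0)(0 := length xs),
      arr = (\<lambda>_ _. 0)(0 := (\<lambda>i. if i < length xs then xs ! i else 0))\<rparr>"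

text \<open>
  The usual word size: a constant multiple \<open>d\<close> of the number of bits needed for the input
  length and for the numbers occurring in the input.
\<close>

definition word_limit :: "nat \<Rightarrow> nat list \<Rightarrow> nat" where
  "word_limit d xs = (length xs + Max (set xs)) ^ d"

text \<open>On halting, register \<open>0\<close> is nonzero iff the answer is yes.\<close>

definition decides_within :: "com \<Rightarrow> nat \<Rightarrow> nat list \<Rightarrow> bool \<Rightarrow> real \<Rightarrow> bool" where
  "decides_within P d xs ans T \<longleftrightarrow>
     (\<exists>t s. exec (word_limit d xs) P (init_state xs) t s \<and>
            (reg s 0 \<noteq> 0 \<longleftrightarrow> ans) \<and> real t \<le> T)"

end

theory Submission
  imports Defs "HOL-Library.FuncSet"
begin

text \<open>
  Let \<open>N\<close> be the number of vertices and \<open>K \<le> k\<close> the number of types. If \<open>r \<ge> N\<close>, a greedy coloring works. If \<open>N < 4\<^sup>K\<close>, then all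
  \<open>r\<^sup>N \<le> q\<^sup>q\<close> colorings can be tried. Otherwise a color \<open>c\<close> is described by a ternary number with
  \<open>K\<close> digits: digit \<open>i\<close> is \<open>1\<close> if some precolored vertex of type \<open>i\<close> has color \<open>c\<close>, and it is \<open>2\<close>
  if \<open>c\<close> is to be used for uncolored vertices of type \<open>i\<close>. An extension exists iff there are numbers
  \<open>x\<^sub>j\<close> of colors with code \<open>j\<close> which agree with the precoloring and meet the demand of every type:
  an independent type needs at most one new color, a clique one for each uncolored vertex.

  Such \<open>x\<close> is found by local search. The moves from \<open>x\<close> to a solution, together with one negative
  unit vector for every unit of unmet demand, form a family of vectors in \<open>{-1, 0, 1}\<^sup>K\<close> with sum zero.
  Taking vectors of each kind in proportion to their number keeps all partial sums in a box whose
  size depends on \<open>K\<close> only, so by the pigeonhole principle a large family splits into two families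
  with sum zero. Hence a family of at most \<open>(3 \<cdot> 9\<^sup>K)\<^sup>K\<close> vectors contains an unmet unit and has sum zero,
  and its moves improve \<open>x\<close>. At most \<open>N\<close> improvements are needed, and each of them is found among
  \<open>2\<close> to the power \<open>O(K\<^sup>2 \<cdot> 3\<^sup>K)\<close> candidates, which is negligible against \<open>q\<^sup>q\<close>.
\<close>

section \<open>A structured language for the word RAM\<close>

text \<open>The obstacle is that the \<open>3 ^ K\<close> numbers \<open>x j\<close> range up to
  \<open>N\<close>, so they cannot be enumerated outright. A move recodes a single color and keeps
  the digits forced by the precoloring. Hence any subset of the moves respects class sizes and
  admissibility of codes, and only the \<open>K\<close> demands have to be balanced. The zero-sum
  argument therefore lives in dimension \<open>K\<close> instead of \<open>3 ^ K\<close>, and the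
  radius is 2 to the power O(K^2). Balancing \<open>3 ^ K\<close> coordinates in this way would put
  about \<open>3 ^ K\<close> into the exponent of the radius and \<open>9 ^ K\<close> into that of
  the search, more than \<open>k * 4 ^ k\<close> allows. Three digit values suffice because a color
  already present in a type gains nothing by being added to it again. The gap between
  \<open>3 ^ K\<close> and \<open>4 ^ K\<close> then absorbs the factor K^2 in the exponent. The
  word size shapes the program: the radius and \<open>4 ^ K\<close> may exceed a word and are capped
  at \<open>N + 1\<close>, and the index of a candidate is never stored, only its digits.\<close>

datatype exp = Num nat | Var nat | Get nat exp | Bin binop exp exp

abbreviation plus_exp (infixl "\<oplus>" 65) where "a \<oplus> b \<equiv> Bin Add a b"
abbreviation minus_exp (infixl "\<ominus>" 65) where "a \<ominus> b \<equiv> Bin Sub a b"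
abbreviation times_exp (infixl "\<otimes>" 70) where "a \<otimes> b \<equiv> Bin Mul a b"
abbreviation div_exp (infixl "\<oslash>" 70) where "a \<oslash> b \<equiv> Bin Div a b"

primrec ev :: "exp \<Rightarrow> state \<Rightarrow> nat" where
  "ev (Num n) s = n"
| "ev (Var x) s = reg s x"
| "ev (Get a e) s = arr s a (ev e s)"
| "ev (Bin f e1 e2) s = eval_op f (ev e1 s) (ev e2 s)"

primrec ecost :: "exp \<Rightarrow> nat" where
  "ecost (Num n) = 1"
| "ecost (Var x) = 1"
| "ecost (Get a e) = ecost e + 1"
| "ecost (Bin f e1 e2) = ecost e1 + ecost e2 + 1"

text \<open>Differences and quotients of words are words, so only sums and products can overflow.\<close>

fun op_safe :: "nat \<Rightarrow> binop \<Rightarrow> nat \<Rightarrow> nat \<Rightarrow> bool" where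
  "op_safe B Add m n \<longleftrightarrow> m + n < B"
| "op_safe B Mul m n \<longleftrightarrow> m * n < B"
| "op_safe B Sub m n \<longleftrightarrow> True"
| "op_safe B Div m n \<longleftrightarrow> True"

primrec safe :: "nat \<Rightarrow> exp \<Rightarrow> state \<Rightarrow> bool" where
  "safe B (Num n) s \<longleftrightarrow> n < B"
| "safe B (Var x) s \<longleftrightarrow> True"
| "safe B (Get a e) s \<longleftrightarrow> safe B e s"
| "safe B (Bin f e1 e2) s \<longleftrightarrow> safe B e1 s \<and> safe B e2 s \<and> op_safe B f (ev e1 s) (ev e2 s)"

text \<open>Subtraction is truncated, so \<open>1 - (a - b)\<close> is 1 if a \<le> b and 0
  otherwise; the product of both directions is the indicator of equality. Each operand is evaluated
  twice.\<close>

definition eq_exp :: "exp \<Rightarrow> exp \<Rightarrow> exp" (infix "\<doteq>" 50) where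
  "(a \<doteq> b) = (Num 1 \<ominus> (a \<ominus> b)) \<otimes> (Num 1 \<ominus> (b \<ominus> a))"

text \<open>A test succeeds iff its value is nonzero, and \<open>b - a\<close> is nonzero iff \<open>a < b\<close>.\<close>

abbreviation less_exp (infix "\<prec>" 50) where "(a \<prec> b) \<equiv> b \<ominus> a"

lemma ev_eq_exp [simp]: "ev (a \<doteq> b) s = (if ev a s = ev b s then 1 else 0)"
  by (auto simp: eq_exp_def)

lemma safe_eq_exp [simp]: "safe B (a \<doteq> b) s \<longleftrightarrow> safe B a s \<and> safe B b s \<and> 1 < B"
  by (cases "ev a s" "ev b s" rule: linorder_cases) (auto simp: eq_exp_def)

lemma ecost_eq_exp [simp]: "ecost (a \<doteq> b) = 2 * ecost a + 2 * ecost b + 7"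
  by (simp add: eq_exp_def)

section \<open>Structured programs with exact running times\<close>

datatype scom =
    Asg nat exp
  | Put nat exp exp
  | SSeq scom scom (infixr ";;" 55)
  | IF exp scom scom
  | WHILE exp scom

text \<open>A self-assignment, so no extra command is needed; as a consequence \<open>mv\<close>
  lists variable 0 wherever \<open>NOP\<close> occurs.\<close>

abbreviation "NOP \<equiv> Asg 0 (Var 0)"
abbreviation set_reg :: "nat \<Rightarrow> nat \<Rightarrow> state \<Rightarrow> state" where
  "set_reg x n s \<equiv> s\<lparr>reg := (reg s)(x := n)\<rparr>"
abbreviation set_arr :: "nat \<Rightarrow> nat \<Rightarrow> nat \<Rightarrow> state \<Rightarrow> state" where
  "set_arr a i n s \<equiv> s\<lparr>arr := (arr s)(a := (arr s a)(i := n))\<rparr>"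

text \<open>A postcondition also takes the running time, which is exact in \<open>wp\<close>.\<close>

type_synonym post = "state \<Rightarrow> nat \<Rightarrow> bool"

text \<open>Unrolls a loop with bounded fuel. Running out of fuel yields \<open>False\<close>, so
  \<open>wp\<close> of a loop asserts termination. The transformer \<open>w\<close> of the body is a
  parameter so that \<open>wp\<close> is primitive recursive.\<close>

primrec whl :: "nat \<Rightarrow> exp \<Rightarrow> (post \<Rightarrow> state \<Rightarrow> bool) \<Rightarrow> nat \<Rightarrow> post \<Rightarrow> state \<Rightarrow> bool" where
  "whl B e w 0 Q s = False"
| "whl B e w (Suc n) Q s = (safe B e s \<and>
     (if ev e s = 0 then Q s (ecost e + 1)
      else w (\<lambda>s1 t1. whl B e w n (\<lambda>s2 t2. Q s2 (t1 + t2 + ecost e + 1)) s1) s))"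

primrec wp :: "nat \<Rightarrow> scom \<Rightarrow> post \<Rightarrow> state \<Rightarrow> bool" where
  "wp B (Asg x e) = (\<lambda>Q s. safe B e s \<and> Q (set_reg x (ev e s) s) (ecost e + 1))"
| "wp B (Put a e1 e2) = (\<lambda>Q s. safe B e1 s \<and> safe B e2 s \<and>
     Q (set_arr a (ev e1 s) (ev e2 s) s) (ecost e1 + ecost e2 + 1))"
| "wp B (c1 ;; c2) = (\<lambda>Q s. wp B c1 (\<lambda>s1 t1. wp B c2 (\<lambda>s2 t2. Q s2 (t1 + t2)) s1) s)"
| "wp B (IF e c1 c2) = (\<lambda>Q s. safe B e s \<and>
     (if ev e s \<noteq> 0 then wp B c1 (\<lambda>s1 t1. Q s1 (t1 + ecost e + 1)) s
      else wp B c2 (\<lambda>s1 t1. Q s1 (t1 + ecost e + 1)) s))"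
| "wp B (WHILE e c) = (\<lambda>Q s. \<exists>n. whl B e (wp B c) n Q s)"

text \<open>Variable \<open>x\<close> lives in register \<open>2 x\<close>; the odd registers hold intermediate values.\<close>

primrec ecomp :: "exp \<Rightarrow> nat \<Rightarrow> com" where
  "ecomp (Num n) t = Const (2 * t + 1) n"
| "ecomp (Var x) t = Move (2 * t + 1) (2 * x)"
| "ecomp (Get a e) t = Seq (ecomp e t) (Load (2 * t + 1) a (2 * t + 1))"
| "ecomp (Bin f e1 e2) t = Seq (Seq (ecomp e1 t) (ecomp e2 (Suc t)))
     (Arith f (2 * t + 1) (2 * t + 1) (2 * Suc t + 1))"

text \<open>Registers 1 and 3 are the temporaries of slots 0 and 1. A loop condition is computed
  before the loop and again at the end of every round, hence once per test, which is what
  \<open>whl\<close> charges.\<close>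

primrec compile :: "scom \<Rightarrow> com" where
  "compile (Asg x e) = Seq (ecomp e 0) (Move (2 * x) 1)"
| "compile (Put a e1 e2) = Seq (Seq (ecomp e1 0) (ecomp e2 1)) (Store a 1 3)"
| "compile (c1 ;; c2) = Seq (compile c1) (compile c2)"
| "compile (IF e c1 c2) = Seq (ecomp e 0) (If 1 (compile c1) (compile c2))"
| "compile (WHILE e c) = Seq (ecomp e 0) (While 1 (Seq (compile c) (ecomp e 0)))"

section \<open>Simulation of structured programs by the machine\<close>

definition view :: "state \<Rightarrow> state" where
  "view s = s\<lparr>reg := (\<lambda>x. reg s (2 * x))\<rparr>"

definition words :: "nat \<Rightarrow> state \<Rightarrow> bool" where
  "words B s \<longleftrightarrow> (\<forall>x. reg s x < B) \<and> (\<forall>a i. arr s a i < B)"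

lemma ev_words: "words B s \<Longrightarrow> safe B e s \<Longrightarrow> ev e s < B"
proof (induction e)
  case (Bin f e1 e2)
  then show ?case
    by (cases f) (auto intro: le_less_trans[OF diff_le_self] le_less_trans[OF div_le_dividend])
qed (auto simp: words_def)

lemma eval_op_words:
  "op_safe B f m n \<Longrightarrow> m < B \<Longrightarrow> eval_op f m n < B"
  by (cases f) (auto intro: le_less_trans[OF diff_le_self] le_less_trans[OF div_le_dividend])

lemma view_sel [simp]: "reg (view s) x = reg s (2 * x)" "arr (view s) = arr s"
  by (simp_all add: view_def)

lemma view_upd_odd [simp]: "view (s\<lparr>reg := (reg s)(Suc (2 * t) := n)\<rparr>) = view s"
proof -
  have "(\<lambda>x. ((reg s)(Suc (2 * t) := n)) (2 * x)) = (\<lambda>x. reg s (2 * x))"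
    by (rule ext) (simp, presburger)
  then show ?thesis by (simp add: view_def)
qed

lemma view_upd_even [simp]: "view (s\<lparr>reg := (reg s)(2 * x := n)\<rparr>) = set_reg x n (view s)"
  by (auto simp: view_def fun_eq_iff)

lemma view_upd_arr [simp]: "view (s\<lparr>arr := f\<rparr>) = (view s)\<lparr>arr := f\<rparr>"
  by (simp add: view_def)

text \<open>Slots act as a stack: evaluation in slot \<open>t\<close> leaves the lower slots alone,
  so the left operand survives the evaluation of the right one in slot \<open>Suc t\<close>.\<close>

lemma exec_ecomp:
  assumes "safe B e (view s)" "words B (view s)"
  shows "\<exists>s'. exec B (ecomp e t) s (ecost e) s' \<and> view s' = view s \<and>
           reg s' (2 * t + 1) = ev e (view s) \<and> (\<forall>t'<t. reg s' (2 * t' + 1) = reg s (2 * t' + 1))"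
  using assms
proof (induction e arbitrary: s t)
  case (Num n)
  then show ?case using exec.Const[of n B "2 * t + 1" s] by (auto intro!: exI)
next
  case (Var x)
  then show ?case using exec.Move[of B "2 * t + 1" "2 * x" s] by (auto intro!: exI)
next
  case (Get a e)
  then obtain s' where s': "exec B (ecomp e t) s (ecost e) s'" "view s' = view s"
    "reg s' (2 * t + 1) = ev e (view s)" "\<forall>t'<t. reg s' (2 * t' + 1) = reg s (2 * t' + 1)"
    by (metis safe.simps(3))
  have "arr s' = arr s" using s'(2) by (metis view_sel(2))
  then show ?case
    using exec.Seq[OF s'(1) exec.Load[of B "2 * t + 1" a "2 * t + 1" s']] s' by (auto intro!: exI)
next
  case (Bin f e1 e2)
  then obtain s1 where s1: "exec B (ecomp e1 t) s (ecost e1) s1" "view s1 = view s"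
    "reg s1 (2 * t + 1) = ev e1 (view s)" "\<forall>t'<t. reg s1 (2 * t' + 1) = reg s (2 * t' + 1)"
    by (metis safe.simps(4))
  obtain s2 where s2: "exec B (ecomp e2 (Suc t)) s1 (ecost e2) s2" "view s2 = view s"
    "reg s2 (2 * Suc t + 1) = ev e2 (view s)"
    "\<forall>t'<Suc t. reg s2 (2 * t' + 1) = reg s1 (2 * t' + 1)"
    using Bin.IH(2)[of s1 "Suc t"] Bin.prems s1(2) by auto
  have ops: "op_safe B f (ev e1 (view s)) (ev e2 (view s))" "ev e1 (view s) < B"
    using Bin.prems ev_words by auto
  have val: "reg s2 (2 * t + 1) = ev e1 (view s)" using s1 s2 by auto
  have "exec B (Arith f (2 * t + 1) (2 * t + 1) (2 * Suc t + 1)) s2 1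
      (s2\<lparr>reg := (reg s2)(2 * t + 1 := eval_op f (reg s2 (2 * t + 1)) (reg s2 (2 * Suc t + 1)))\<rparr>)"
    by (rule exec.Arith) (simp only: val s2(3) eval_op_words[OF ops])
  from exec.Seq[OF exec.Seq[OF s1(1) s2(1)] this] show ?case
    using s1 s2 val by (auto intro!: exI)
qed

lemma wp_sound:
  assumes "wp B c Q (view s)" "words B (view s)"
  shows "\<exists>t s'. exec B (compile c) s t s' \<and> Q (view s') t \<and> words B (view s')"
  using assms
proof (induction c arbitrary: Q s)
  case (Asg x e)
  obtain s' where s': "exec B (ecomp e 0) s (ecost e) s'" "view s' = view s" "reg s' 1 = ev e (view s)"
    using exec_ecomp[of B e s 0] Asg by auto
  have "words B (set_reg x (ev e (view s)) (view s))"
    using Asg ev_words[of B "view s" e] by (auto simp: words_def)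
  then show ?case
    using exec.Seq[OF s'(1) exec.Move[of B "2 * x" 1 s']] Asg.prems s' by (auto intro!: exI)
next
  case (Put a e1 e2)
  obtain s1 where s1: "exec B (ecomp e1 0) s (ecost e1) s1" "view s1 = view s"
    "reg s1 1 = ev e1 (view s)"
    using exec_ecomp[of B e1 s 0] Put by auto
  obtain s2 where s2: "exec B (ecomp e2 1) s1 (ecost e2) s2" "view s2 = view s"
    "reg s2 3 = ev e2 (view s)" "reg s2 1 = ev e1 (view s)"
    using exec_ecomp[of B e2 s1 1] Put s1 by (auto simp: numeral_3_eq_3)
  have "arr s2 = arr s" using s2(2) by (metis view_sel(2))
  moreover have "words B (set_arr a (ev e1 (view s)) (ev e2 (view s)) (view s))"
    using Put ev_words[of B "view s" e2] by (auto simp: words_def)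
  ultimately show ?case
    using exec.Seq[OF exec.Seq[OF s1(1) s2(1)] exec.Store[of B a 1 3 s2]] Put.prems s2
    by (auto intro!: exI)
next
  case (SSeq c1 c2)
  from SSeq.IH(1)[of "\<lambda>s1 t1. wp B c2 (\<lambda>s2 t2. Q s2 (t1 + t2)) s1" s] SSeq.prems
  obtain t1 s1 where 1: "exec B (compile c1) s t1 s1" "wp B c2 (\<lambda>s2 t2. Q s2 (t1 + t2)) (view s1)"
    "words B (view s1)" by auto
  from SSeq.IH(2)[OF 1(2,3)] 1(1) show ?case by (auto intro: exec.Seq)
next
  case (IF e c1 c2)
  obtain s' where s': "exec B (ecomp e 0) s (ecost e) s'" "view s' = view s" "reg s' 1 = ev e (view s)"
    using exec_ecomp[of B e s 0] IF by auto
  show ?case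
  proof (cases "ev e (view s) = 0")
    case True
    with IF.IH(2)[of "\<lambda>s1 t1. Q s1 (t1 + ecost e + 1)" s'] IF.prems s'(2)
    obtain t s2 where "exec B (compile c2) s' t s2" "Q (view s2) (t + ecost e + 1)" "words B (view s2)"
      by auto
    with exec.Seq[OF s'(1) exec.IfFalse[of s' 1 B "compile c2" t s2 "compile c1"]] True s'(3)
    show ?thesis by (auto simp: ac_simps intro!: exI)
  next
    case False
    with IF.IH(1)[of "\<lambda>s1 t1. Q s1 (t1 + ecost e + 1)" s'] IF.prems s'(2)
    obtain t s2 where "exec B (compile c1) s' t s2" "Q (view s2) (t + ecost e + 1)" "words B (view s2)"
      by auto
    with exec.Seq[OF s'(1) exec.IfTrue[of s' 1 B "compile c1" t s2 "compile c2"]] False s'(3)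
    show ?thesis by (auto simp: ac_simps intro!: exI)
  qed
next
  case (WHILE e c)
  then obtain n where "whl B e (wp B c) n Q (view s)" by auto
  \<comment> \<open>The machine loop starts only after the first evaluation of the condition. The
    state \<open>s0\<close> is exposed so that the evaluation ending one round can be identified
    with the one that precedes the rest of the loop.\<close>
  then have "\<exists>t s' s0. exec B (ecomp e 0) s (ecost e) s0 \<and>
      exec B (While 1 (Seq (compile c) (ecomp e 0))) s0 t s' \<and> Q (view s') (ecost e + t) \<and> words B (view s')"
    using WHILE.prems(2)
  proof (induction n arbitrary: Q s)
    case (Suc n)
    obtain s' where s': "exec B (ecomp e 0) s (ecost e) s'" "view s' = view s" "reg s' 1 = ev e (view s)"
      using exec_ecomp[of B e s 0] Suc by auto
    show ?case
    proof (cases "ev e (view s) = 0")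
      case True
      then show ?thesis using s' Suc.prems exec.WhileFalse[of s' 1 B]
        by (metis whl.simps(2))
    next
      case False
      have "wp B c (\<lambda>s1 t1. whl B e (wp B c) n (\<lambda>s2 t2. Q s2 (t1 + t2 + ecost e + 1)) s1) (view s')"
        using Suc.prems(1) False s'(2) by simp
      from WHILE.IH[OF this] Suc.prems(2) s'(2) obtain t1 s1 where
        1: "exec B (compile c) s' t1 s1"
          "whl B e (wp B c) n (\<lambda>s2 t2. Q s2 (t1 + t2 + ecost e + 1)) (view s1)"
          "words B (view s1)" by auto
      from Suc.IH[OF 1(2,3)] obtain t2 s2 s3 where
        2: "exec B (ecomp e 0) s1 (ecost e) s3"
          "exec B (While 1 (Seq (compile c) (ecomp e 0))) s3 t2 s2"
          "Q (view s2) (t1 + (ecost e + t2) + ecost e + 1)" "words B (view s2)" by auto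
      have "exec B (While 1 (Seq (compile c) (ecomp e 0))) s' ((t1 + ecost e) + t2 + 1) s2"
        using exec.WhileTrue[OF _ exec.Seq[OF 1(1) 2(1)] 2(2)] False s'(3) by auto
      with 2(3,4) s'(1) show ?thesis
        by (intro exI[of _ "(t1 + ecost e) + t2 + 1"] exI[of _ s2] exI[of _ s']) (auto simp: ac_simps)
    qed
  qed simp
  then show ?case by (auto intro: exec.Seq)
qed

section \<open>Frames and proof rules for loops\<close>

primrec mv :: "scom \<Rightarrow> nat set" where
  "mv (Asg x e) = {x}"
| "mv (Put a e1 e2) = {}"
| "mv (c1 ;; c2) = mv c1 \<union> mv c2"
| "mv (IF e c1 c2) = mv c1 \<union> mv c2"
| "mv (WHILE e c) = mv c"

primrec ma :: "scom \<Rightarrow> nat set" where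
  "ma (Asg x e) = {}"
| "ma (Put a e1 e2) = {a}"
| "ma (c1 ;; c2) = ma c1 \<union> ma c2"
| "ma (IF e c1 c2) = ma c1 \<union> ma c2"
| "ma (WHILE e c) = ma c"

definition frame :: "nat set \<Rightarrow> nat set \<Rightarrow> state \<Rightarrow> state \<Rightarrow> bool" where
  "frame X Y s s' \<longleftrightarrow> (\<forall>x. x \<notin> X \<longrightarrow> reg s' x = reg s x) \<and> (\<forall>a. a \<notin> Y \<longrightarrow> arr s' a = arr s a)"

lemma frame_refl [simp]: "frame X Y s s"
  by (simp add: frame_def)

lemma frame_trans: "frame X Y s s' \<Longrightarrow> frame X Y s' s'' \<Longrightarrow> frame X Y s s''"
  by (simp add: frame_def)

lemma frame_mono: "frame X Y s s' \<Longrightarrow> X \<subseteq> X' \<Longrightarrow> Y \<subseteq> Y' \<Longrightarrow> frame X' Y' s s'"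
  by (auto simp: frame_def)

lemma whl_mono:
  assumes w: "\<And>Q Q' s. w Q s \<Longrightarrow> (\<And>s' t. frame X Y s s' \<Longrightarrow> Q s' t \<Longrightarrow> Q' s' t) \<Longrightarrow> w Q' s"
  shows "whl B e w n Q s \<Longrightarrow> (\<And>s' t. frame X Y s s' \<Longrightarrow> Q s' t \<Longrightarrow> Q' s' t) \<Longrightarrow> whl B e w n Q' s"
proof (induction n arbitrary: Q Q' s)
  case (Suc n)
  show ?case
  proof (cases "ev e s = 0")
    case True
    then show ?thesis using Suc.prems by simp
  next
    case False
    have "w (\<lambda>s1 t1. whl B e w n (\<lambda>s2 t2. Q' s2 (t1 + t2 + ecost e + 1)) s1) s"
    proof (rule w)
      show "w (\<lambda>s1 t1. whl B e w n (\<lambda>s2 t2. Q s2 (t1 + t2 + ecost e + 1)) s1) s"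
        using Suc.prems(1) False by simp
    next
      fix s1 t1
      assume "frame X Y s s1" and 1: "whl B e w n (\<lambda>s2 t2. Q s2 (t1 + t2 + ecost e + 1)) s1"
      then show "whl B e w n (\<lambda>s2 t2. Q' s2 (t1 + t2 + ecost e + 1)) s1"
        by (intro Suc.IH[OF 1] Suc.prems(2)) (auto intro: frame_trans)
    qed
    then show ?thesis using False Suc.prems(1) by simp
  qed
qed simp

text \<open>Consequence rule with the frame built in: the new postcondition may use that only
  \<open>mv c\<close> and \<open>ma c\<close> have changed. Specifications of subprograms can
  therefore be silent about everything they leave alone.\<close>

lemma wp_mono:
  "wp B c Q s \<Longrightarrow> (\<And>s' t. frame (mv c) (ma c) s s' \<Longrightarrow> Q s' t \<Longrightarrow> Q' s' t) \<Longrightarrow> wp B c Q' s"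
proof (induction c arbitrary: Q Q' s)
  case (Asg x e)
  then show ?case by (auto simp: frame_def)
next
  case (Put a e1 e2)
  then show ?case by (auto simp: frame_def)
next
  case (SSeq c1 c2)
  show ?case
    unfolding wp.simps
  proof (rule SSeq.IH(1))
    show "wp B c1 (\<lambda>s1 t1. wp B c2 (\<lambda>s2 t2. Q s2 (t1 + t2)) s1) s" using SSeq.prems by simp
  next
    fix s1 t1
    assume f: "frame (mv c1) (ma c1) s s1" and w: "wp B c2 (\<lambda>s2 t2. Q s2 (t1 + t2)) s1"
    show "wp B c2 (\<lambda>s2 t2. Q' s2 (t1 + t2)) s1"
    proof (rule SSeq.IH(2)[OF w], rule SSeq.prems(2))
      fix s2 t assume "frame (mv c2) (ma c2) s1 s2"
      then show "frame (mv (c1 ;; c2)) (ma (c1 ;; c2)) s s2"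
        using f by (auto intro: frame_trans[of _ _ s s1] elim: frame_mono)
    qed
  qed
next
  case (IF e c1 c2)
  show ?case
  proof (cases "ev e s = 0")
    case True
    have "wp B c2 (\<lambda>s1 t1. Q' s1 (t1 + ecost e + 1)) s"
      by (rule IF.IH(2)[of "\<lambda>s1 t1. Q s1 (t1 + ecost e + 1)"])
        (use True IF.prems in \<open>auto elim!: frame_mono intro!: IF.prems(2)\<close>)
    then show ?thesis using True IF.prems(1) by simp
  next
    case False
    have "wp B c1 (\<lambda>s1 t1. Q' s1 (t1 + ecost e + 1)) s"
      by (rule IF.IH(1)[of "\<lambda>s1 t1. Q s1 (t1 + ecost e + 1)"])
        (use False IF.prems in \<open>auto elim!: frame_mono intro!: IF.prems(2)\<close>)
    then show ?thesis using False IF.prems(1) by simp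
  qed
next
  case (WHILE e c)
  from WHILE.prems(1) obtain n where n: "whl B e (wp B c) n Q s" by auto
  have "whl B e (wp B c) n Q' s"
  proof (rule whl_mono[where w = "wp B c" and X = "mv c" and Y = "ma c", OF _ n])
    fix Q Q' :: post and s
    assume "wp B c Q s" "\<And>s' t. frame (mv c) (ma c) s s' \<Longrightarrow> Q s' t \<Longrightarrow> Q' s' t"
    then show "wp B c Q' s" by (rule WHILE.IH)
  qed (use WHILE.prems(2) in simp)
  then show ?case by auto
qed

lemma wp_Asg_Num:
  "n < B \<Longrightarrow> wp B c (\<lambda>s' t. Q s' (2 + t)) (set_reg x n s) \<Longrightarrow> wp B (Asg x (Num n) ;; c) Q s"
  by simp

lemma wp_Asg_seq:
  "safe B e s \<Longrightarrow> wp B c (\<lambda>s' t. Q s' (ecost e + 1 + t)) (set_reg x (ev e s) s) \<Longrightarrow> wp B (Asg x e ;; c) Q s"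
  by simp

lemma wp_IF_true:
  "safe B e s \<Longrightarrow> ev e s \<noteq> 0 \<Longrightarrow> wp B c1 (\<lambda>s1 t1. Q s1 (t1 + ecost e + 1)) s \<Longrightarrow> wp B (IF e c1 c2) Q s"
  by simp

lemma wp_IF_false:
  "safe B e s \<Longrightarrow> ev e s = 0 \<Longrightarrow> wp B c2 (\<lambda>s1 t1. Q s1 (t1 + ecost e + 1)) s \<Longrightarrow> wp B (IF e c1 c2) Q s"
  by simp

lemma wp_seqI:
  "wp B c1 R s \<Longrightarrow> (\<And>s1 t1. R s1 t1 \<Longrightarrow> wp B c2 (\<lambda>s2 t2. Q s2 (t1 + t2)) s1) \<Longrightarrow> wp B (c1 ;; c2) Q s"
  unfolding wp.simps(3) by (erule wp_mono) simp

text \<open>The measure serves twice, for termination and for the number of rounds in the running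
  time.\<close>

lemma wp_WHILE:
  fixes meas :: "state \<Rightarrow> nat"
  assumes init: "I s0"
    and safe: "\<And>s. I s \<Longrightarrow> frame (mv c) (ma c) s0 s \<Longrightarrow> safe B e s"
    and body: "\<And>s. I s \<Longrightarrow> frame (mv c) (ma c) s0 s \<Longrightarrow> ev e s \<noteq> 0 \<Longrightarrow>
      wp B c (\<lambda>s' t. I s' \<and> meas s' < meas s \<and> t \<le> T) s"
    and fin: "\<And>s t. I s \<Longrightarrow> frame (mv c) (ma c) s0 s \<Longrightarrow> ev e s = 0 \<Longrightarrow>
      t \<le> meas s0 * (T + ecost e + 1) + ecost e + 1 \<Longrightarrow> Q s t"
  shows "wp B (WHILE e c) Q s0"
proof -
  have main: "whl B e (wp B c) (Suc m) Q' s"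
    if "I s" "frame (mv c) (ma c) s0 s" "meas s \<le> m"
      "\<And>s' t. I s' \<Longrightarrow> frame (mv c) (ma c) s0 s' \<Longrightarrow> ev e s' = 0 \<Longrightarrow>
         t \<le> m * (T + ecost e + 1) + ecost e + 1 \<Longrightarrow> Q' s' t" for s m Q'
    using that
  proof (induction m arbitrary: s Q')
    case 0
    have "ev e s = 0"
    proof (rule ccontr)
      assume "ev e s \<noteq> 0"
      from body[OF 0(1,2) this] have "wp B c (\<lambda>_ _. False) s" by (rule wp_mono) (use 0(3) in auto)
      \<comment> \<open>Law of the excluded miracle: no program establishes \<open>False\<close>. At
        measure 0 the body would have to lower the measure further, so the test must fail.\<close>
      moreover have "\<not> wp B c (\<lambda>_ _. False) s" for s
      proof (induction c arbitrary: s)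
        case (WHILE e c)
        have "\<not> whl B e (wp B c) n (\<lambda>_ _. False) s" for n
        proof (induction n arbitrary: s)
          case (Suc n)
          then show ?case using WHILE by simp
        qed simp
        then show ?case by simp
      qed simp_all
      ultimately show False by blast
    qed
    then show ?case using 0 safe by simp
  next
    case (Suc m)
    show ?case
    proof (cases "ev e s = 0")
      case True
      then show ?thesis using Suc.prems safe by simp
    next
      case False
      have "wp B c (\<lambda>s1 t1. whl B e (wp B c) (Suc m) (\<lambda>s2 t2. Q' s2 (t1 + t2 + ecost e + 1)) s1) s"
      proof (rule wp_mono[OF body[OF Suc.prems(1,2) False]])
        fix s1 t1
        assume f: "frame (mv c) (ma c) s s1" and *: "I s1 \<and> meas s1 < meas s \<and> t1 \<le> T"
        have f': "frame (mv c) (ma c) s0 s1" using f Suc.prems(2) by (blast intro: frame_trans)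
        show "whl B e (wp B c) (Suc m) (\<lambda>s2 t2. Q' s2 (t1 + t2 + ecost e + 1)) s1"
          by (rule Suc.IH[OF _ f']) (use * Suc.prems(3) in \<open>auto intro!: Suc.prems(4)\<close>)
      qed
      then show ?thesis using safe[OF Suc.prems(1,2)] False by simp
    qed
  qed
  have "whl B e (wp B c) (Suc (meas s0)) Q s0"
    by (rule main[OF init frame_refl order_refl fin])
  then show ?thesis unfolding wp.simps by (rule exI)
qed

text \<open>For loops whose progress is not a function of the state: a relation \<open>J\<close>
  between counters and states suffices, since the least related counter is a measure.\<close>

lemma wp_WHILE_count:
  assumes init: "J m0 s0"
    and safe: "\<And>m s. J m s \<Longrightarrow> safe B e s"
    and body: "\<And>m s. J m s \<Longrightarrow> frame (mv c) (ma c) s0 s \<Longrightarrow> ev e s \<noteq> 0 \<Longrightarrow>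
      wp B c (\<lambda>s' t. (\<exists>m'<m. J m' s') \<and> t \<le> T) s"
    and fin: "\<And>m s t. J m s \<Longrightarrow> frame (mv c) (ma c) s0 s \<Longrightarrow> ev e s = 0 \<Longrightarrow>
      t \<le> m0 * (T + ecost e + 1) + ecost e + 1 \<Longrightarrow> Q s t"
  shows "wp B (WHILE e c) Q s0"
proof (rule wp_WHILE[where I = "\<lambda>s. \<exists>m. J m s" and meas = "\<lambda>s. LEAST m. J m s" and T = T], goal_cases)
  case 1
  then show ?case using init by blast
next
  case (2 s)
  then show ?case using safe by blast
next
  case (3 s)
  then have "J (LEAST m. J m s) s" by (auto intro: LeastI)
  from body[OF this 3(2,3)] show ?case
    by (rule wp_mono) (auto intro: le_less_trans[OF Least_le])
next
  case (4 s t)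
  have "(LEAST m. J m s0) \<le> m0" using init by (rule Least_le)
  then have "t \<le> m0 * (T + ecost e + 1) + ecost e + 1"
    using 4(4) by (meson add_le_mono1 le_trans mult_le_mono1)
  then show ?case using 4 fin by blast
qed

definition FOR :: "nat \<Rightarrow> nat \<Rightarrow> scom \<Rightarrow> scom" where
  "FOR x L c = Asg x (Num 0) ;; WHILE (Var x \<prec> Var L) (c ;; Asg x (Var x \<oplus> Num 1))"

lemma mods_FOR [simp]: "mv (FOR x L c) = insert x (mv c)" "ma (FOR x L c) = ma c"
  by (auto simp: FOR_def)

text \<open>The invariant is required after setting \<open>x\<close> to \<open>Suc j\<close>, as the
  increment belongs to the loop. A round pays 4 for the test and 4 for the increment; the 6 covers
  initialization and the last test.\<close>

lemma wp_FOR: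
  assumes L: "L \<notin> mv c" "x \<noteq> L" "x \<notin> mv c" "reg s0 L < B" "1 < B"
    and init: "I 0 (set_reg x 0 s0)"
    and body: "\<And>j s. j < reg s0 L \<Longrightarrow> I j s \<Longrightarrow> reg s x = j \<Longrightarrow> reg s L = reg s0 L \<Longrightarrow>
      frame (insert x (mv c)) (ma c) s0 s \<Longrightarrow>
      wp B c (\<lambda>s' t. t \<le> T \<and> I (Suc j) (set_reg x (Suc j) s')) s"
    and fin: "\<And>s t. I (reg s0 L) s \<Longrightarrow> reg s x = reg s0 L \<Longrightarrow>
      frame (insert x (mv c)) (ma c) s0 s \<Longrightarrow> t \<le> reg s0 L * (T + 8) + 6 \<Longrightarrow> Q s t"
  shows "wp B (FOR x L c) Q s0"
proof -
  let ?n = "reg s0 L"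
  let ?s0 = "set_reg x 0 s0"
  let ?c = "c ;; Asg x (Var x \<oplus> Num 1)"
  have "wp B (WHILE (Var x \<prec> Var L) ?c) (\<lambda>s t. Q s (2 + t)) ?s0"
  proof (rule wp_WHILE[where I = "\<lambda>s. reg s x \<le> ?n \<and> reg s L = ?n \<and> I (reg s x) s" and
        meas = "\<lambda>s. ?n - reg s x" and T = "T + 4"], goal_cases)
    case 1
    then show ?case using init L by simp
  next
    case (2 s)
    then show ?case by simp
  next
    case (3 s)
    have f: "frame (insert x (mv c)) (ma c) s0 s"
      using 3(2) by (auto simp: frame_def)
    have j: "reg s x < ?n" using 3 by auto
    show ?case
      unfolding wp.simps
    proof (rule wp_mono[OF body[OF j _ refl _ f]], goal_cases)
      case 1 show ?case using 3 by simp
    next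
      case 2 show ?case using 3 by simp
    next
      case (3 s' t)
      have "reg s' x = reg s x" "reg s' L = reg s L" using 3(1) L by (auto simp: frame_def)
      then show ?case using 3(2) j L
        using \<open>reg s x \<le> reg s0 L \<and> reg s L = reg s0 L \<and> I (reg s x) s\<close> by auto
    qed
  next
    case (4 s t)
    have f: "frame (insert x (mv c)) (ma c) s0 s"
      using 4(2) by (auto simp: frame_def)
    have "reg s x = ?n" using 4 by auto
    moreover have "2 + t \<le> ?n * (T + 8) + 6" using 4(4) by (auto simp: algebra_simps)
    ultimately show ?case using fin[OF _ _ f, of "2 + t"] 4(1) by simp
  qed
  then show ?thesis using L by (simp add: FOR_def)
qed

section \<open>Small families with sum zero\<close>

text \<open>House-monotone apportionment with upper quota: \<open>c t\<close> distributes
  \<open>t\<close> seats among kinds of weight \<open>m\<close>. Some kind always deserves the next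
  seat, since \<open>M * c \<tau> \<ge> Suc t * m \<tau>\<close> for all kinds would sum to
  \<open>M * t \<ge> Suc t * M\<close>.\<close>

lemma balanced_order:
  fixes m :: "'t \<Rightarrow> nat"
  assumes "finite T" and M: "M = (\<Sum>\<tau>\<in>T. m \<tau>)" "M > 0"
  obtains c :: "nat \<Rightarrow> 't \<Rightarrow> nat" where
    "\<And>t. (\<Sum>\<tau>\<in>T. c t \<tau>) = t" "\<And>t \<tau>. c t \<tau> \<le> c (Suc t) \<tau>"
    "\<And>t \<tau>. \<tau> \<in> T \<Longrightarrow> M * c t \<tau> < t * m \<tau> + M"
proof -
  have step: "\<exists>c'. ((\<Sum>\<tau>\<in>T. c' \<tau>) = Suc t \<and> (\<forall>\<tau>\<in>T. M * c' \<tau> < Suc t * m \<tau> + M)) \<and> (\<forall>\<tau>. c \<tau> \<le> c' \<tau>)"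
    if c: "(\<Sum>\<tau>\<in>T. c \<tau>) = t \<and> (\<forall>\<tau>\<in>T. M * c \<tau> < t * m \<tau> + M)" for c :: "'t \<Rightarrow> nat" and t
  proof -
    have "\<exists>\<tau>\<in>T. M * c \<tau> < Suc t * m \<tau>"
    proof (rule ccontr)
      assume "\<not> ?thesis"
      then have "(\<Sum>\<tau>\<in>T. Suc t * m \<tau>) \<le> (\<Sum>\<tau>\<in>T. M * c \<tau>)"
        by (intro sum_mono) (auto simp: not_less)
      then have "Suc t * M \<le> M * t"
        using c M by (simp only: sum_distrib_left[symmetric])
      then show False using M(2) by simp
    qed
    then obtain \<tau> where \<tau>: "\<tau> \<in> T" "M * c \<tau> < Suc t * m \<tau>" by blast
    have "(\<Sum>\<sigma>\<in>T. (c(\<tau> := Suc (c \<tau>))) \<sigma>) = Suc t"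
      using \<tau>(1) \<open>finite T\<close> c by (simp add: sum.remove[of T \<tau>] cong: sum.cong)
        (simp add: sum.remove[of T \<tau>])
    moreover have "M * (c(\<tau> := Suc (c \<tau>))) \<sigma> < Suc t * m \<sigma> + M" if "\<sigma> \<in> T" for \<sigma>
      using c \<tau> that by (cases "\<sigma> = \<tau>") (auto intro: less_le_trans)
    ultimately show ?thesis by (intro exI[of _ "c(\<tau> := Suc (c \<tau>))"]) auto
  qed
  have "\<exists>c. \<forall>t. ((\<Sum>\<tau>\<in>T. c t \<tau>) = t \<and> (\<forall>\<tau>\<in>T. M * c t \<tau> < t * m \<tau> + M)) \<and> (\<forall>\<tau>. c t \<tau> \<le> c (Suc t) \<tau>)"
    by (rule dependent_nat_choice) (use M step in \<open>auto intro!: exI[of _ "\<lambda>_. 0"]\<close>)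
  then show thesis using that by blast
qed

text \<open>After \<open>t\<close> vectors each of the \<open>P \<le> 3 ^ K\<close> kinds has been
  taken about \<open>t * m \<tau> / M\<close> times, with an error of at most \<open>P\<close>. The
  proportional parts sum to zero, so each coordinate of a partial sum is at most
  \<open>P * P \<le> 9 ^ K\<close> in absolute value. The box has at most \<open>3 * 9 ^ K\<close>
  integers per coordinate, hence fewer points than there are partial sums.\<close>

lemma zero_sum_split:
  fixes w :: "'z \<Rightarrow> nat \<Rightarrow> int"
  assumes Z: "finite Z" and w: "\<And>z i. z \<in> Z \<Longrightarrow> i < K \<Longrightarrow> w z i \<in> {-1, 0, 1}"
    and zero: "\<And>i. i < K \<Longrightarrow> (\<Sum>z\<in>Z. w z i) = 0"
    and large: "card Z > (3 * 9 ^ K) ^ K"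
  obtains Y where "Y \<subset> Z" "Y \<noteq> {}" "\<And>i. i < K \<Longrightarrow> (\<Sum>z\<in>Y. w z i) = 0"
proof -
  define h where "h z = restrict (w z) {..<K}" for z
  define T where "T = h ` Z"
  define m where "m \<tau> = card {z \<in> Z. h z = \<tau>}" for \<tau>
  define M where "M = card Z"
  define P where "P = card T"
  have T: "finite T" using Z by (simp add: T_def)
  have TP: "T \<subseteq> ({..<K} \<rightarrow>\<^sub>E {-1, 0, 1})"
  proof
    fix \<tau> assume "\<tau> \<in> T"
    then obtain z where z: "z \<in> Z" "\<tau> = restrict (w z) {..<K}" by (auto simp: T_def h_def)
    show "\<tau> \<in> ({..<K} \<rightarrow>\<^sub>E {-1, 0, 1})"
      unfolding z(2) by (rule restrict_PiE[THEN iffD2, OF Pi_I]) (use w[OF z(1)] in simp)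
  qed
  have "card ({..<K} \<rightarrow>\<^sub>E {-1, 0, 1 :: int}) = 3 ^ K" by (simp add: card_PiE numeral_3_eq_3)
  moreover have "finite ({..<K} \<rightarrow>\<^sub>E {-1, 0, 1 :: int})" by (intro finite_PiE) auto
  ultimately have "P \<le> 3 ^ K"
    using card_mono[OF _ TP] by (simp add: P_def)
  then have "P ^ 2 \<le> (3 ^ K) ^ 2" by (rule power_mono) simp
  moreover have "((3 :: nat) ^ K) ^ 2 = (3 ^ 2) ^ K" by (metis power_mult mult.commute)
  ultimately have P2: "P ^ 2 \<le> 9 ^ K" by simp
  have hw: "h z i = w z i" if "i < K" for z i using that by (simp add: h_def)
  have Mm: "M = (\<Sum>\<tau>\<in>T. m \<tau>)"
    unfolding M_def T_def m_def using sum.image_gen[OF Z, of "\<lambda>_. 1 :: nat" h] by simp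
  have Mpos: "M > 0" using large by (simp add: M_def)
  have mz: "(\<Sum>\<tau>\<in>T. int (m \<tau>) * \<tau> i) = 0" if "i < K" for i
  proof -
    have "0 = (\<Sum>z\<in>Z. h z i)" using zero[OF that] hw[OF that] by simp
    also have "\<dots> = (\<Sum>\<tau>\<in>T. \<Sum>z\<in>{z \<in> Z. h z = \<tau>}. h z i)"
      unfolding T_def by (rule sum.image_gen[OF Z])
    also have "\<dots> = (\<Sum>\<tau>\<in>T. int (m \<tau>) * \<tau> i)"
      by (rule sum.cong) (auto simp: m_def)
    finally show ?thesis by simp
  qed
  obtain c where c: "\<And>t. (\<Sum>\<tau>\<in>T. c t \<tau>) = t" "\<And>t \<tau>. c t \<tau> \<le> c (Suc t) \<tau>"
    "\<And>t \<tau>. \<tau> \<in> T \<Longrightarrow> M * c t \<tau> < t * m \<tau> + M"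
    using balanced_order[OF T Mm Mpos] by metis
  have cmono: "c t \<tau> \<le> c t' \<tau>" if "t \<le> t'" for t t' \<tau>
    by (rule lift_Suc_mono_le[of "\<lambda>t. c t \<tau>", OF c(2) that])
  \<comment> \<open>At \<open>t = M\<close> the strict quota gives
    \<open>c M \<tau> < m \<tau> + 1\<close>, so the apportionment never asks for more vectors of a
    kind than there are.\<close>
  have cM: "c t \<tau> \<le> m \<tau>" if "t \<le> M" "\<tau> \<in> T" for t \<tau>
  proof -
    have "M * c M \<tau> < M * (m \<tau> + 1)" using c(3)[OF that(2), of M] by simp
    then have "c M \<tau> < m \<tau> + 1" unfolding mult_less_cancel1 by (rule conjunct2)
    then have "c M \<tau> \<le> m \<tau>" by simp
    then show ?thesis using cmono[OF that(1), of \<tau>] by simp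
  qed
  define p where "p t i = (\<Sum>\<tau>\<in>T. int (c t \<tau>) * \<tau> i)" for t and i :: nat
  \<comment> \<open>The quota bounds only the surplus of a kind. The deviations sum to zero, so a
    deficit is paid for by the surpluses of the other kinds, each at most \<open>M\<close>.\<close>
  have dev: "\<bar>int M * int (c t \<tau>) - int t * int (m \<tau>)\<bar> \<le> int P * int M" if \<tau>: "\<tau> \<in> T" for t \<tau>
  proof -
    let ?d = "\<lambda>\<sigma>. int M * int (c t \<sigma>) - int t * int (m \<sigma>)"
    have up: "?d \<sigma> \<le> int M" if "\<sigma> \<in> T" for \<sigma>
      using c(3)[OF that, of t] by (simp flip: of_nat_mult of_nat_add add: algebra_simps)
    have "(\<Sum>\<sigma>\<in>T. ?d \<sigma>) = int M * int (\<Sum>\<sigma>\<in>T. c t \<sigma>) - int t * int (\<Sum>\<sigma>\<in>T. m \<sigma>)"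
      by (simp add: sum_subtractf sum_distrib_left)
    also have "\<dots> = 0" using c(1)[of t] Mm by simp
    finally have "?d \<tau> + (\<Sum>\<sigma>\<in>T - {\<tau>}. ?d \<sigma>) = 0" using sum.remove[OF T \<tau>, of ?d] by simp
    moreover have "(\<Sum>\<sigma>\<in>T - {\<tau>}. ?d \<sigma>) \<le> (\<Sum>\<sigma>\<in>T - {\<tau>}. int M)"
      by (rule sum_mono) (use up in auto)
    moreover have "(\<Sum>\<sigma>\<in>T - {\<tau>}. int M) \<le> int P * int M"
      using T \<tau> by (simp add: P_def card_Diff_singleton mult_right_mono)
    moreover have "int M \<le> int P * int M"
      using T \<tau> Mpos by (auto simp: P_def card_gt_0_iff Suc_le_eq)
    ultimately show ?thesis using up[OF \<tau>] by linarith
  qed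
  have pb: "\<bar>p t i\<bar> \<le> 9 ^ K" if i: "i < K" for t i
  proof -
    have "(\<Sum>\<tau>\<in>T. int t * (int (m \<tau>) * \<tau> i)) = 0"
      by (simp only: sum_distrib_left[symmetric] mz[OF i])
    then have "int M * p t i = (\<Sum>\<tau>\<in>T. (int M * int (c t \<tau>) - int t * int (m \<tau>)) * \<tau> i)"
      by (simp add: p_def sum_distrib_left left_diff_distrib sum_subtractf mult.assoc)
    also have "\<bar>\<dots>\<bar> \<le> (\<Sum>\<tau>\<in>T. \<bar>(int M * int (c t \<tau>) - int t * int (m \<tau>)) * \<tau> i\<bar>)"
      by (rule sum_abs)
    also have "\<dots> \<le> (\<Sum>\<tau>\<in>T. int P * int M)"
    proof (rule sum_mono)
      fix \<tau> assume \<tau>: "\<tau> \<in> T"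
      have "\<tau> i \<in> {-1, 0, 1}" using PiE_mem[OF subsetD[OF TP \<tau>], of i] i by simp
      then have "\<bar>\<tau> i\<bar> \<le> 1" by auto
      then have "\<bar>(int M * int (c t \<tau>) - int t * int (m \<tau>)) * \<tau> i\<bar> \<le> (int P * int M) * 1"
        unfolding abs_mult by (intro mult_mono dev[OF \<tau>]) auto
      then show "\<bar>(int M * int (c t \<tau>) - int t * int (m \<tau>)) * \<tau> i\<bar> \<le> int P * int M" by simp
    qed
    also have "\<dots> = int M * int (P ^ 2)" by (simp add: P_def power2_eq_square)
    finally have "int M * \<bar>p t i\<bar> \<le> int M * int (P ^ 2)" by (simp add: abs_mult)
    then have "\<bar>p t i\<bar> \<le> int (P ^ 2)" using Mpos by simp
    also have "\<dots> \<le> int (9 ^ K)" using P2 by (simp only: of_nat_le_iff)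
    finally show ?thesis by simp
  qed
  let ?F = "\<lambda>t. restrict (p t) {..<K}"
  let ?R = "{..<K} \<rightarrow>\<^sub>E {- (9 ^ K) .. 9 ^ K :: int}"
  have "card ?R = (nat (2 * 9 ^ K + 1)) ^ K"
    by (simp add: card_PiE)
  also have "\<dots> \<le> (3 * 9 ^ K) ^ K"
  proof (rule power_mono)
    have "2 * 9 ^ K + 1 \<le> (3 * 9 ^ K :: int)" by simp
    then show "nat (2 * 9 ^ K + 1) \<le> 3 * 9 ^ K" by (simp add: nat_le_iff)
  qed simp
  also have "\<dots> < card {..<M}" using large by (simp add: M_def)
  finally have lt: "card ?R < card {..<M}" .
  have sub: "?F ` {..<M} \<subseteq> ?R"
  proof (rule image_subsetI)
    fix t
    have "p t i \<in> {- (9 ^ K) .. 9 ^ K}" if "i < K" for i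
      using pb[OF that, of t] by (simp add: abs_le_iff)
    then show "?F t \<in> ?R" by (simp only: restrict_PiE_iff) simp
  qed
  have finR: "finite ?R" by (simp add: finite_PiE)
  have "\<not> inj_on ?F {..<M}"
  proof
    assume "inj_on ?F {..<M}"
    then have "card {..<M} \<le> card ?R" by (rule card_inj_on_le[OF _ sub finR])
    then show False using lt by simp
  qed
  \<comment> \<open>Both indices lie below \<open>M\<close>, so \<open>0 < t2 - t1 < M\<close> and
    the vectors taken between them form a nonempty proper subset.\<close>
  then obtain t1 t2 where t: "t1 < t2" "t2 < M" "?F t1 = ?F t2"
    unfolding inj_on_def by (metis lessThan_iff linorder_neqE_nat)
  have peq: "p t1 i = p t2 i" if "i < K" for i
    using fun_cong[OF t(3), of i] that by simp
  have "\<exists>Y. Y \<subseteq> {z \<in> Z. h z = \<tau>} \<and> card Y = c t2 \<tau> - c t1 \<tau>" if "\<tau> \<in> T" for \<tau>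
  proof -
    have "c t2 \<tau> - c t1 \<tau> \<le> m \<tau>" using cM[OF _ that, of t2] t by simp
    then show ?thesis unfolding m_def by (meson obtain_subset_with_card_n)
  qed
  then obtain Y where Y: "\<And>\<tau>. \<tau> \<in> T \<Longrightarrow> Y \<tau> \<subseteq> {z \<in> Z. h z = \<tau>}"
    "\<And>\<tau>. \<tau> \<in> T \<Longrightarrow> card (Y \<tau>) = c t2 \<tau> - c t1 \<tau>" by metis
  have finY: "finite (Y \<tau>)" if "\<tau> \<in> T" for \<tau>
    using Y(1)[OF that] Z by (auto intro: finite_subset)
  have disj: "Y \<tau> \<inter> Y \<sigma> = {}" if "\<tau> \<in> T" "\<sigma> \<in> T" "\<tau> \<noteq> \<sigma>" for \<tau> \<sigma>
    using Y(1)[OF that(1)] Y(1)[OF that(2)] that(3) by auto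
  let ?Y = "\<Union>\<tau>\<in>T. Y \<tau>"
  have "card ?Y = (\<Sum>\<tau>\<in>T. c t2 \<tau> - c t1 \<tau>)"
    using card_UN_disjoint[OF T, of Y] finY disj Y(2) by simp
  also have "\<dots> = (\<Sum>\<tau>\<in>T. c t2 \<tau>) - (\<Sum>\<tau>\<in>T. c t1 \<tau>)"
    by (rule sum_subtractf_nat) (use cmono t in auto)
  finally have cardY: "card ?Y = t2 - t1" using c(1) by simp
  have subY: "?Y \<subseteq> Z" using Y(1) by blast
  show thesis
  proof (rule that[of ?Y])
    show "?Y \<subset> Z" using subY cardY t by (auto simp: M_def)
    show "?Y \<noteq> {}" using cardY t by (metis card.empty zero_less_diff less_not_refl)
  next
    fix i assume i: "i < K"
    have "(\<Sum>z\<in>?Y. w z i) = (\<Sum>\<tau>\<in>T. \<Sum>z\<in>Y \<tau>. w z i)"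
      by (rule sum.UNION_disjoint[OF T]) (use finY disj in auto)
    also have "\<dots> = (\<Sum>\<tau>\<in>T. int (c t2 \<tau> - c t1 \<tau>) * \<tau> i)"
    proof (rule sum.cong[OF refl])
      fix \<tau> assume \<tau>: "\<tau> \<in> T"
      have "(\<Sum>z\<in>Y \<tau>. w z i) = (\<Sum>z\<in>Y \<tau>. \<tau> i)"
        by (rule sum.cong[OF refl]) (use Y(1)[OF \<tau>] hw[OF i] in auto)
      then show "(\<Sum>z\<in>Y \<tau>. w z i) = int (c t2 \<tau> - c t1 \<tau>) * \<tau> i" using Y(2)[OF \<tau>] by simp
    qed
    also have "\<dots> = p t2 i - p t1 i"
      unfolding p_def sum_subtractf[symmetric]
      by (rule sum.cong[OF refl]) (use cmono[of t1 t2] t in \<open>simp add: of_nat_diff left_diff_distrib\<close>)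
    finally show "(\<Sum>z\<in>?Y. w z i) = 0" using peq[OF i] by simp
  qed
qed

text \<open>If a part has sum zero, so does its complement; discarding the one without
  \<open>z0\<close> can be repeated until the family is small.\<close>

lemma zero_sum_small:
  fixes w :: "'z \<Rightarrow> nat \<Rightarrow> int"
  assumes "finite Z" "\<And>z i. z \<in> Z \<Longrightarrow> i < K \<Longrightarrow> w z i \<in> {-1, 0, 1}"
    and "\<And>i. i < K \<Longrightarrow> (\<Sum>z\<in>Z. w z i) = 0" "z0 \<in> Z"
  shows "\<exists>Y\<subseteq>Z. z0 \<in> Y \<and> card Y \<le> (3 * 9 ^ K) ^ K \<and> (\<forall>i<K. (\<Sum>z\<in>Y. w z i) = 0)"
  using assms
proof (induction "card Z" arbitrary: Z rule: less_induct)
  case less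
  show ?case
  proof (cases "card Z > (3 * 9 ^ K) ^ K")
    case False
    then have "card Z \<le> (3 * 9 ^ K) ^ K" by simp
    then show ?thesis
      by (intro exI[of _ Z] conjI allI impI order_refl less.prems(3,4))
  next
    case True
    obtain Y where Y: "Y \<subset> Z" "Y \<noteq> {}" "\<And>i. i < K \<Longrightarrow> (\<Sum>z\<in>Y. w z i) = 0"
      by (rule zero_sum_split[of Z K w]) (use less.prems(1-3) True in simp_all)
    have compl: "(\<Sum>z\<in>Z - Y. w z i) = 0" if "i < K" for i
      using sum.subset_diff[of Y Z "\<lambda>z. w z i"] Y(1) Y(3)[OF that] less.prems(1) less.prems(3)[OF that]
      by auto
    have finY: "finite Y" using Y(1) less.prems(1) by (auto intro: finite_subset)
    define X where "X = (if z0 \<in> Y then Y else Z - Y)"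
    have "X \<subset> Z" using Y(1,2) by (auto simp: X_def)
    have "card X < card Z" using less.prems(1) \<open>X \<subset> Z\<close> by (rule psubset_card_mono)
    moreover have "finite X" using \<open>X \<subset> Z\<close> less.prems(1) by (auto intro: finite_subset)
    moreover have "z0 \<in> X" using less.prems(4) by (simp add: X_def)
    moreover have "(\<Sum>z\<in>X. w z i) = 0" if "i < K" for i using compl Y(3) that by (simp add: X_def)
    moreover have "w z i \<in> {-1, 0, 1}" if "z \<in> X" "i < K" for z i
      using less.prems(2) that \<open>X \<subset> Z\<close> by blast
    ultimately have "\<exists>Y\<subseteq>X. z0 \<in> Y \<and> card Y \<le> (3 * 9 ^ K) ^ K \<and> (\<forall>i<K. (\<Sum>z\<in>Y. w z i) = 0)"
      by (intro less.hyps)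
    then obtain Y' where "Y' \<subseteq> X" "z0 \<in> Y'" "card Y' \<le> (3 * 9 ^ K) ^ K"
      "\<forall>i<K. (\<Sum>z\<in>Y'. w z i) = 0" by (elim exE conjE)
    then show ?thesis
      using \<open>X \<subset> Z\<close> by (intro exI[of _ Y'] conjI) simp_all
  qed
qed

text \<open>Let \<open>D\<close> be the recoded colors and \<open>R\<close> the units of unmet
  demand in a small zero-sum family. Sum zero says that recoding \<open>D\<close> gains in type
  \<open>i\<close> exactly the number of units of type \<open>i\<close> in \<open>R\<close>. This
  number lies between 0 and the unmet demand, so no type loses supply or is oversupplied, and
  \<open>i0\<close> gains because the family was chosen to contain one of its units.\<close>

lemma augment:
  fixes e :: "'j \<Rightarrow> nat \<Rightarrow> nat"
  assumes C: "finite C" and e1: "\<And>j i. e j i \<le> 1"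
    and le: "\<And>i. i < K \<Longrightarrow> (\<Sum>c\<in>C. e (code c) i) \<le> u i"
    and eq: "\<And>i. i < K \<Longrightarrow> (\<Sum>c\<in>C. e (code' c) i) = u i"
    and i0: "i0 < K" "(\<Sum>c\<in>C. e (code c) i0) < u i0"
  obtains D where "D \<subseteq> C" "card D \<le> (3 * 9 ^ K) ^ K"
    "\<And>i. i < K \<Longrightarrow> (\<Sum>c\<in>C. e (if c \<in> D then code' c else code c) i) \<le> u i"
    "\<And>i. i < K \<Longrightarrow> (\<Sum>c\<in>C. e (code c) i) \<le> (\<Sum>c\<in>C. e (if c \<in> D then code' c else code c) i)"
    "(\<Sum>c\<in>C. e (code c) i0) < (\<Sum>c\<in>C. e (if c \<in> D then code' c else code c) i0)"
proof -
  define s where "s i = u i - (\<Sum>c\<in>C. e (code c) i)" for i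
  \<comment> \<open>A unit of unmet demand is a pair of its type and an index, so that equal unit
    vectors remain distinct members of the family.\<close>
  define S where "S = (SIGMA i:{..<K}. {..<s i})"
  define Z where "Z = Inl ` C \<union> Inr ` S"
  define w :: "'a + nat \<times> nat \<Rightarrow> nat \<Rightarrow> int" where
    "w z i = (case z of Inl c \<Rightarrow> int (e (code' c) i) - int (e (code c) i)
                     | Inr q \<Rightarrow> if fst q = i then - 1 else 0)" for z i
  have finS: "finite S" by (simp add: S_def)
  have sumZ: "(\<Sum>z\<in>Inl ` D \<union> Inr ` R. w z i) =
      (\<Sum>c\<in>D. int (e (code' c) i) - int (e (code c) i)) - int (card {q \<in> R. fst q = i})"
    if "D \<subseteq> C" "R \<subseteq> S" for D R i
  proof -
    have fin: "finite D" "finite R" using that C finS by (auto intro: finite_subset)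
    have "(\<Sum>z\<in>Inl ` D \<union> Inr ` R. w z i) = (\<Sum>z\<in>Inl ` D. w z i) + (\<Sum>z\<in>Inr ` R. w z i)"
      by (rule sum.union_disjoint) (use fin in auto)
    also have "(\<Sum>z\<in>Inl ` D. w z i) = (\<Sum>c\<in>D. int (e (code' c) i) - int (e (code c) i))"
      by (subst sum.reindex) (auto simp: w_def)
    also have "(\<Sum>z\<in>Inr ` R. w z i) = (\<Sum>q\<in>R. if fst q = i then - 1 else 0)"
      by (subst sum.reindex) (auto simp: w_def)
    also have "\<dots> = - int (card {q \<in> R. fst q = i})"
      using fin by (simp add: sum.If_cases Int_def)
    finally show ?thesis by simp
  qed
  have cardS: "card {q \<in> S. fst q = i} = s i" if "i < K" for i
  proof -
    have "{q \<in> S. fst q = i} = Pair i ` {..<s i}" using that by (auto simp: S_def)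
    then show ?thesis by (simp add: card_image inj_on_def)
  qed
  have "finite Z" using C finS by (simp add: Z_def)
  moreover have "w z i \<in> {-1, 0, 1}" for z i
  proof (cases z)
    case (Inl c)
    have "e (code' c) i = 0 \<or> e (code' c) i = 1" "e (code c) i = 0 \<or> e (code c) i = 1"
      using e1[of "code' c" i] e1[of "code c" i] by linarith+
    then show ?thesis using Inl by (auto simp: w_def)
  qed (auto simp: w_def)
  moreover have "(\<Sum>z\<in>Z. w z i) = 0" if "i < K" for i
    using sumZ[OF order_refl order_refl, of i] cardS[OF that] le[OF that] eq[OF that]
    by (simp add: Z_def sum_subtractf s_def of_nat_diff flip: of_nat_sum)
  moreover have "Inr (i0, 0) \<in> Z" using i0 by (auto simp: Z_def S_def s_def)
  ultimately obtain Y where Y: "Y \<subseteq> Z" "Inr (i0, 0) \<in> Y" "card Y \<le> (3 * 9 ^ K) ^ K"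
    "\<And>i. i < K \<Longrightarrow> (\<Sum>z\<in>Y. w z i) = 0"
    using zero_sum_small[of Z K w "Inr (i0, 0)"] by blast
  define D where "D = Inl -` Y"
  define R where "R = Inr -` Y"
  have DR: "D \<subseteq> C" "R \<subseteq> S" using Y(1) by (auto simp: D_def R_def Z_def)
  have YDR: "Y = Inl ` D \<union> Inr ` R"
  proof (rule set_eqI)
    fix z show "z \<in> Y \<longleftrightarrow> z \<in> Inl ` D \<union> Inr ` R" by (cases z) (auto simp: D_def R_def)
  qed
  have finY: "finite Y" using Y(1) \<open>finite Z\<close> by (rule finite_subset)
  have fin: "finite D" "finite R" using DR C finS by (auto intro: finite_subset)
  have "card D = card (Inl ` D :: ('a + nat \<times> nat) set)" by (simp add: card_image)
  also have "\<dots> \<le> card Y" by (rule card_mono[OF finY]) (auto simp: YDR)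
  finally have cD: "card D \<le> (3 * 9 ^ K) ^ K" using Y(3) by simp
  have new: "(\<Sum>c\<in>C. e (if c \<in> D then code' c else code c) i)
      = (\<Sum>c\<in>C. e (code c) i) + card {q \<in> R. fst q = i}" if "i < K" for i
  proof -
    have "(\<Sum>c\<in>C. int (e (if c \<in> D then code' c else code c) i))
        = (\<Sum>c\<in>C. int (e (code c) i) + (if c \<in> D then int (e (code' c) i) - int (e (code c) i) else 0))"
      by (rule sum.cong) auto
    also have "\<dots> = (\<Sum>c\<in>C. int (e (code c) i)) + (\<Sum>c\<in>D. int (e (code' c) i) - int (e (code c) i))"
      using C DR(1) by (simp add: sum.distrib flip: sum.inter_restrict) (simp add: Int_absorb1)
    also have "(\<Sum>c\<in>D. int (e (code' c) i) - int (e (code c) i)) = int (card {q \<in> R. fst q = i})"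
      using sumZ[OF DR, of i] Y(4)[OF that] YDR by simp
    finally show ?thesis by (simp flip: of_nat_sum of_nat_add)
  qed
  have cR: "card {q \<in> R. fst q = i} \<le> s i" if "i < K" for i
    unfolding cardS[OF that, symmetric] by (rule card_mono) (use DR(2) finS in auto)
  have "(i0, 0) \<in> {q \<in> R. fst q = i0}" using Y(2) by (simp add: R_def)
  then have pos: "card {q \<in> R. fst q = i0} > 0" using fin by (auto simp: card_gt_0_iff)
  show thesis
  proof (rule that[OF DR(1) cD])
    fix i assume i: "i < K"
    show "(\<Sum>c\<in>C. e (if c \<in> D then code' c else code c) i) \<le> u i"
      using new[OF i] cR[OF i] le[OF i] by (simp add: s_def)
    show "(\<Sum>c\<in>C. e (code c) i) \<le> (\<Sum>c\<in>C. e (if c \<in> D then code' c else code c) i)"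
      using new[OF i] by simp
  next
    show "(\<Sum>c\<in>C. e (code c) i0) < (\<Sum>c\<in>C. e (if c \<in> D then code' c else code c) i0)"
      using new[OF i0(1)] pos by simp
  qed
qed

text \<open>Turns multiplicities back into an assignment: \<open>y j\<close> elements are cut off
  for one value, and the rest is treated by induction.\<close>

lemma realize_counts:
  assumes "finite C" "finite J" "(\<Sum>j\<in>J. y j) = card C"
  obtains code where "\<And>c. c \<in> C \<Longrightarrow> code c \<in> J" "\<And>j. j \<in> J \<Longrightarrow> card {c \<in> C. code c = j} = y j"
proof -
  have "\<exists>code. (\<forall>c\<in>C. code c \<in> J) \<and> (\<forall>j\<in>J. card {c \<in> C. code c = j} = y j)"
    using assms(2,1,3)
  proof (induction J arbitrary: C rule: finite_induct)
    case (insert j J)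
    have "y j \<le> card C" using insert by simp
    then obtain D where D: "D \<subseteq> C" "card D = y j" by (meson obtain_subset_with_card_n)
    have "(\<Sum>j\<in>J. y j) = card (C - D)"
      using insert D by (simp add: card_Diff_subset finite_subset)
    then obtain code where code: "\<forall>c\<in>C - D. code c \<in> J" "\<forall>j\<in>J. card {c \<in> C - D. code c = j} = y j"
      using insert.IH[of "C - D"] insert.prems by auto
    let ?code = "\<lambda>c. if c \<in> D then j else code c"
    have "{c \<in> C. ?code c = j} = D" using D code(1) insert.hyps by auto
    moreover have "{c \<in> C. ?code c = j'} = {c \<in> C - D. code c = j'}" if "j' \<in> J" for j'
      using that insert.hyps by auto
    ultimately show ?case using code D by (intro exI[of _ ?code]) auto
  qed simp
  then show thesis using that by blast
qed

section \<open>Codes of colors\<close>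

lemma digits_of_sum:
  fixes b :: nat
  assumes "\<And>i. i < L \<Longrightarrow> v i < b"
  shows "(\<Sum>i<L. v i * b ^ i) < b ^ L \<and> (\<forall>k<L. (\<Sum>i<L. v i * b ^ i) div b ^ k mod b = v k)"
  using assms
proof (induction L)
  case (Suc L)
  let ?S = "\<Sum>i<L. v i * b ^ i"
  have IH: "?S < b ^ L" "\<And>k. k < L \<Longrightarrow> ?S div b ^ k mod b = v k" using Suc by auto
  have vL: "v L < b" using Suc.prems by simp
  have "?S + v L * b ^ L < b ^ L + v L * b ^ L" using IH(1) by simp
  also have "\<dots> = (v L + 1) * b ^ L" by simp
  also have "\<dots> \<le> b * b ^ L" using vL by (intro mult_right_mono) auto
  finally have "(\<Sum>i<Suc L. v i * b ^ i) < b ^ Suc L" by simp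
  moreover have "(\<Sum>i<Suc L. v i * b ^ i) div b ^ k mod b = v k" if k: "k < Suc L" for k
  proof (cases "k = L")
    case True
    then show ?thesis using IH(1) vL by simp
  next
    case False
    then have k: "k < L" using k by simp
    then obtain d where d: "L = k + Suc d" by (metis add_Suc_right less_imp_Suc_add)
    have bpos: "b ^ k > 0" using vL by simp
    have "?S + v L * b ^ L = ?S + (b * (v L * b ^ d)) * b ^ k"
      by (simp add: d power_add ac_simps)
    then have "(?S + v L * b ^ L) div b ^ k = b * (v L * b ^ d) + ?S div b ^ k"
      using bpos by (simp only: div_mult_self1)
    then show ?thesis using IH(2)[OF k] by simp
  qed
  ultimately show ?case by blast
qed simp

lemma number_with_digits:
  fixes b :: nat
  assumes "\<And>i. i < L \<Longrightarrow> v i < b"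
  obtains m where "m < b ^ L" "\<And>i. i < L \<Longrightarrow> m div b ^ i mod b = v i"
  using digits_of_sum[of L v b, OF assms] by blast

definition trit :: "nat \<Rightarrow> nat \<Rightarrow> nat" where
  "trit j i = j div 3 ^ i mod 3"

definition uses :: "nat \<Rightarrow> nat \<Rightarrow> nat" where
  "uses j i = (if trit j i = 2 then 1 else 0)"

text \<open>Erases the digits 2 and keeps the digits 1: the part of a code that the precoloring
  dictates.\<close>

definition pre_part :: "nat \<Rightarrow> nat \<Rightarrow> nat" where
  "pre_part K j = (\<Sum>i<K. if trit j i = 1 then 3 ^ i else 0)"

lemma trit_sum:
  assumes "i < K"
  shows "trit (\<Sum>i<K. if P i then 3 ^ i else 0) i = (if P i then 1 else 0)"
  using digits_of_sum[of K "\<lambda>i. if P i then 1 else 0" 3] assms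
  by (auto simp: trit_def if_distrib[where f = "\<lambda>x. x * _"] cong: if_cong)

lemma sum_pow3_less: "(\<Sum>i<K. if P i then 3 ^ i else 0) < (3 :: nat) ^ K"
  using digits_of_sum[of K "\<lambda>i. if P i then 1 else 0" 3]
  by (auto simp: if_distrib[where f = "\<lambda>x. x * _"] cong: if_cong)

text \<open>\<open>M\<close> is adjacency between types, and \<open>M i i\<close> marks a clique.
  For a type with a single vertex both readings of \<open>M i i\<close> give the same
  demand.\<close>

locale typed_instance =
  fixes N K r :: nat and E :: "nat set set" and p :: "nat \<rightharpoonup> nat"
    and \<tau> :: "nat \<Rightarrow> nat" and M :: "nat \<Rightarrow> nat \<Rightarrow> bool"
  assumes inst: "precol_instance {0..<N} E r p"
    and type_less: "v < N \<Longrightarrow> \<tau> v < K"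
    and edge_iff: "u < N \<Longrightarrow> v < N \<Longrightarrow> {u, v} \<in> E \<longleftrightarrow> u \<noteq> v \<and> M (\<tau> u) (\<tau> v)"
    and M_sym: "M i j \<longleftrightarrow> M j i"
begin

definition used :: "nat \<Rightarrow> nat \<Rightarrow> bool" where
  "used c i \<longleftrightarrow> (\<exists>v<N. \<tau> v = i \<and> p v = Some c)"

definition free :: "nat \<Rightarrow> nat set" where
  "free i = {v. v < N \<and> \<tau> v = i \<and> p v = None}"

text \<open>In an independent type the color of a precolored vertex can serve all uncolored ones,
  since its vertices have the same neighbors; without a precolored vertex one new color serves them
  all.\<close>

definition dem :: "nat \<Rightarrow> nat" where
  "dem i = (if M i i then card (free i)
            else if (\<exists>v<N. \<tau> v = i \<and> p v \<noteq> None) \<or> free i = {} then 0 else 1)"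

definition mc :: "nat \<Rightarrow> nat" where
  "mc c = (\<Sum>i<K. if used c i then 3 ^ i else 0)"

text \<open>Only pairs with a digit 2 are tested: two digits 1 on adjacent types would be a fault of
  the precoloring. The condition \<open>i \<noteq> i'\<close> lets a new color be given to one
  vertex of a clique.\<close>

definition bad :: "nat \<Rightarrow> bool" where
  "bad j \<longleftrightarrow> (\<exists>i<K. \<exists>i'<K. i \<noteq> i' \<and> trit j i = 2 \<and> trit j i' \<noteq> 0 \<and> M i i')"

definition coding :: "(nat \<Rightarrow> nat) \<Rightarrow> bool" where
  "coding code \<longleftrightarrow> (\<forall>c\<in>{1..r}. code c < 3 ^ K \<and> pre_part K (code c) = mc c \<and> \<not> bad (code c))"

definition count :: "(nat \<Rightarrow> nat) \<Rightarrow> nat \<Rightarrow> nat" where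
  "count code j = card {c \<in> {1..r}. code c = j}"

definition served :: "(nat \<Rightarrow> nat) \<Rightarrow> nat \<Rightarrow> nat" where
  "served x i = (\<Sum>j<3 ^ K. x j * uses j i)"

text \<open>The second conjunct says that the colors with forced part \<open>A\<close> are
  distributed among the codes that extend \<open>A\<close>. Demands enter only as upper bounds, so
  the bare precoloring is a starting point and the total supply is the objective.\<close>

definition feas :: "(nat \<Rightarrow> nat) \<Rightarrow> bool" where
  "feas x \<longleftrightarrow> (\<forall>j<3 ^ K. bad j \<longrightarrow> x j = 0) \<and>
     (\<forall>A<3 ^ K. (\<Sum>j<3 ^ K. if pre_part K j = A then x j else 0) = count mc A) \<and>
     (\<forall>i<K. served x i \<le> dem i)"

lemma p_range: "p v = Some c \<Longrightarrow> c \<in> {1..r}" "p v = Some c \<Longrightarrow> v < N"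
  using inst by (auto simp: precol_instance_def proper_partial_coloring_def ran_def dom_def)

lemma p_proper:
  assumes "p u = Some c" "p v = Some c"
  shows "u = v \<or> \<not> M (\<tau> u) (\<tau> v)"
proof -
  have "{u, v} \<in> E \<longrightarrow> p u \<noteq> p v"
    using inst assms by (force simp: precol_instance_def proper_partial_coloring_def)
  then show ?thesis using edge_iff[of u v] p_range(2) assms by auto
qed

lemma sum_uses:
  assumes "\<And>c. c \<in> {1..r} \<Longrightarrow> code c < 3 ^ K"
  shows "served (count code) i = (\<Sum>c\<in>{1..r}. uses (code c) i)"
proof -
  have "(\<Sum>c\<in>{1..r}. uses (code c) i) =
      (\<Sum>j<3 ^ K. \<Sum>c\<in>{c \<in> {1..r}. code c = j}. uses (code c) i)"
    by (rule sum.group[symmetric]) (use assms in auto)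
  also have "\<dots> = (\<Sum>j<3 ^ K. count code j * uses j i)"
    by (rule sum.cong) (auto simp: count_def)
  finally show ?thesis by (simp add: served_def)
qed

lemma feas_count:
  assumes "coding code" "\<And>i. i < K \<Longrightarrow> (\<Sum>c\<in>{1..r}. uses (code c) i) \<le> dem i"
  shows "feas (count code)"
  unfolding feas_def
proof (intro conjI allI impI)
  fix j assume "bad j"
  then have "{c \<in> {1..r}. code c = j} = {}" using assms(1) by (auto simp: coding_def)
  then show "count code j = 0" by (simp add: count_def)
next
  fix A :: nat assume "A < 3 ^ K"
  have k: "code c \<in> {..<3 ^ K}" "pre_part K (code c) = mc c" if "c \<in> {1..r}" for c
    using assms(1) that by (simp_all add: coding_def)
  have eq: "{c \<in> {1..r}. mc c = A} = (\<Union>j\<in>{j \<in> {..<3 ^ K}. pre_part K j = A}. {c \<in> {1..r}. code c = j})"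
    (is "?L = ?R")
  proof (rule set_eqI)
    fix c show "c \<in> ?L \<longleftrightarrow> c \<in> ?R" using k[of c] by auto
  qed
  have "count mc A = (\<Sum>j\<in>{j \<in> {..<3 ^ K}. pre_part K j = A}. count code j)"
    unfolding count_def eq
  proof (rule card_UN_disjoint)
    show "finite {j \<in> {..<3 ^ K}. pre_part K j = A}" by simp
    show "\<forall>j\<in>{j \<in> {..<3 ^ K}. pre_part K j = A}. finite {c \<in> {1..r}. code c = j}" by simp
    show "\<forall>i\<in>{j \<in> {..<3 ^ K}. pre_part K j = A}. \<forall>j\<in>{j \<in> {..<3 ^ K}. pre_part K j = A}.
      i \<noteq> j \<longrightarrow> {c \<in> {1..r}. code c = i} \<inter> {c \<in> {1..r}. code c = j} = {}"
      by blast
  qed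
  also have "\<dots> = (\<Sum>j<3 ^ K. if pre_part K j = A then count code j else 0)"
    by (simp only: sum.inter_filter[OF finite_lessThan])
  finally show "(\<Sum>j<3 ^ K. if pre_part K j = A then count code j else 0) = count mc A"
    by simp
next
  fix i assume "i < K"
  then show "served (count code) i \<le> dem i"
    using assms sum_uses[of code i] by (simp add: coding_def)
qed

text \<open>The class equations allow codes to be handed out separately among the colors with a
  common forced part. A bad code has multiplicity zero and goes to no color.\<close>

lemma feas_realize:
  assumes "feas x"
  obtains code where "coding code" "\<And>j. j < 3 ^ K \<Longrightarrow> count code j = x j"
proof -
  define R where "R A code \<longleftrightarrow> (\<forall>c\<in>{c \<in> {1..r}. mc c = A}. code c \<in> {j. j < 3 ^ K \<and> pre_part K j = A}) \<and>
      (\<forall>j\<in>{j. j < 3 ^ K \<and> pre_part K j = A}. card {c \<in> {c \<in> {1..r}. mc c = A}. code c = j} = x j)"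
    for A and code :: "nat \<Rightarrow> nat"
  have "\<exists>code. R A code" for A
  proof (cases "A < 3 ^ K")
    case True
    have "(\<Sum>j\<in>{j. j < 3 ^ K \<and> pre_part K j = A}. x j) = card {c \<in> {1..r}. mc c = A}"
      using assms True sum.inter_filter[of "{..<3 ^ K}" x "\<lambda>j. pre_part K j = A"]
      by (simp add: feas_def count_def)
    then show ?thesis
      by (rule realize_counts[rotated 2]) (auto simp: R_def)
  next
    \<comment> \<open>No color and no code has such a forced part, so every function will do; this
      makes the choice of \<open>code A\<close> total in \<open>A\<close>.\<close>
    case False
    have "pre_part K j < 3 ^ K" "mc j < 3 ^ K" for j
      unfolding pre_part_def mc_def by (rule sum_pow3_less)+
    then have "{c \<in> {1..r}. mc c = A} = {}" "{j. j < 3 ^ K \<and> pre_part K j = A} = {}"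
      using False by auto
    then show ?thesis unfolding R_def by (simp only: ball_empty) simp
  qed
  then obtain code where R: "\<And>A. R A (code A)" by metis
  have code: "\<And>A c. c \<in> {1..r} \<Longrightarrow> mc c = A \<Longrightarrow> code A c < 3 ^ K \<and> pre_part K (code A c) = A"
    "\<And>A j. j < 3 ^ K \<Longrightarrow> pre_part K j = A \<Longrightarrow>
       card {c \<in> {c \<in> {1..r}. mc c = A}. code A c = j} = x j"
    using R unfolding R_def by simp_all
  let ?code = "\<lambda>c. code (mc c) c"
  have eq: "count ?code j = x j" if j: "j < 3 ^ K" for j
  proof -
    have "{c \<in> {1..r}. ?code c = j} = {c \<in> {c \<in> {1..r}. mc c = pre_part K j}. code (pre_part K j) c = j}"
      using code(1) by auto
    then show ?thesis using code(2)[OF j refl] by (simp add: count_def)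
  qed
  have "\<not> bad (?code c)" if c: "c \<in> {1..r}" for c
  proof
    assume b: "bad (?code c)"
    have "?code c < 3 ^ K" using code(1)[OF c refl] by simp
    with b have "card {c' \<in> {1..r}. ?code c' = ?code c} = 0"
      using assms eq by (simp add: feas_def count_def)
    then have "{c' \<in> {1..r}. ?code c' = ?code c} = {}" by simp
    then show False using c by blast
  qed
  then have "coding ?code" using code(1) by (simp add: coding_def)
  then show thesis using eq that by blast
qed

text \<open>An extension may spend more new colors on an independent type than its demand. Hence a
  set \<open>S i\<close> of exactly \<open>dem i\<close> colors is selected among those of the
  uncolored vertices of type \<open>i\<close>: all of them in a clique, where they are distinct and
  new, and at most one otherwise.\<close>

lemma extendible_imp_coding:
  assumes "precol_extendible {0..<N} E r p"
  obtains code where "coding code" "\<And>i. i < K \<Longrightarrow> (\<Sum>c\<in>{1..r}. uses (code c) i) = dem i"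
proof -
  obtain f where f: "proper_partial_coloring {0..<N} E r f" "dom f = {0..<N}" "p \<subseteq>\<^sub>m f"
    using assms by (auto simp: precol_extendible_def)
  have fp: "f v = Some c" if "p v = Some c" for v c
    using f(3) that by (metis domI map_le_def)
  have fN: "\<exists>c\<in>{1..r}. f v = Some c" if "v < N" for v
  proof -
    have "v \<in> dom f" using f(2) that by simp
    then obtain c where c: "f v = Some c" by blast
    moreover have "ran f \<subseteq> {1..r}" using f(1) by (simp add: proper_partial_coloring_def)
    ultimately show ?thesis using ranI[of f v c] by blast
  qed
  have fprop: "f u \<noteq> f v" if "u < N" "v < N" "u \<noteq> v" "M (\<tau> u) (\<tau> v)" for u v
  proof -
    have "{u, v} \<in> E" "u \<in> dom f" "v \<in> dom f" using that edge_iff[of u v] f(2) by simp_all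
    then show ?thesis using f(1) unfolding proper_partial_coloring_def by blast
  qed
  define R where "R i S \<longleftrightarrow> S \<subseteq> (the \<circ> f) ` free i \<and> card S = dem i \<and> (\<forall>c\<in>S. \<not> used c i)" for i S
  have "\<exists>S. R i S" for i
  proof (cases "M i i")
    case True
    have "inj_on (the \<circ> f) (free i)"
    proof (rule inj_onI)
      fix u v assume uv: "u \<in> free i" "v \<in> free i" "(the \<circ> f) u = (the \<circ> f) v"
      then have "f u = f v" using fN[of u] fN[of v] by (auto simp: free_def)
      then show "u = v" using fprop[of u v] uv True by (auto simp: free_def)
    qed
    then have "card ((the \<circ> f) ` free i) = card (free i)" by (rule card_image)
    then have "card ((the \<circ> f) ` free i) = dem i" using True by (simp only: dem_def if_True)
    moreover have "\<not> used (the (f v)) i" if "v \<in> free i" for v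
    proof
      assume "used (the (f v)) i"
      then obtain u where u: "u < N" "\<tau> u = i" "p u = Some (the (f v))" by (auto simp: used_def)
      have v: "v < N" "\<tau> v = i" "p v = None" using that by (simp_all add: free_def)
      have "f u = f v" using fp[OF u(3)] fN[OF v(1)] by auto
      moreover have "u \<noteq> v" using u(3) v(3) by auto
      ultimately show False using fprop[of u v] u v True by simp
    qed
    ultimately show ?thesis by (intro exI[of _ "(the \<circ> f) ` free i"]) (auto simp: R_def)
  next
    case indep: False
    show ?thesis
    proof (cases "dem i = 0")
      case True
      then show ?thesis by (intro exI[of _ "{}"]) (auto simp: R_def)
    next
      case False
      then obtain v where "v \<in> free i" "\<not> (\<exists>v<N. \<tau> v = i \<and> p v \<noteq> None)" "dem i = 1"
        using indep by (auto simp: dem_def split: if_splits)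
      then show ?thesis by (intro exI[of _ "{(the \<circ> f) v}"]) (auto simp: used_def R_def)
    qed
  qed
  then obtain S where RS: "\<And>i. R i (S i)" by metis
  have S: "\<And>i. S i \<subseteq> (the \<circ> f) ` free i" "\<And>i. card (S i) = dem i"
    "\<And>i c. c \<in> S i \<Longrightarrow> \<not> used c i"
    using RS unfolding R_def by simp_all
  define R' where "R' c j \<longleftrightarrow> j < 3 ^ K \<and>
    (\<forall>i<K. trit j i = (if c \<in> S i then 2 else if used c i then 1 else 0))" for c j
  have "\<exists>j. R' c j" for c
    unfolding trit_def R'_def
    by (rule number_with_digits[of K "\<lambda>i. if c \<in> S i then 2 else if used c i then 1 else 0" 3]) auto
  then obtain code where RC: "\<And>c. R' c (code c)" by metis
  have code: "\<And>c. code c < 3 ^ K"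
    "\<And>c i. i < K \<Longrightarrow> trit (code c) i = (if c \<in> S i then 2 else if used c i then 1 else 0)"
    using RC unfolding R'_def by simp_all
  \<comment> \<open>Every nonzero digit is witnessed by a vertex to which \<open>f\<close> gives
    that color, so a bad code would contradict properness of \<open>f\<close>.\<close>
  have vert: "\<exists>v<N. \<tau> v = i \<and> f v = Some c" if "c \<in> S i \<or> used c i" for c i
  proof (cases "c \<in> S i")
    case True
    then obtain v where "v \<in> free i" "c = the (f v)" using S(1)[of i] by auto
    then show ?thesis using fN[of v] by (auto simp: free_def)
  next
    case False
    then show ?thesis using that fp by (auto simp: used_def)
  qed
  have "\<not> bad (code c)" for c
  proof
    assume "bad (code c)"
    then obtain i i' where i: "i < K" "i' < K" "i \<noteq> i'" "trit (code c) i = 2" "trit (code c) i' \<noteq> 0" "M i i'"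
      by (auto simp: bad_def)
    then have "c \<in> S i" "c \<in> S i' \<or> used c i'" using code(2)[of i c] code(2)[of i' c]
      by (auto split: if_splits)
    then obtain v v' where "v < N" "\<tau> v = i" "f v = Some c" "v' < N" "\<tau> v' = i'" "f v' = Some c"
      using vert by metis
    then show False using fprop[of v v'] i by auto
  qed
  moreover have "pre_part K (code c) = mc c" for c
    unfolding pre_part_def mc_def using code(2) S(3) by (intro sum.cong) auto
  ultimately have "coding code" using code(1) by (simp add: coding_def)
  moreover have "(\<Sum>c\<in>{1..r}. uses (code c) i) = dem i" if i: "i < K" for i
  proof -
    have "S i \<subseteq> {1..r}"
    proof
      fix c assume "c \<in> S i"
      then obtain v where "v < N" "f v = Some c" using vert by blast
      then show "c \<in> {1..r}" using fN[of v] by auto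
    qed
    have "(\<Sum>c\<in>{1..r}. uses (code c) i) = (\<Sum>c\<in>{1..r}. if c \<in> S i then 1 else 0)"
      by (rule sum.cong) (auto simp: uses_def code(2)[OF i])
    also have "\<dots> = card ({1..r} \<inter> S i)" by (simp add: sum.If_cases)
    also have "{1..r} \<inter> S i = S i" using \<open>S i \<subseteq> {1..r}\<close> by auto
    finally show ?thesis using S(2) by simp
  qed
  ultimately show thesis by (rule that)
qed

text \<open>A clique is colored by a bijection from its uncolored vertices to the colors with digit
  2. In an independent type all uncolored vertices share one color: a new one, or a precolored one
  if the demand is 0.\<close>

lemma coding_imp_extendible:
  assumes code: "coding code" and eq: "\<And>i. i < K \<Longrightarrow> (\<Sum>c\<in>{1..r}. uses (code c) i) = dem i"
  shows "precol_extendible {0..<N} E r p"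
proof -
  define S where "S i = {c \<in> {1..r}. trit (code c) i = 2}" for i
  have cardS: "card (S i) = dem i" if "i < K" for i
  proof -
    have "(\<Sum>c\<in>{1..r}. uses (code c) i) = card ({1..r} \<inter> {c. trit (code c) i = 2})"
      by (simp add: uses_def sum.If_cases)
    also have "{1..r} \<inter> {c. trit (code c) i = 2} = S i" by (auto simp: S_def)
    finally show ?thesis using eq[OF that] by simp
  qed
  have trit1: "trit (code c) i = 1 \<longleftrightarrow> used c i" if "c \<in> {1..r}" "i < K" for c i
  proof -
    have "trit (pre_part K (code c)) i = trit (mc c) i" using code that by (simp add: coding_def)
    moreover have "trit (pre_part K (code c)) i = (if trit (code c) i = 1 then 1 else 0)"
      unfolding pre_part_def by (rule trit_sum[OF that(2)])
    moreover have "trit (mc c) i = (if used c i then 1 else 0)"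
      unfolding mc_def by (rule trit_sum[OF that(2)])
    ultimately show ?thesis by (metis zero_neq_one)
  qed
  define R where "R i g \<longleftrightarrow>
    (\<forall>v\<in>free i. g v \<in> S i \<or> \<not> M i i \<and> used (g v) i) \<and> (M i i \<longrightarrow> inj_on g (free i))" for i g
  have "\<exists>g. R i g" if i: "i < K" for i
  proof (cases "M i i")
    case True
    have "finite (S i)" "finite (free i)" by (auto simp: S_def free_def)
    then obtain g where "bij_betw g (free i) (S i)"
      using cardS[OF i] True finite_same_card_bij[of "free i" "S i"] by (auto simp: dem_def)
    then show ?thesis by (auto simp: bij_betw_def R_def)
  next
    case indep: False
    show ?thesis
    proof (cases "dem i = 0")
      case False
      then have "S i \<noteq> {}" using cardS[OF i] by auto
      then obtain c where "c \<in> S i" by auto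
      then show ?thesis using indep by (intro exI[of _ "\<lambda>_. c"]) (auto simp: R_def)
    next
      case True
      then have "free i = {} \<or> (\<exists>v<N. \<tau> v = i \<and> p v \<noteq> None)"
        using indep by (auto simp: dem_def split: if_splits)
      then show ?thesis
      proof
        assume "\<exists>v<N. \<tau> v = i \<and> p v \<noteq> None"
        then obtain c where "used c i" by (auto simp: used_def)
        then show ?thesis using indep by (intro exI[of _ "\<lambda>_. c"]) (auto simp: R_def)
      qed (auto simp: R_def)
    qed
  qed
  then obtain g where RG: "\<And>i. i < K \<Longrightarrow> R i (g i)" by metis
  have g: "\<And>i v. i < K \<Longrightarrow> v \<in> free i \<Longrightarrow> g i v \<in> S i \<or> \<not> M i i \<and> used (g i v) i"
    "\<And>i. i < K \<Longrightarrow> M i i \<Longrightarrow> inj_on (g i) (free i)"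
    using RG unfolding R_def by simp_all
  define h where "h v = (case p v of Some c \<Rightarrow> c | None \<Rightarrow> g (\<tau> v) v)" for v
  define f where "f v = (if v < N then Some (h v) else None)" for v
  have hcase: "p v = Some (h v) \<or> v \<in> free (\<tau> v) \<and> h v = g (\<tau> v) v" if "v < N" for v
    using that by (cases "p v") (auto simp: h_def free_def)
  have usedr: "c \<in> {1..r}" if "used c i" for c i using that p_range(1) by (auto simp: used_def)
  \<comment> \<open>Records which digit in the code of \<open>h v\<close> is responsible for
    \<open>v\<close>, and what is known of \<open>v\<close> in either case.\<close>
  have digit: "h v \<in> {1..r} \<and> (trit (code (h v)) (\<tau> v) = 1 \<and> (p v = Some (h v) \<or> \<not> M (\<tau> v) (\<tau> v))
      \<or> trit (code (h v)) (\<tau> v) = 2 \<and> v \<in> free (\<tau> v) \<and> h v = g (\<tau> v) v)"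
    if v: "v < N" for v
    using hcase[OF v]
  proof
    assume pv: "p v = Some (h v)"
    then have "used (h v) (\<tau> v)" using v by (auto simp: used_def)
    then show ?thesis using trit1[OF usedr type_less[OF v]] usedr pv by blast
  next
    assume fv: "v \<in> free (\<tau> v) \<and> h v = g (\<tau> v) v"
    then have "h v \<in> S (\<tau> v) \<or> \<not> M (\<tau> v) (\<tau> v) \<and> used (h v) (\<tau> v)"
      using g(1)[OF type_less[OF v]] by simp
    then show ?thesis using fv trit1[OF usedr type_less[OF v]] usedr by (auto simp: S_def)
  qed
  have ne: "h u \<noteq> h v" if uv: "u < N" "v < N" "u \<noteq> v" "M (\<tau> u) (\<tau> v)" for u v
  proof
    assume eq: "h u = h v"
    define c where "c = h v"
    have c: "c \<in> {1..r}" using digit[OF uv(2)] by (simp add: c_def)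
    show False
    proof (cases "\<tau> u = \<tau> v")
      case True
      then have Mi: "M (\<tau> v) (\<tau> v)" using uv(4) by simp
      consider "p u = Some c" "p v = Some c" | "u \<in> free (\<tau> v)" "v \<in> free (\<tau> v)" "g (\<tau> v) u = g (\<tau> v) v"
        using digit[OF uv(1)] digit[OF uv(2)] Mi True eq by (auto simp: c_def)
      then show False
      proof cases
        case 1
        then show False using p_proper[OF 1] uv by simp
      next
        case 2
        then show False using g(2)[OF type_less[OF uv(2)] Mi] uv(3) by (auto dest: inj_onD)
      qed
    next
      case False
      have nb: "\<not> bad (code c)" using code c by (auto simp: coding_def)
      have t: "trit (code c) (\<tau> u) = 1 \<or> trit (code c) (\<tau> u) = 2"
        "trit (code c) (\<tau> v) = 1 \<or> trit (code c) (\<tau> v) = 2"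
        using digit[OF uv(1)] digit[OF uv(2)] eq by (auto simp: c_def)
      show False
      proof (cases "trit (code c) (\<tau> u) = 1 \<and> trit (code c) (\<tau> v) = 1")
        case True
        \<comment> \<open>A digit 1 does not mean that \<open>u\<close> and \<open>v\<close> are
          precolored themselves, as the color may be shared within their types. The clash is found
          at precolored vertices \<open>u'\<close> and \<open>v'\<close> of the same types.\<close>
        then have "used c (\<tau> u)" "used c (\<tau> v)" using trit1[OF c] type_less uv(1,2) by auto
        then obtain u' v' where "\<tau> u' = \<tau> u" "p u' = Some c" "\<tau> v' = \<tau> v" "p v' = Some c"
          by (auto simp: used_def)
        then show False using p_proper[of u' c v'] False uv(4) by auto
      next
        case F: False
        have "\<exists>i<K. \<exists>i'<K. i \<noteq> i' \<and> trit (code c) i = 2 \<and> trit (code c) i' \<noteq> 0 \<and> M i i'"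
        proof (cases "trit (code c) (\<tau> u) = 2")
          case True
          then show ?thesis using False uv t type_less by (intro exI[of _ "\<tau> u"] exI[of _ "\<tau> v"] conjI) auto
        next
          case u1: False
          then show ?thesis using F False uv t type_less M_sym[of "\<tau> u" "\<tau> v"]
            by (intro exI[of _ "\<tau> v"] exI[of _ "\<tau> u"] conjI) auto
        qed
        then show False using nb by (simp add: bad_def)
      qed
    qed
  qed
  have dom: "dom f = {0..<N}" by (auto simp: f_def dom_def)
  have "proper_partial_coloring {0..<N} E r f"
    unfolding proper_partial_coloring_def
  proof (intro conjI ballI impI)
    show "dom f \<subseteq> {0..<N}" using dom by simp
    show "ran f \<subseteq> {1..r}" using digit by (auto simp: ran_def f_def split: if_splits)
  next
    fix u v assume "u \<in> dom f" "v \<in> dom f" "{u, v} \<in> E"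
    then show "f u \<noteq> f v" using ne[of u v] edge_iff[of u v] dom by (simp add: f_def)
  qed
  moreover have "p \<subseteq>\<^sub>m f"
    unfolding map_le_def
  proof
    fix v assume "v \<in> dom p"
    then obtain c where "p v = Some c" by auto
    then show "p v = f v" using p_range(2)[of v c] by (simp add: f_def h_def)
  qed
  ultimately show ?thesis using dom by (auto simp: precol_extendible_def)
qed

lemma served_cong: "(\<And>j. j < 3 ^ K \<Longrightarrow> x j = y j) \<Longrightarrow> served x i = served y i"
  unfolding served_def by (rule sum.cong) auto

lemma full_imp_extendible:
  assumes "feas x" "(\<Sum>i<K. served x i) = (\<Sum>i<K. dem i)"
  shows "precol_extendible {0..<N} E r p"
proof -
  obtain code where code: "coding code" "\<And>j. j < 3 ^ K \<Longrightarrow> count code j = x j"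
    by (rule feas_realize[OF assms(1)]) blast
  have le: "served x i \<le> dem i" if "i < K" for i using assms(1) that by (simp add: feas_def)
  have "served x i = dem i" if i: "i < K" for i
  proof (rule ccontr)
    assume "served x i \<noteq> dem i"
    then have "served x i < dem i" using le[OF i] by simp
    then have "(\<Sum>i<K. served x i) < (\<Sum>i<K. dem i)"
      using le i by (intro sum_strict_mono_ex1) auto
    then show False using assms(2) by simp
  qed
  then have "(\<Sum>c\<in>{1..r}. uses (code c) i) = dem i" if "i < K" for i
    using sum_uses[of code i] code that served_cong[of "count code" x i] by (simp add: coding_def)
  then show ?thesis by (rule coding_imp_extendible[OF code(1)])
qed

text \<open>The alternative \<open>r \<le> g\<close> suffices since no more than \<open>r\<close>
  colors can be recoded at all; it allows the program to cut the radius down to a word. A recoded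
  color changes each multiplicity by at most 1, whence the distance \<open>g\<close>.\<close>

lemma improve:
  assumes ext: "precol_extendible {0..<N} E r p" and feas: "feas x"
    and less: "(\<Sum>i<K. served x i) < (\<Sum>i<K. dem i)"
    and g: "(3 * 9 ^ K) ^ K \<le> g \<or> r \<le> g"
  obtains y where "feas y" "(\<Sum>i<K. served x i) < (\<Sum>i<K. served y i)"
    "\<And>j. j < 3 ^ K \<Longrightarrow> y j \<le> x j + g" "\<And>j. j < 3 ^ K \<Longrightarrow> x j \<le> y j + g"
proof -
  obtain code' where code': "coding code'" "\<And>i. i < K \<Longrightarrow> (\<Sum>c\<in>{1..r}. uses (code' c) i) = dem i"
    by (rule extendible_imp_coding[OF ext]) blast
  obtain code where code: "coding code" "\<And>j. j < 3 ^ K \<Longrightarrow> count code j = x j"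
    by (rule feas_realize[OF feas]) blast
  have sx: "(\<Sum>c\<in>{1..r}. uses (code c) i) = served x i" for i
    using sum_uses[of code i] code served_cong[of "count code" x i] by (simp add: coding_def)
  have le: "served x i \<le> dem i" if "i < K" for i using feas that by (simp add: feas_def)
  obtain i0 where i0: "i0 < K" "served x i0 < dem i0"
  proof (rule ccontr)
    assume "\<not> thesis"
    then have "(\<Sum>i<K. dem i) \<le> (\<Sum>i<K. served x i)"
      using that by (intro sum_mono) (auto simp: not_less[symmetric])
    then show False using less by simp
  qed
  obtain D where D: "D \<subseteq> {1..r}" "card D \<le> (3 * 9 ^ K) ^ K"
    "\<And>i. i < K \<Longrightarrow> (\<Sum>c\<in>{1..r}. uses (if c \<in> D then code' c else code c) i) \<le> dem i"
    "\<And>i. i < K \<Longrightarrow> served x i \<le> (\<Sum>c\<in>{1..r}. uses (if c \<in> D then code' c else code c) i)"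
    "served x i0 < (\<Sum>c\<in>{1..r}. uses (if c \<in> D then code' c else code c) i0)"
    by (rule augment[of "{1..r}" uses K code dem code' i0, unfolded sx])
      (use le code'(2) i0 in \<open>auto simp: uses_def\<close>)
  define new where "new = (\<lambda>c. if c \<in> D then code' c else code c)"
  have coding: "coding new" using code(1) code'(1) by (simp add: coding_def new_def)
  have sn: "served (count new) i = (\<Sum>c\<in>{1..r}. uses (new c) i)" for i
    by (rule sum_uses) (use coding in \<open>simp add: coding_def\<close>)
  have finD: "finite D" using D(1) by (auto intro: finite_subset)
  have "card D \<le> card {1..r}" by (rule card_mono[OF _ D(1)]) simp
  then have cD: "card D \<le> g" using g D(2) by auto
  have close: "count a j \<le> count b j + g" if "\<And>c. c \<notin> D \<Longrightarrow> a c = b c" for a b j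
  proof -
    have "card {c \<in> {1..r}. a c = j} \<le> card ({c \<in> {1..r}. b c = j} \<union> D)"
      by (rule card_mono) (use that finD in auto)
    also have "\<dots> \<le> card {c \<in> {1..r}. b c = j} + card D" by (rule card_Un_le)
    finally show ?thesis using cD by (simp add: count_def)
  qed
  show thesis
  proof (rule that[of "count new"])
    show "feas (count new)" by (rule feas_count[OF coding]) (use D(3) in \<open>simp add: new_def\<close>)
    show "(\<Sum>i<K. served x i) < (\<Sum>i<K. served (count new) i)"
      unfolding sn by (rule sum_strict_mono_ex1) (use D(4,5) i0 in \<open>auto simp: new_def\<close>)
  next
    fix j :: nat assume "j < 3 ^ K"
    then show "count new j \<le> x j + g" "x j \<le> count new j + g"
      using close[of new code j] close[of code new j] code(2)[of j] by (auto simp: new_def)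
  qed
qed

text \<open>The starting point of the search: each color carries just its forced digits, so no digit
  is 2 and nothing is supplied.\<close>

lemma feas_count_pre:
  shows "feas (count mc)" "served (count mc) i = 0"
proof -
  have lt: "mc c < 3 ^ K" for c unfolding mc_def by (rule sum_pow3_less)
  have t: "trit (mc c) i = (if used c i then 1 else 0)" if "i < K" for c i
    unfolding mc_def by (rule trit_sum[OF that])
  have u: "uses (mc c) i = 0" for c i
  proof (cases "i < K")
    case True
    then show ?thesis by (simp add: uses_def t)
  next
    case False
    then have "(3 :: nat) ^ K \<le> 3 ^ i" by (intro power_increasing) auto
    with lt[of c] have "mc c < 3 ^ i" by (rule less_le_trans)
    then show ?thesis by (simp add: uses_def trit_def)
  qed
  have "pre_part K (mc c) = mc c" for c
    unfolding pre_part_def by (subst (2) mc_def, rule sum.cong) (use t in auto)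
  moreover have "\<not> bad (mc c)" for c by (auto simp: bad_def t split: if_splits)
  ultimately have "coding mc" using lt by (simp add: coding_def)
  then show "feas (count mc)" by (rule feas_count) (simp add: u)
  show "served (count mc) i = 0" using sum_uses[of mc i] lt u by simp
qed

end

section \<open>Classifying the vertices by type\<close>

text \<open>
  Variables \<open>1\<close> to \<open>4\<close> hold \<open>N\<close>, \<open>r\<close>, the number of edges and the number of types. Array \<open>1\<close> maps
  a vertex to its type plus one; \<open>0\<close> means that the type is not yet known. In each phase, array \<open>2\<close>
  marks the neighbors of the new representative, and arrays \<open>3\<close> and \<open>4\<close> hold for every vertex its
  degree and the number of neighbors that it shares with the representative.
\<close>

definition col_exp :: "nat \<Rightarrow> exp" where
  "col_exp v = Get 0 (Num 3 \<oplus> Var v)"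

definition load_edge :: scom where
  "load_edge = Asg 9 (Get 0 (Num 2 \<otimes> Var 8 \<oplus> (Num 3 \<oplus> Var 1))) ;;
               Asg 10 (Get 0 (Num 2 \<otimes> Var 8 \<oplus> (Num 4 \<oplus> Var 1)))"

text \<open>\<open>N\<close> is the sentinel for the case that every vertex has its type; otherwise
  variable 6 ends up with the last vertex without one.\<close>

definition find_free :: scom where
  "find_free = Asg 6 (Var 1) ;; FOR 7 1 (IF (Get 1 (Var 7)) NOP (Asg 6 (Var 7)))"

definition clear_marks :: scom where
  "clear_marks = FOR 7 1 (Put 2 (Var 7) (Num 0) ;; Put 3 (Var 7) (Num 0) ;; Put 4 (Var 7) (Num 0))"

definition mark_nbh :: scom where
  "mark_nbh = FOR 8 3 (load_edge ;;
     Put 2 (Var 9) (Get 2 (Var 9) \<oplus> (Var 10 \<doteq> Var 6)) ;;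
     Put 2 (Var 10) (Get 2 (Var 10) \<oplus> (Var 9 \<doteq> Var 6)) ;;
     Put 3 (Var 9) (Get 3 (Var 9) \<oplus> Num 1) ;;
     Put 3 (Var 10) (Get 3 (Var 10) \<oplus> Num 1))"

definition count_common :: scom where
  "count_common = FOR 8 3 (load_edge ;;
     Put 4 (Var 9) (Get 4 (Var 9) \<oplus> Get 2 (Var 10)) ;;
     Put 4 (Var 10) (Get 4 (Var 10) \<oplus> Get 2 (Var 9)))"

definition assign_type :: scom where
  "assign_type = FOR 7 1 (IF (Get 1 (Var 7)) NOP
     (IF (Get 4 (Var 7) \<oplus> Get 2 (Var 7) \<doteq> Get 3 (Var 7))
       (IF (Get 3 (Var 7) \<doteq> Get 3 (Var 6)) (Put 1 (Var 7) (Var 4)) NOP) NOP))"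

definition type_phase :: scom where
  "type_phase = find_free ;; IF (Var 1 \<ominus> Var 6)
     (clear_marks ;; mark_nbh ;; count_common ;; Asg 4 (Var 4 \<oplus> Num 1) ;; assign_type)
     (Asg 5 (Num 0))"

definition find_types :: scom where
  "find_types = Asg 4 (Num 0) ;; Asg 5 (Num 1) ;; WHILE (Var 5) type_phase"

lemmas types_defs = load_edge_def find_free_def clear_marks_def mark_nbh_def count_common_def
  assign_type_def type_phase_def find_types_def col_exp_def

lemma mods_types:
  "mv find_free = {0, 6, 7}" "ma find_free = {}"
  "mv clear_marks = {7}" "ma clear_marks = {2, 3, 4}"
  "mv mark_nbh = {8, 9, 10}" "ma mark_nbh = {2, 3}"
  "mv count_common = {8, 9, 10}" "ma count_common = {4}"
  "mv assign_type = {0, 7}" "ma assign_type = {1}"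
  "mv type_phase = {0, 4, 5, 6, 7, 8, 9, 10}" "ma type_phase = {1, 2, 3, 4}"
  "mv find_types = {0, 4, 5, 6, 7, 8, 9, 10}" "ma find_types = {1, 2, 3, 4}"
  by (auto simp: types_defs)

text \<open>Types can be compared by counting, without adjacency lists.\<close>

lemma same_type_card:
  assumes "finite (nbh E v)" "finite (nbh E a)" "v \<notin> nbh E v" "a \<notin> nbh E a"
    "a \<in> nbh E v \<longleftrightarrow> v \<in> nbh E a"
  shows "same_type E v a \<longleftrightarrow>
    card (nbh E v \<inter> nbh E a) + (if v \<in> nbh E a then 1 else 0) = card (nbh E v) \<and>
    card (nbh E v) = card (nbh E a)"
proof -
  let ?I = "nbh E v \<inter> nbh E a"
  have sub: "?I \<subseteq> nbh E v - {a}" "?I \<subseteq> nbh E a - {v}" using assms by auto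
  have fin: "finite (nbh E v - {a})" "finite (nbh E a - {v})" using assms by auto
  have card: "card (nbh E v - {a}) = card (nbh E v) - (if v \<in> nbh E a then 1 else 0)"
    "card (nbh E a - {v}) = card (nbh E a) - (if v \<in> nbh E a then 1 else 0)"
    using assms by (auto simp: card_Diff_singleton)
  have pos: "card (nbh E v) \<noteq> 0 \<and> card (nbh E a) \<noteq> 0" if "v \<in> nbh E a"
    using that assms by auto
  show ?thesis
  proof
    assume "same_type E v a"
    then have e: "nbh E v - {a} = nbh E a - {v}" by (simp add: same_type_def)
    then have "?I = nbh E v - {a}" using assms(3,4) by blast
    then have "card ?I = card (nbh E v - {a})" "card (nbh E v - {a}) = card (nbh E a - {v})"
      using e by simp_all
    then show "card ?I + (if v \<in> nbh E a then 1 else 0) = card (nbh E v) \<and>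
        card (nbh E v) = card (nbh E a)"
      using card pos by (auto split: if_splits)
  next
    assume "card ?I + (if v \<in> nbh E a then 1 else 0) = card (nbh E v) \<and>
      card (nbh E v) = card (nbh E a)"
    then have "card ?I = card (nbh E v - {a})" "card ?I = card (nbh E a - {v})"
      using card by auto
    then have "?I = nbh E v - {a}" "?I = nbh E a - {v}"
      using card_subset_eq[OF fin(1) sub(1)] card_subset_eq[OF fin(2) sub(2)] by simp_all
    then show "same_type E v a" by (simp add: same_type_def)
  qed
qed

text \<open>\<open>U\<close> and \<open>W\<close> list the end points in input order. The quadratic
  bound leaves room for products of two quantities that are linear in the input, such as matrix
  indices; \<open>r < N\<close> is the case left over by the greedy coloring.\<close>

locale graph_input =
  fixes N r m B :: nat and A0 :: "nat \<Rightarrow> nat" and E :: "nat set set" and p :: "nat \<rightharpoonup> nat"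
    and U W :: "nat \<Rightarrow> nat"
  assumes precol: "precol_instance {0..<N} E r p"
    and col: "v < N \<Longrightarrow> A0 (3 + v) = (case p v of None \<Rightarrow> 0 | Some c \<Rightarrow> c)"
    and U_eq: "e < m \<Longrightarrow> A0 (2 * e + (3 + N)) = U e"
    and W_eq: "e < m \<Longrightarrow> A0 (2 * e + (4 + N)) = W e"
    and E_eq: "E = (\<lambda>e. {U e, W e}) ` {..<m}"
    and E_inj: "inj_on (\<lambda>e. {U e, W e}) {..<m}"
    and B: "12 * ((3 + N + 2 * m) * (3 + N + 2 * m)) < B"
    and rN: "r < N"
begin

lemma edge_in:
  assumes "e < m"
  shows "U e < N" "W e < N" "U e \<noteq> W e"
proof -
  have "{U e, W e} \<in> {{u, v} | u v. u \<in> {0..<N} \<and> v \<in> {0..<N} \<and> u \<noteq> v}"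
    using precol assms E_eq by (auto simp: precol_instance_def simple_graph_def)
  then obtain u v where "{U e, W e} = {u, v}" "u < N" "v < N" "u \<noteq> v" by auto
  then show "U e < N" "W e < N" "U e \<noteq> W e" by (auto simp: doubleton_eq_iff)
qed

lemma nbh_props:
  "nbh E v \<subseteq> {0..<N}" "finite (nbh E v)" "v \<notin> nbh E v" "a \<in> nbh E v \<longleftrightarrow> v \<in> nbh E a"
  "u \<in> nbh E v \<Longrightarrow> u < N" "u \<in> nbh E v \<Longrightarrow> v < N"
proof -
  have *: "a < N \<and> b < N \<and> a \<noteq> b" if "{a, b} \<in> E" for a b
  proof -
    from that E_eq obtain e where "e < m" "{a, b} = {U e, W e}" by auto
    then show ?thesis using edge_in[of e] by (auto simp: doubleton_eq_iff)
  qed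
  show "nbh E v \<subseteq> {0..<N}" using * by (auto simp: nbh_def)
  then show "finite (nbh E v)" by (rule finite_subset) simp
  show "v \<notin> nbh E v" using *[of v v] by (auto simp: nbh_def)
  show "a \<in> nbh E v \<longleftrightarrow> v \<in> nbh E a" by (simp add: nbh_def insert_commute)
  show "u \<in> nbh E v \<Longrightarrow> u < N" "u \<in> nbh E v \<Longrightarrow> v < N"
    using *[of v u] by (auto simp: nbh_def)
qed

lemma nbh_edge: "u \<in> nbh E v \<longleftrightarrow> (\<exists>e<m. U e = v \<and> W e = u \<or> W e = v \<and> U e = u)"
  unfolding nbh_def E_eq by (auto simp: doubleton_eq_iff)

text \<open>Edges are listed once, so each neighbor of \<open>v\<close> corresponds to exactly one
  listed edge. Degrees, marks and numbers of common neighbors are the instances with weight 1, the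
  indicator of the representative, and the marks.\<close>

lemma edge_sum:
  fixes \<phi> :: "nat \<Rightarrow> nat"
  shows "(\<Sum>e<m. (if U e = v then \<phi> (W e) else 0) + (if W e = v then \<phi> (U e) else 0)) = (\<Sum>u\<in>nbh E v. \<phi> u)"
proof -
  define I where "I = {e. e < m \<and> (U e = v \<or> W e = v)}"
  define other where "other e = (if U e = v then W e else U e)" for e
  have "(\<Sum>e<m. (if U e = v then \<phi> (W e) else 0) + (if W e = v then \<phi> (U e) else 0))
      = (\<Sum>e\<in>I. \<phi> (other e))"
    by (rule sum.mono_neutral_cong_right) (auto simp: I_def other_def dest: edge_in(3))
  also have "\<dots> = (\<Sum>u\<in>nbh E v. \<phi> u)"
  proof (rule sum.reindex_bij_betw)
    show "bij_betw other I (nbh E v)"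
      unfolding bij_betw_def
    proof
      have pair: "{U e, W e} = {v, other e}" if "e \<in> I" for e
        using that by (auto simp: I_def other_def)
      show "inj_on other I"
      proof (rule inj_onI)
        fix e e' assume "e \<in> I" "e' \<in> I" "other e = other e'"
        then have "{U e, W e} = {U e', W e'}" using pair by metis
        then show "e = e'" using E_inj \<open>e \<in> I\<close> \<open>e' \<in> I\<close> by (auto simp: I_def dest: inj_onD)
      qed
      show "other ` I = nbh E v"
      proof
        show "other ` I \<subseteq> nbh E v" by (auto simp: nbh_edge I_def other_def)
        show "nbh E v \<subseteq> other ` I"
        proof
          fix u assume "u \<in> nbh E v"
          then obtain e where e: "e < m" "U e = v \<and> W e = u \<or> W e = v \<and> U e = u"
            unfolding nbh_edge by blast
          then have "other e = u" "e \<in> I" using edge_in(3)[of e] by (auto simp: other_def I_def)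
          then show "u \<in> other ` I" by blast
        qed
      qed
    qed
  qed
  finally show ?thesis .
qed

definition inp :: "state \<Rightarrow> bool" where
  "inp s \<longleftrightarrow> arr s 0 = A0 \<and> reg s 1 = N \<and> reg s 2 = r \<and> reg s 3 = m"

lemma inp_frame:
  "frame X Y s s' \<Longrightarrow> inp s \<Longrightarrow> 1 \<notin> X \<Longrightarrow> 2 \<notin> X \<Longrightarrow> 3 \<notin> X \<Longrightarrow> 0 \<notin> Y \<Longrightarrow> inp s'"
  by (simp add: frame_def inp_def)

lemma inp_simps:
  "inp s \<Longrightarrow> arr s 0 = A0" "inp s \<Longrightarrow> reg s 1 = N" "inp s \<Longrightarrow> reg s (Suc 0) = N"
  "inp s \<Longrightarrow> reg s 2 = r" "inp s \<Longrightarrow> reg s 3 = m"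
  by (simp_all add: inp_def)

lemma small: "x \<le> 12 * (3 + N + 2 * m) \<Longrightarrow> x < B"
proof -
  assume "x \<le> 12 * (3 + N + 2 * m)"
  also have "\<dots> \<le> 12 * ((3 + N + 2 * m) * (3 + N + 2 * m))" by (intro mult_left_mono) auto
  finally show "x < B" using B by simp
qed

lemma wp_load_edge:
  assumes "inp s" "reg s 8 = e" "e < m"
  shows "wp B load_edge (\<lambda>s' t. s' = set_reg 10 (W e) (set_reg 9 (U e) s) \<and> t = 18) s"
  using assms small[of "2 * e + (3 + N)"] small[of "2 * e + (4 + N)"] small[of 4]
  by (simp add: load_edge_def inp_simps U_eq W_eq)

lemma wp_find_free:
  assumes "inp s"
  shows "wp B find_free (\<lambda>s' t. (reg s' 6 < N \<and> arr s 1 (reg s' 6) = 0 \<or>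
     reg s' 6 = N \<and> (\<forall>v<N. arr s 1 v \<noteq> 0)) \<and> t \<le> N * 13 + 8) s"
  unfolding find_free_def wp.simps
proof (intro conjI, goal_cases)
  case 2
  show ?case
  proof (rule wp_FOR[where T = 5 and I = "\<lambda>j s'. reg s' 6 < N \<and> arr s 1 (reg s' 6) = 0 \<or>
     reg s' 6 = N \<and> (\<forall>v<j. arr s 1 v \<noteq> 0)"], goal_cases)
    case (7 j s')
    then have "arr s' 1 = arr s 1" by (simp add: frame_def)
    then show ?case using 7 assms by (auto simp: inp_simps less_Suc_eq)
  qed (use assms small[of N] small[of 1] in \<open>auto simp: inp_simps\<close>)
qed simp

lemma wp_clear_marks:
  assumes "inp s"
  shows "wp B clear_marks (\<lambda>s' t. (\<forall>v<N. arr s' 2 v = 0 \<and> arr s' 3 v = 0 \<and> arr s' 4 v = 0) \<and>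
    t \<le> N * 17 + 6) s"
  unfolding clear_marks_def
proof (rule wp_FOR[where T = 9 and I = "\<lambda>j s'. \<forall>v<j. arr s' 2 v = 0 \<and> arr s' 3 v = 0 \<and> arr s' 4 v = 0"], goal_cases)
  case (7 j s')
  then show ?case using small[of 0] by (auto simp: less_Suc_eq)
qed (use assms small[of N] small[of 1] in \<open>auto simp: inp_simps\<close>)

lemma deg_bound: "(\<Sum>e<j. (if U e = v then 1 else 0) + (if W e = v then 1 else 0)) \<le> 2 * (j :: nat)"
  by (induction j) auto

text \<open>Both arrays accumulate partial sums as in \<open>edge_sum\<close>; array 2 counts the
  edges between \<open>v\<close> and \<open>a\<close>, of which there is at most one, so the count
  is a mark in the end.\<close>

lemma wp_mark_nbh:
  assumes "inp s" "reg s 6 = a" and clear: "\<forall>v<N. arr s 2 v = 0 \<and> arr s 3 v = 0"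
  shows "wp B mark_nbh (\<lambda>s' t. (\<forall>v<N. arr s' 2 v = (if v \<in> nbh E a then 1 else 0) \<and>
    arr s' 3 v = card (nbh E v)) \<and> t \<le> m * 100 + 6) s"
  unfolding mark_nbh_def
proof (rule wp_FOR[where T = 92 and I = "\<lambda>j s'. \<forall>v<N.
    arr s' 2 v = (\<Sum>e<j. (if U e = v then if W e = a then 1 else 0 else 0) +
      (if W e = v then if U e = a then 1 else 0 else 0)) \<and>
    arr s' 3 v = (\<Sum>e<j. (if U e = v then 1 else 0) + (if W e = v then 1 else 0))"], goal_cases)
  case (7 j s')
  have j: "j < m" using 7 assms by (simp add: inp_simps)
  have inp: "inp s'" using inp_frame[OF 7(5) assms(1)] by (simp add: load_edge_def)
  have r6: "reg s' 6 = a" using 7(5) assms(2) by (simp add: frame_def load_edge_def)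
  note e = edge_in[OF j]
  have "(\<Sum>e<j. (if U e = v then if W e = a then 1 else 0 else 0) +
      (if W e = v then if U e = a then 1 else 0 else 0)) \<le>
      (\<Sum>e<j. (if U e = v then 1 else 0) + (if W e = v then 1 else 0 :: nat))" for v
    by (intro sum_mono add_mono) auto
  then have *: "(\<Sum>e<j. (if U e = v then if W e = a then 1 else 0 else 0) +
      (if W e = v then if U e = a then 1 else 0 else 0)) \<le> 2 * j" for v
    using deg_bound[of v j] le_trans by blast
  have bnd: "arr s' 3 (U j) + 1 < B" "arr s' 3 (W j) + 1 < B"
    "arr s' 2 (U j) + 1 < B" "arr s' 2 (W j) + 1 < B"
    using 7(2) e deg_bound[of "U j" j] deg_bound[of "W j" j] *[of "U j"] *[of "W j"] j
    by (auto intro!: small)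
  then have bnd': "arr s' 2 (U j) < B" "arr s' 2 (W j) < B" by simp_all
  show ?case
    unfolding wp.simps(3)
    by (rule wp_mono[OF wp_load_edge[OF inp 7(3) j]])
      (use 7(2) e r6 bnd bnd' small[of 1] in auto)
next
  case (8 s' t)
  have "(\<Sum>u\<in>nbh E v. if u = a then 1 else 0) = (if v \<in> nbh E a then 1 else (0 :: nat))" for v
    using nbh_props(2,4) by simp
  then show ?case using 8(1,4) assms(1) edge_sum[of _ "\<lambda>_. 1"] edge_sum[of _ "\<lambda>u. if u = a then 1 else 0"]
    by (simp add: inp_simps)
qed (use assms small[of m] small[of 1] in \<open>auto simp: inp_simps load_edge_def\<close>)

lemma wp_count_common:
  assumes "inp s" and clear: "\<forall>v<N. arr s 4 v = 0"
    and mk: "\<forall>v<N. arr s 2 v = (if v \<in> nbh E a then 1 else 0)"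
  shows "wp B count_common (\<lambda>s' t. (\<forall>v<N. arr s' 4 v = card (nbh E v \<inter> nbh E a)) \<and> t \<le> m * 100 + 6) s"
  unfolding count_common_def
proof (rule wp_FOR[where T = 92 and I = "\<lambda>j s'. \<forall>v<N. arr s' 4 v =
    (\<Sum>e<j. (if U e = v then arr s 2 (W e) else 0) + (if W e = v then arr s 2 (U e) else 0))"], goal_cases)
  case (7 j s')
  have j: "j < m" using 7 assms by (simp add: inp_simps)
  have inp: "inp s'" using inp_frame[OF 7(5) assms(1)] by (simp add: load_edge_def)
  have a2: "arr s' 2 = arr s 2" using 7(5) by (simp add: frame_def load_edge_def)
  note e = edge_in[OF j]
  have le1: "arr s 2 v \<le> 1" if "v < N" for v using mk that by auto
  have "(\<Sum>e<j. (if U e = v then arr s 2 (W e) else 0) + (if W e = v then arr s 2 (U e) else 0)) \<le>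
      (\<Sum>e<j. (if U e = v then 1 else 0) + (if W e = v then 1 else 0))" for v
  proof (intro sum_mono add_mono)
    fix e assume "e \<in> {..<j}"
    then have "e < m" using j by simp
    then show "(if U e = v then arr s 2 (W e) else 0) \<le> (if U e = v then 1 else 0)"
      "(if W e = v then arr s 2 (U e) else 0) \<le> (if W e = v then 1 else 0)"
      using le1 edge_in by auto
  qed
  then have *: "(\<Sum>e<j. (if U e = v then arr s 2 (W e) else 0) + (if W e = v then arr s 2 (U e) else 0)) \<le> 2 * j" for v
    using deg_bound[of v j] le_trans by blast
  have bnd: "arr s' 4 (U j) + arr s 2 (W j) < B" "arr s' 4 (W j) + arr s 2 (U j) < B"
    using 7(2) e *[of "U j"] *[of "W j"] j le1[of "U j"] le1[of "W j"] by (auto intro!: small)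
  show ?case
    unfolding wp.simps(3)
    by (rule wp_mono[OF wp_load_edge[OF inp 7(3) j]])
      (use 7(2) e a2 bnd in \<open>auto\<close>)
next
  case (8 s' t)
  have "(\<Sum>e<m. (if U e = v then arr s 2 (W e) else 0) + (if W e = v then arr s 2 (U e) else 0))
      = card (nbh E v \<inter> nbh E a)" for v
  proof -
    have "(\<Sum>u\<in>nbh E v. arr s 2 u) = (\<Sum>u\<in>nbh E v. if u \<in> nbh E a then 1 else 0)"
      by (rule sum.cong) (use mk nbh_props in auto)
    also have "\<dots> = card (nbh E v \<inter> nbh E a)" using nbh_props(2) by (simp add: sum.If_cases)
    finally show ?thesis using edge_sum[of v "arr s 2"] by simp
  qed
  then show ?case using 8 assms(1) by (simp add: inp_simps)
qed (use assms small[of m] small[of 1] in \<open>auto simp: inp_simps load_edge_def\<close>)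

lemma wp_assign_type:
  assumes "inp s" "reg s 6 = a" "a < N"
    and deg: "\<forall>v<N. arr s 3 v = card (nbh E v)"
    and mk: "\<forall>v<N. arr s 2 v = (if v \<in> nbh E a then 1 else 0)"
    and cnt: "\<forall>v<N. arr s 4 v = card (nbh E v \<inter> nbh E a)"
  shows "wp B assign_type (\<lambda>s' t. (\<forall>v<N. arr s' 1 v =
     (if arr s 1 v = 0 \<and> same_type E v a then reg s 4 else arr s 1 v)) \<and> t \<le> N * 100 + 6) s"
  unfolding assign_type_def
proof (rule wp_FOR[where T = 92 and I = "\<lambda>j s'. \<forall>v<N. arr s' 1 v =
     (if v < j \<and> arr s 1 v = 0 \<and> same_type E v a then reg s 4 else arr s 1 v)"], goal_cases)
  case (7 j s')
  have j: "j < N" using 7 assms by (simp add: inp_simps)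
  have fr: "arr s' 2 = arr s 2" "arr s' 3 = arr s 3" "arr s' 4 = arr s 4" "reg s' 6 = a" "reg s' 4 = reg s 4"
    using 7(5) assms(2) by (simp_all add: frame_def)
  have *: "same_type E j a \<longleftrightarrow> arr s 4 j + arr s 2 j = arr s 3 j \<and> arr s 3 j = arr s 3 a"
    using same_type_card[of E j a] nbh_props deg mk cnt j assms(3) by simp
  have "card (nbh E j \<inter> nbh E a) \<le> card {0..<N}" by (rule card_mono) (use nbh_props(1)[of j] in auto)
  then have bnd: "arr s 4 j + arr s 2 j < B" using cnt mk j by (auto intro!: small)
  show ?case
    using 7(2,3) j fr * bnd small[of 1] by (auto simp: less_Suc_eq)
qed (use assms small[of N] small[of 1] in \<open>auto simp: inp_simps\<close>)

end

section \<open>Bounding the number of types\<close>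

text \<open>Representatives of different types lie in different blocks of any partition into types.
  Thus the count made by the program is at most \<open>k\<close>, a number that the program never
  sees.\<close>

lemma card_types_le:
  fixes N :: nat
  assumes nd: "nd_at_most {0..<N} E k"
    and rep: "\<And>i. i \<in> {1..K} \<Longrightarrow> rep i < N"
    and diff: "\<And>i j. i \<in> {1..K} \<Longrightarrow> j \<in> {1..K} \<Longrightarrow> i < j \<Longrightarrow> \<not> same_type E (rep j) (rep i)"
  shows "K \<le> k"
proof -
  obtain P where P: "partition_on {0..<N} P" "finite P" "card P \<le> k"
    "\<And>S v v'. S \<in> P \<Longrightarrow> v \<in> S \<Longrightarrow> v' \<in> S \<Longrightarrow> same_type E v v'"
    using nd unfolding nd_at_most_def by blast
  have "\<exists>S\<in>P. rep i \<in> S" if "i \<in> {1..K}" for i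
  proof -
    have "rep i \<in> \<Union>P" using P(1) rep[OF that] by (simp add: partition_on_def)
    then show ?thesis by blast
  qed
  then obtain b where b: "\<And>i. i \<in> {1..K} \<Longrightarrow> b i \<in> P \<and> rep i \<in> b i" by metis
  have "inj_on b {1..K}"
  proof (rule inj_onI)
    fix i j assume ij: "i \<in> {1..K}" "j \<in> {1..K}" "b i = b j"
    then have "same_type E (rep i) (rep j)" "same_type E (rep j) (rep i)"
      using b[OF ij(1)] b[OF ij(2)] P(4) by auto
    then show "i = j" using diff ij by (metis linorder_neqE_nat)
  qed
  then have "card {1..K} \<le> card P" by (rule card_inj_on_le) (use b P(2) in auto)
  then show ?thesis using P(3) by simp
qed

context graph_input
begin

text \<open>Value 0 means untyped. That later and untyped vertices differ in type from
  representative \<open>i\<close> makes the representatives pairwise different in type, as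
  \<open>card_types_le\<close> demands.\<close>

definition types_inv :: "(nat \<Rightarrow> nat) \<Rightarrow> nat \<Rightarrow> bool" where
  "types_inv ty K \<longleftrightarrow> (\<forall>v<N. ty v \<le> K) \<and> (\<exists>rep. \<forall>i\<in>{1..K}. rep i < N \<and> ty (rep i) = i \<and>
     (\<forall>v<N. ty v = i \<longrightarrow> same_type E v (rep i)) \<and>
     (\<forall>v<N. ty v = 0 \<or> ty v > i \<longrightarrow> \<not> same_type E v (rep i)))"

lemma types_inv_le:
  assumes "types_inv ty K"
  shows "nd_at_most {0..<N} E k \<Longrightarrow> K \<le> k" "K \<le> N"
proof -
  obtain rep where rep: "\<And>i. i \<in> {1..K} \<Longrightarrow> rep i < N \<and> ty (rep i) = i \<and>
     (\<forall>v<N. ty v = 0 \<or> ty v > i \<longrightarrow> \<not> same_type E v (rep i))"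
    using assms unfolding types_inv_def by blast
  show "K \<le> k" if "nd_at_most {0..<N} E k"
    by (rule card_types_le[OF that, of K rep]) (use rep in auto)
  have "inj_on rep {1..K}" by (rule inj_on_inverseI[of _ ty]) (use rep in auto)
  then have "card {1..K} \<le> card {0..<N}" by (rule card_inj_on_le) (use rep in auto)
  then show "K \<le> N" by simp
qed

lemma types_inv_step:
  assumes "types_inv ty K" "a < N" "ty a = 0"
    and ty': "\<forall>v<N. ty' v = (if ty v = 0 \<and> same_type E v a then Suc K else ty v)"
  shows "types_inv ty' (Suc K)"
proof -
  obtain rep where rep: "\<forall>i\<in>{1..K}. rep i < N \<and> ty (rep i) = i \<and>
     (\<forall>v<N. ty v = i \<longrightarrow> same_type E v (rep i)) \<and>
     (\<forall>v<N. ty v = 0 \<or> ty v > i \<longrightarrow> \<not> same_type E v (rep i))"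
    and le: "\<forall>v<N. ty v \<le> K"
    using assms(1) unfolding types_inv_def by blast
  have refl: "same_type E a a" by (simp add: same_type_def)
  let ?rep = "rep(Suc K := a)"
  have "?rep i < N \<and> ty' (?rep i) = i \<and>
     (\<forall>v<N. ty' v = i \<longrightarrow> same_type E v (?rep i)) \<and>
     (\<forall>v<N. ty' v = 0 \<or> ty' v > i \<longrightarrow> \<not> same_type E v (?rep i))" if "i \<in> {1..Suc K}" for i
  proof (cases "i = Suc K")
    case True
    then show ?thesis using ty' le refl assms(2,3) by (auto split: if_splits)
  next
    case False
    then have i: "i \<in> {1..K}" using that by auto
    show ?thesis using rep[rule_format, OF i] ty' i False by (auto split: if_splits)
  qed
  moreover have "\<forall>v<N. ty' v \<le> Suc K" using ty' le by auto
  ultimately show ?thesis unfolding types_inv_def by (intro conjI exI[of _ ?rep]) auto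
qed

lemma wp_type_phase:
  assumes "inp s" and inv: "types_inv (arr s 1) (reg s 4)"
  shows "wp B type_phase (\<lambda>s' t.
    types_inv (arr s' 1) (reg s' 4) \<and>
    (if \<forall>v<N. arr s 1 v \<noteq> 0 then reg s' 5 = 0 \<and> reg s' 4 = reg s 4 \<and> arr s' 1 = arr s 1
     else reg s' 5 = reg s 5 \<and> reg s' 4 = Suc (reg s 4)) \<and> t \<le> 500 * (3 + N + 2 * m)) s"
  unfolding type_phase_def wp.simps(3)
proof (rule wp_mono[OF wp_find_free[OF assms(1)]], goal_cases)
  case (1 s1 t1)
  have inp1: "inp s1" using inp_frame[OF 1(1) assms(1)] by (simp add: mods_types)
  have f1: "arr s1 1 = arr s 1" "reg s1 4 = reg s 4" "reg s1 5 = reg s 5"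
    using 1(1) by (simp_all add: frame_def mods_types)
  show ?case
  proof (cases "reg s1 6 < N")
    case False
    then have "reg s1 6 = N" "\<forall>v<N. arr s 1 v \<noteq> 0" using 1(2) by auto
    then show ?thesis using 1(2) inv f1 inp1 small[of 0] by (simp add: inp_simps)
  next
    case True
    let ?a = "reg s1 6"
    have a0: "arr s 1 ?a = 0" using 1(2) True by auto
    then have na: "\<not> (\<forall>v<N. arr s 1 v \<noteq> 0)" using True by auto
    have K: "Suc (reg s 4) < B" using types_inv_le(2)[OF inv] by (intro small) simp
    have "wp B (clear_marks ;; mark_nbh ;; count_common ;; Asg 4 (Var 4 \<oplus> Num 1) ;; assign_type)
      (\<lambda>s' t. types_inv (arr s' 1) (reg s' 4) \<and> reg s' 5 = reg s 5 \<and> reg s' 4 = Suc (reg s 4) \<and>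
        t \<le> 117 * N + 200 * m + 30) s1"
      unfolding wp.simps(3)
    proof (rule wp_mono[OF wp_clear_marks[OF inp1]], goal_cases)
      case (1 s2 t2)
      have inp2: "inp s2" using inp_frame[OF 1(1) inp1] by (simp add: mods_types)
      have f2: "reg s2 6 = ?a" using 1(1) by (simp add: frame_def mods_types)
      have cl: "\<forall>v<N. arr s2 2 v = 0 \<and> arr s2 3 v = 0" using 1(2) by simp
      show ?case
      proof (rule wp_mono[OF wp_mark_nbh[OF inp2 f2 cl]], goal_cases)
        case (1 s3 t3)
        note fr3 = 1(1) and p3 = 1(2)
        have inp3: "inp s3" using inp_frame[OF fr3 inp2] by (simp add: mods_types)
        have cl3: "\<forall>v<N. arr s3 4 v = 0" using \<open>(\<forall>v<N. arr s2 2 v = 0 \<and> arr s2 3 v = 0 \<and> arr s2 4 v = 0) \<and> t2 \<le> N * 17 + 6\<close> fr3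
          by (simp add: frame_def mods_types)
        have mk3: "\<forall>v<N. arr s3 2 v = (if v \<in> nbh E ?a then 1 else 0)" using p3 by simp
        show ?case
        proof (rule wp_mono[OF wp_count_common[OF inp3 cl3 mk3]], goal_cases)
          case (1 s4 t4)
          let ?s4 = "set_reg 4 (Suc (reg s 4)) s4"
          have fr: "frame {7, 8, 9, 10} {2, 3, 4} s1 s4"
            using \<open>frame (mv clear_marks) (ma clear_marks) s1 s2\<close> fr3 1(1)
            by (simp add: frame_def mods_types)
          have inp4: "inp ?s4" using inp_frame[OF fr inp1] by (simp add: inp_def)
          have r4: "reg ?s4 6 = ?a" "arr ?s4 1 = arr s 1" "reg s4 4 = reg s 4" "reg s4 5 = reg s 5"
            using fr f1 by (simp_all add: frame_def)
          have deg4: "\<forall>v<N. arr ?s4 3 v = card (nbh E v)" "\<forall>v<N. arr ?s4 2 v = (if v \<in> nbh E ?a then 1 else 0)"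
            using p3 1(1) by (simp_all add: frame_def mods_types)
          have cnt4: "\<forall>v<N. arr ?s4 4 v = card (nbh E v \<inter> nbh E ?a)" using 1(2) by simp
          have "wp B assign_type (\<lambda>s' t. types_inv (arr s' 1) (reg s' 4) \<and> reg s' 5 = reg s 5 \<and>
              reg s' 4 = Suc (reg s 4) \<and> t \<le> N * 100 + 6) ?s4"
          proof (rule wp_mono[OF wp_assign_type[OF inp4 r4(1) True deg4 cnt4]], goal_cases)
            case (1 s5 t5)
            have "reg s5 4 = Suc (reg s 4)" "reg s5 5 = reg s 5"
              using 1(1) r4 by (simp_all add: frame_def mods_types)
            moreover have "types_inv (arr s5 1) (Suc (reg s 4))"
              by (rule types_inv_step[OF inv True a0]) (use 1(2) r4 in simp)
            ultimately show ?case using 1(2) by simp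
          qed
          then have "wp B assign_type (\<lambda>s' t. types_inv (arr s' 1) (reg s' 4) \<and> reg s' 5 = reg s 5 \<and>
              reg s' 4 = Suc (reg s 4) \<and> t2 + (t3 + (t4 + (4 + t))) \<le> 117 * N + 200 * m + 30) ?s4"
            by (rule wp_mono) (use 1(2) p3 \<open>(\<forall>v<N. arr s2 2 v = 0 \<and> arr s2 3 v = 0 \<and> arr s2 4 v = 0) \<and> t2 \<le> N * 17 + 6\<close> in auto)
          then show ?case using r4 K small[of 1] by simp
        qed
      qed
    qed
    note body = this
    have ne: "ev (Var 1 \<ominus> Var 6) s1 \<noteq> 0" using True inp1 by (simp add: inp_simps)
    show ?thesis
      unfolding wp.simps(4) if_P[OF ne]
      by (intro conjI, simp, rule wp_mono[OF body]) (use 1(2) na in auto)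
  qed
qed

lemma wp_find_types:
  assumes "inp s" "\<forall>v<N. arr s 1 v = 0" and nd: "nd_at_most {0..<N} E k"
  shows "wp B find_types (\<lambda>s' t. types_inv (arr s' 1) (reg s' 4) \<and> (\<forall>v<N. arr s' 1 v \<noteq> 0) \<and>
     t \<le> 600 * (k + 2) * (3 + N + 2 * m)) s"
proof -
  let ?s = "set_reg 5 1 (set_reg 4 0 s)"
  have inp: "inp ?s" using assms(1) by (simp add: inp_def)
  have "wp B (WHILE (Var 5) type_phase) (\<lambda>s' t. types_inv (arr s' 1) (reg s' 4) \<and>
     (\<forall>v<N. arr s' 1 v \<noteq> 0) \<and> Suc (Suc (Suc (Suc t))) \<le> 600 * (k + 2) * (3 + N + 2 * m)) ?s"
  \<comment> \<open>Each successful phase adds a type, and there are at most \<open>k\<close>. One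
    last phase finds no vertex and clears the flag in variable 5, the second summand of the
    measure.\<close>
  proof (rule wp_WHILE[where I = "\<lambda>s. types_inv (arr s 1) (reg s 4) \<and> reg s 5 \<le> 1 \<and>
      (reg s 5 = 0 \<longrightarrow> (\<forall>v<N. arr s 1 v \<noteq> 0))" and meas = "\<lambda>s. (k - reg s 4) + reg s 5"
      and T = "500 * (3 + N + 2 * m)"], goal_cases)
    case 1
    then show ?case using assms(2) by (simp add: types_inv_def)
  next
    case (3 s1)
    have inp1: "inp s1" using inp_frame[OF 3(2) inp] by (simp add: mods_types)
    show ?case
    proof (rule wp_mono[OF wp_type_phase[OF inp1]], goal_cases)
      case 1
      then show ?case using 3 by simp
    next
      case (2 s' t)
      have "reg s' 4 \<le> k" by (rule types_inv_le(1)[OF conjunct1[OF 2(2)] nd])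
      then show ?case using 2(2) 3 by (auto split: if_splits)
    qed
  next
    case (4 s' t)
    have "t \<le> (k + 1) * (500 * (3 + N + 2 * m) + 2) + 2" using 4(4) by simp
    also have "\<dots> + 4 \<le> 600 * (k + 2) * (3 + N + 2 * m)" by (simp add: algebra_simps)
    finally show ?case using 4 by simp
  qed simp
  then show ?thesis using small[of 0] small[of 1] by (simp add: find_types_def del: wp.simps(5))
qed

end

section \<open>Enumeration and brute force\<close>

text \<open>\<open>ENUM a b L c\<close> runs \<open>c\<close> with array \<open>a\<close> holding each number of \<open>L\<close> digits in base \<open>b\<close>.\<close>

definition ENUM :: "nat \<Rightarrow> nat \<Rightarrow> nat \<Rightarrow> scom \<Rightarrow> scom" where
  "ENUM a b L c =
     FOR 22 L (Put a (Var 22) (Num 0)) ;; Asg 21 (Num 1) ;;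
     WHILE (Var 21) (c ;; Asg 20 (Num 1) ;;
       FOR 22 L (Put a (Var 22) (Get a (Var 22) \<oplus> Var 20) ;;
         IF (Get a (Var 22) \<doteq> Var b) (Put a (Var 22) (Num 0)) (Asg 20 (Num 0))) ;;
       Asg 21 (Num 1 \<ominus> Var 20))"

lemma mods_ENUM [simp]:
  "mv (ENUM a b L c) = mv c \<union> {20, 21, 22}" "ma (ENUM a b L c) = insert a (ma c)"
  by (auto simp: ENUM_def)

text \<open>Adding 1 to \<open>k\<close> carries into digit \<open>j\<close> exactly if
  \<open>b ^ j\<close> divides \<open>Suc k\<close>, which describes the carry without mentioning
  the lower digits.\<close>

lemma odometer_step:
  fixes b k j :: nat
  assumes "b > 0"
  defines "d \<equiv> k div b ^ j mod b" and "c \<equiv> (if b ^ j dvd Suc k then 1 else 0 :: nat)"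
  shows "Suc k div b ^ j mod b = (if d + c = b then 0 else d + c)"
    and "b ^ Suc j dvd Suc k \<longleftrightarrow> d + c = b"
proof -
  have bj: "b ^ j > 0" using assms(1) by simp
  have dl: "d < b" using assms(1) by (simp add: d_def)
  have div: "Suc k div b ^ j = k div b ^ j + c"
    by (simp add: div_Suc c_def dvd_eq_mod_eq_0)
  have mod: "Suc k div b ^ j mod b = (d + c) mod b"
    by (simp add: div d_def mod_add_left_eq)
  have "d + c \<le> b" using dl by (auto simp: c_def)
  then show 1: "Suc k div b ^ j mod b = (if d + c = b then 0 else d + c)"
    using mod by auto
  show "b ^ Suc j dvd Suc k \<longleftrightarrow> d + c = b"
  proof
    assume dvd: "b ^ Suc j dvd Suc k"
    then obtain q where q: "Suc k = b ^ j * (b * q)" by (auto simp: dvd_def ac_simps)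
    then have "b ^ j dvd Suc k" by simp
    then have "c = 1" by (simp add: c_def)
    moreover have "Suc k div b ^ j mod b = 0" using q bj by simp
    ultimately show "d + c = b" using 1 by (auto split: if_splits)
  next
    assume eq: "d + c = b"
    then have "c \<noteq> 0" using dl by auto
    then have "b ^ j dvd Suc k" by (simp add: c_def split: if_splits)
    then have "Suc k = b ^ j * (Suc k div b ^ j)" by simp
    moreover have "b dvd Suc k div b ^ j" using 1 eq by (simp add: dvd_eq_mod_eq_0)
    ultimately show "b ^ Suc j dvd Suc k" by (metis mult_dvd_mono dvd_refl power_Suc2)
  qed
qed

text \<open>The index \<open>k\<close> exists only in the proof, since the number of candidates may
  exceed the word limit. The program stores digits, and a carry out of the last one, that is
  \<open>nb ^ n dvd Suc k\<close>, ends the loop. The invariant has to survive changes of the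
  scratch variables and of the digit array, hence the quantified frames.\<close>

lemma wp_ENUM:
  assumes b: "b \<notin> mv c" "b \<notin> {20, 21, 22}" and L: "L \<notin> mv c" "L \<notin> {20, 21, 22}"
    and c: "mv c \<inter> {20, 21, 22} = {}" "a \<notin> ma c"
    and bounds: "1 < B" "0 < reg s0 b" "reg s0 b < B" "reg s0 L < B"
    and init: "\<And>s. frame {20, 21, 22} {a} s0 s \<Longrightarrow> I 0 s"
    and body: "\<And>k s. k < reg s0 b ^ reg s0 L \<Longrightarrow> I k s \<Longrightarrow>
      frame (mv c \<union> {20, 21, 22}) (insert a (ma c)) s0 s \<Longrightarrow>
      (\<forall>i<reg s0 L. arr s a i = k div reg s0 b ^ i mod reg s0 b) \<Longrightarrow>
      wp B c (\<lambda>s' t. t \<le> T \<and> (\<forall>s''. frame {20, 21, 22} {a} s' s'' \<longrightarrow> I (Suc k) s'')) s"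
    and fin: "\<And>s t. I (reg s0 b ^ reg s0 L) s \<Longrightarrow>
      frame (mv c \<union> {20, 21, 22}) (insert a (ma c)) s0 s \<Longrightarrow>
      t \<le> reg s0 b ^ reg s0 L * (T + 50 * reg s0 L + 50) + 50 * reg s0 L + 50 \<Longrightarrow> Q s t"
  shows "wp B (ENUM a b L c) Q s0"
proof -
  define nb where "nb = reg s0 b"
  define n where "n = reg s0 L"
  have nb: "0 < nb" "nb < B" "n < B" using bounds by (simp_all add: nb_def n_def)
  define J where "J m s \<longleftrightarrow> frame (mv c \<union> {20, 21, 22}) (insert a (ma c)) s0 s \<and>
    (if reg s 21 \<noteq> 0 then \<exists>k<nb ^ n. m = nb ^ n - k \<and> I k s \<and> (\<forall>i<n. arr s a i = k div nb ^ i mod nb)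
     else I (nb ^ n) s)" for m s
  let ?inc = "FOR 22 L (Put a (Var 22) (Get a (Var 22) \<oplus> Var 20) ;;
         IF (Get a (Var 22) \<doteq> Var b) (Put a (Var 22) (Num 0)) (Asg 20 (Num 0)))"
  have inc: "wp B ?inc (\<lambda>s' t. reg s' 20 = (if nb ^ n dvd Suc k then 1 else 0) \<and>
      (\<forall>i<n. arr s' a i = Suc k div nb ^ i mod nb) \<and> t \<le> n * 38 + 6) s"
    if s: "reg s 20 = 1" "\<forall>i<n. arr s a i = k div nb ^ i mod nb" "reg s b = nb" "reg s L = n" for s k
  proof (rule wp_FOR[where T = 30 and I = "\<lambda>j s'. reg s' 20 = (if nb ^ j dvd Suc k then 1 else 0) \<and>
      (\<forall>i<n. arr s' a i = (if i < j then Suc k div nb ^ i mod nb else k div nb ^ i mod nb))"], goal_cases)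
    case (7 j s')
    have j: "j < n" using 7 s by simp
    have rb: "reg s' b = nb" using 7(5) b s by (simp add: frame_def)
    note st = odometer_step[OF nb(1), where k = k and j = j]
    have d: "arr s' a j = k div nb ^ j mod nb" using 7(2) j by simp
    have dl: "k div nb ^ j mod nb < nb" using nb(1) by simp
    then have sum: "arr s' a j + reg s' 20 < B" using 7(2) d nb(2) by auto
    show ?case
    proof (cases "arr s' a j + reg s' 20 = nb")
      case True
      then have "nb ^ Suc j dvd Suc k" "Suc k div nb ^ j mod nb = 0" "reg s' 20 = 1"
        using st d 7(2) dl by auto
      then show ?thesis using True 7(2,3) rb sum bounds(1) b j by (auto simp: less_Suc_eq)
    next
      case False
      then have "\<not> nb ^ Suc j dvd Suc k" "Suc k div nb ^ j mod nb = arr s' a j + reg s' 20"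
        using st d 7(2) by auto
      then show ?thesis using False 7(2,3) rb sum bounds(1) b j by (auto simp: less_Suc_eq)
    qed
  next
    case (8 s' t)
    then show ?case using s by simp
  qed (use s L b nb bounds in auto)
  have "wp B (WHILE (Var 21) (c ;; Asg 20 (Num 1) ;; ?inc ;; Asg 21 (Num 1 \<ominus> Var 20)))
      (\<lambda>s t. Q s (t0 + (2 + t))) s1"
    if s1: "frame {20, 21, 22} {a} s0 s1" "reg s1 21 = 1" "\<forall>i<n. arr s1 a i = 0" and t0: "t0 \<le> n * 12 + 6" for s1 t0
  proof (rule wp_WHILE_count[where J = J and T = "T + n * 38 + 20" and ?m0.0 = "nb ^ n"], goal_cases)
    case 1
    have "frame {20, 21, 22} {a} s0 s1" using s1(1) .
    then have "I 0 s1" by (rule init)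
    then show ?case unfolding J_def
      using s1 nb(1) frame_mono[OF s1(1), of "mv c \<union> {20, 21, 22}" "insert a (ma c)"]
      by (auto intro!: exI[of _ 0])
  next
    case (3 m s)
    then obtain k where k: "k < nb ^ n" "m = nb ^ n - k" "I k s" "\<forall>i<n. arr s a i = k div nb ^ i mod nb"
      and fr: "frame (mv c \<union> {20, 21, 22}) (insert a (ma c)) s0 s"
      by (auto simp: J_def split: if_splits)
    show ?case
      unfolding wp.simps(3)
    proof (rule wp_mono[OF body[of k s, folded nb_def n_def, OF k(1) k(3) fr k(4)]], goal_cases)
      case (1 s' t)
      have f2: "frame (mv c \<union> {20, 21, 22}) (insert a (ma c)) s0 s'"
        by (rule frame_trans[OF fr]) (use 1(1) in \<open>auto elim!: frame_mono\<close>)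
      have dig: "\<forall>i<n. arr s' a i = k div nb ^ i mod nb" using k(4) 1(1) c(2) by (simp add: frame_def)
      have rr: "reg s' b = nb" "reg s' L = n" using f2 b L by (simp_all add: frame_def nb_def n_def)
      show ?case
        unfolding wp.simps(1)
      proof (intro conjI)
        show "safe B (Num 1) s'" using bounds by simp
        show "wp B ?inc (\<lambda>s1 t1. safe B (Num 1 \<ominus> Var 20) s1 \<and> (\<exists>m'<m. J m' (set_reg 21 (ev (Num 1 \<ominus> Var 20) s1) s1)) \<and>
            t + (ecost (Num 1) + 1 + (t1 + (ecost (Num 1 \<ominus> Var 20) + 1))) \<le> T + n * 38 + 20)
          (set_reg 20 (ev (Num 1) s') s')"
        proof (rule wp_mono[OF inc[of "set_reg 20 (ev (Num 1) s') s'" k]])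
          show "reg (set_reg 20 (ev (Num 1) s') s') 20 = 1"
            "\<forall>i<n. arr (set_reg 20 (ev (Num 1) s') s') a i = k div nb ^ i mod nb"
            "reg (set_reg 20 (ev (Num 1) s') s') b = nb" "reg (set_reg 20 (ev (Num 1) s') s') L = n"
            using dig rr b L by simp_all
        next
          fix s2 t2
          assume 5: "frame (mv ?inc) (ma ?inc) (set_reg 20 (ev (Num 1) s') s') s2"
            "reg s2 20 = (if nb ^ n dvd Suc k then 1 else 0) \<and>
              (\<forall>i<n. arr s2 a i = Suc k div nb ^ i mod nb) \<and> t2 \<le> n * 38 + 6"
          let ?s2 = "set_reg 21 (ev (Num 1 \<ominus> Var 20) s2) s2"
          have "frame {20, 21, 22} {a} s' ?s2" using 5(1) by (auto simp: frame_def)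
          then have I: "I (Suc k) ?s2" using 1(2) by blast
          have f3: "frame (mv c \<union> {20, 21, 22}) (insert a (ma c)) s0 ?s2"
            by (rule frame_trans[OF f2]) (use 5(1) in \<open>auto simp: frame_def\<close>)
          have "J (nb ^ n - Suc k) ?s2"
          proof (cases "Suc k = nb ^ n")
            case True
            then have "reg ?s2 21 = 0" using 5(2) by simp
            then show ?thesis using I f3 True by (simp add: J_def)
          next
            case False
            then have lt: "Suc k < nb ^ n" using k(1) by simp
            then have "\<not> nb ^ n dvd Suc k" by (auto dest: dvd_imp_le)
            then have "reg ?s2 21 = 1" using 5(2) by simp
            then show ?thesis using I f3 lt 5(2) by (auto simp: J_def)
          qed
          moreover have "nb ^ n - Suc k < m" using k(1,2) by simp
          ultimately show "safe B (Num 1 \<ominus> Var 20) s2 \<and> (\<exists>m'<m. J m' ?s2) \<and>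
            t + (ecost (Num 1) + 1 + (t2 + (ecost (Num 1 \<ominus> Var 20) + 1))) \<le> T + n * 38 + 20"
            using 5(2) 1(2) bounds(1) by auto
        qed
      qed
    qed
  next
    case (4 m s t)
    then have "I (nb ^ n) s" "frame (mv c \<union> {20, 21, 22}) (insert a (ma c)) s0 s"
      by (auto simp: J_def)
    moreover have "t0 + (2 + t) \<le> nb ^ n * (T + 50 * n + 50) + 50 * n + 50"
    proof -
      have "t \<le> nb ^ n * (22 + (T + n * 38)) + 2" using 4(4) by simp
      moreover have "nb ^ n * (22 + (T + n * 38)) \<le> nb ^ n * (T + 50 * n + 50)"
        by (intro mult_left_mono) auto
      ultimately show ?thesis using t0 by linarith
    qed
    ultimately show ?case unfolding nb_def n_def by (rule fin)
  qed simp
  note main = this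
  show ?thesis
    unfolding ENUM_def wp.simps(3)
  proof (rule wp_FOR[where T = 4 and I = "\<lambda>j s'. \<forall>i<j. arr s' a i = 0"], goal_cases)
    case (8 s t)
    have "wp B (WHILE (Var 21) (c ;; Asg 20 (Num 1) ;; ?inc ;; Asg 21 (Num 1 \<ominus> Var 20)))
      (\<lambda>s t'. Q s (t + (2 + t'))) (set_reg 21 1 s)"
      by (rule main) (use 8 in \<open>auto simp: n_def frame_def\<close>)
    then show ?case using bounds(1) by (simp del: wp.simps(5))
  qed (use L bounds in \<open>auto simp: less_Suc_eq\<close>)
qed

section \<open>Capped powers and exhaustive coloring\<close>

text \<open>The power itself may not fit into a word. Truncating after every doubling keeps all
  intermediate values at most twice the cap.\<close>

definition capped_pow :: "nat \<Rightarrow> nat \<Rightarrow> nat \<Rightarrow> scom" where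
  "capped_pow x n cap = Asg x (Num 1) ;;
     FOR 22 n (Asg x (Var x \<oplus> Var x) ;; IF (Var cap \<prec> Var x) (Asg x (Var cap)) NOP)"

lemma mods_capped_pow [simp]: "mv (capped_pow x n cap) = {0, 22, x}" "ma (capped_pow x n cap) = {}"
  by (auto simp: capped_pow_def)

lemma wp_capped_pow:
  assumes "n \<notin> {0, 22, x}" "cap \<notin> {0, 22, x}" "x \<notin> {0, 22}" "1 < B" "reg s n < B" "2 * reg s cap < B" "1 \<le> reg s cap"
  shows "wp B (capped_pow x n cap) (\<lambda>s' t. reg s' x = min (2 ^ reg s n) (reg s cap) \<and> t \<le> reg s n * 20 + 8) s"
proof -
  have "wp B (FOR 22 n (Asg x (Var x \<oplus> Var x) ;; IF (Var cap \<prec> Var x) (Asg x (Var cap)) NOP))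
     (\<lambda>s' t. reg s' x = min (2 ^ reg s n) (reg s cap) \<and> 2 + t \<le> reg s n * 20 + 8) (set_reg x 1 s)"
  proof (rule wp_FOR[where T = 12 and I = "\<lambda>j s'. reg s' x = min (2 ^ j) (reg s cap)"], goal_cases)
    case (7 j s')
    have cap: "reg s' cap = reg s cap" using 7(5) assms by (simp add: frame_def)
    show ?case using 7(2) cap assms by (auto simp: min_def)
  qed (use assms in auto)
  then show ?thesis using assms by (simp add: capped_pow_def)
qed

text \<open>Array 5 holds digits from 0 to r - 1 while colors run from 1 to r, hence the added 1 in
  the comparison with the input. Variable 0 is only ever set to 1, so it remembers success across
  candidates.\<close>

definition check_coloring :: scom where
  "check_coloring = Asg 11 (Num 1) ;;
     FOR 7 1 (Asg 9 (col_exp 7) ;;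
       IF (Var 9) (IF (Var 9 \<doteq> Get 5 (Var 7) \<oplus> Num 1) (Asg 9 (Num 0)) (Asg 11 (Num 0))) (Asg 9 (Num 0))) ;;
     FOR 8 3 (load_edge ;;
       IF (Get 5 (Var 9) \<doteq> Get 5 (Var 10)) (Asg 11 (Num 0)) (Asg 9 (Num 0))) ;;
     IF (Var 11) (Asg 0 (Num 1)) (Asg 9 (Num 0))"

definition brute :: scom where
  "brute = Asg 0 (Num 0) ;; ENUM 5 2 1 check_coloring"

lemma mods_brute [simp]: "mv check_coloring = {0, 7, 8, 9, 10, 11}" "ma check_coloring = {}"
  by (auto simp: check_coloring_def load_edge_def)

context graph_input
begin

definition good_coloring :: "(nat \<Rightarrow> nat) \<Rightarrow> bool" where
  "good_coloring a \<longleftrightarrow> (\<forall>v<N. A0 (3 + v) = 0 \<or> A0 (3 + v) = a v + 1) \<and> (\<forall>e<m. a (U e) \<noteq> a (W e))"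

lemma col_cases: "v < N \<Longrightarrow> A0 (3 + v) = 0 \<longleftrightarrow> p v = None"
    "v < N \<Longrightarrow> c \<noteq> 0 \<Longrightarrow> A0 (3 + v) = c \<longleftrightarrow> p v = Some c"
    "v < N \<Longrightarrow> A0 (3 + v) \<le> r"
proof -
  assume v: "v < N"
  have rng: "ran p \<subseteq> {1..r}" using precol by (simp add: precol_instance_def proper_partial_coloring_def)
  have "c \<in> {1..r}" if "p v = Some c" for c using rng ranI[of p v c] that by blast
  then show "A0 (3 + v) = 0 \<longleftrightarrow> p v = None" "c \<noteq> 0 \<Longrightarrow> A0 (3 + v) = c \<longleftrightarrow> p v = Some c" "A0 (3 + v) \<le> r"
    using col[OF v] by (auto split: option.splits)
qed

lemma good_coloring_iff:
  "(\<exists>k<r ^ N. good_coloring (\<lambda>i. k div r ^ i mod r)) \<longleftrightarrow> precol_extendible {0..<N} E r p"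
proof
  assume "\<exists>k<r ^ N. good_coloring (\<lambda>i. k div r ^ i mod r)"
  then obtain k where g: "good_coloring (\<lambda>i. k div r ^ i mod r)" by blast
  define a where "a i = k div r ^ i mod r" for i
  have r0: "r > 0" using precol by (simp add: precol_instance_def)
  have al: "a i < r" for i using r0 by (simp add: a_def)
  have g': "\<And>v. v < N \<Longrightarrow> A0 (3 + v) = 0 \<or> A0 (3 + v) = a v + 1" "\<And>e. e < m \<Longrightarrow> a (U e) \<noteq> a (W e)"
    using g by (auto simp: good_coloring_def a_def)
  define f where "f v = (if v < N then Some (a v + 1) else None)" for v
  have dom: "dom f = {0..<N}" by (auto simp: f_def dom_def)
  have "proper_partial_coloring {0..<N} E r f"
    unfolding proper_partial_coloring_def
  proof (intro conjI ballI impI)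
    show "dom f \<subseteq> {0..<N}" using dom by simp
    show "ran f \<subseteq> {1..r}" using al by (auto simp: ran_def f_def Suc_le_eq)
  next
    fix u v assume uv: "u \<in> dom f" "v \<in> dom f" "{u, v} \<in> E"
    then obtain e where "e < m" "{u, v} = {U e, W e}" using E_eq by auto
    then have "a u \<noteq> a v" using g'(2)[of e] by (auto simp: doubleton_eq_iff)
    then show "f u \<noteq> f v" using uv dom by (simp add: f_def)
  qed
  moreover have "p \<subseteq>\<^sub>m f"
    unfolding map_le_def
  proof
    fix v assume "v \<in> dom p"
    then obtain c where c: "p v = Some c" by auto
    have "dom p \<subseteq> {0..<N}" using precol by (simp add: precol_instance_def proper_partial_coloring_def)
    then have v: "v < N" using \<open>v \<in> dom p\<close> by auto
    then have "A0 (3 + v) = a v + 1" using g'(1)[OF v] col_cases(1)[OF v] c by auto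
    then show "p v = f v" using col_cases(2)[OF v, of "a v + 1"] v by (simp add: f_def)
  qed
  ultimately show "precol_extendible {0..<N} E r p" using dom by (auto simp: precol_extendible_def)
next
  assume "precol_extendible {0..<N} E r p"
  then obtain f where f: "proper_partial_coloring {0..<N} E r f" "dom f = {0..<N}" "p \<subseteq>\<^sub>m f"
    by (auto simp: precol_extendible_def)
  define a where "a v = the (f v) - 1" for v
  have fa: "f v = Some (a v + 1) \<and> a v < r" if "v < N" for v
  proof -
    have "v \<in> dom f" using f(2) that by simp
    then obtain c where c: "f v = Some c" by blast
    moreover have "ran f \<subseteq> {1..r}" using f(1) by (simp add: proper_partial_coloring_def)
    ultimately have "c \<in> {1..r}" using ranI[of f v c] by blast
    then show ?thesis using c by (auto simp: a_def)
  qed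
  obtain k where k: "k < r ^ N" "\<And>i. i < N \<Longrightarrow> k div r ^ i mod r = a i"
    by (rule number_with_digits[of N a r]) (use fa in auto)
  have "good_coloring (\<lambda>i. k div r ^ i mod r)"
    unfolding good_coloring_def
  proof (intro conjI allI impI)
    fix v assume v: "v < N"
    show "A0 (3 + v) = 0 \<or> A0 (3 + v) = k div r ^ v mod r + 1"
    proof (cases "p v")
      case None
      then show ?thesis using col_cases(1)[OF v] by simp
    next
      case (Some c)
      then have "f v = Some c" using f(3) by (metis domI map_le_def)
      then have "p v = Some (a v + 1)" using fa[OF v] Some by simp
      then show ?thesis using col_cases(2)[OF v, of "a v + 1"] k(2)[OF v] by simp
    qed
  next
    fix e assume e: "e < m"
    note ed = edge_in[OF e]
    have "{U e, W e} \<in> E" using e E_eq by auto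
    then have "f (U e) \<noteq> f (W e)" using f(1,2) ed by (simp add: proper_partial_coloring_def)
    then show "k div r ^ U e mod r \<noteq> k div r ^ W e mod r"
      using fa[OF ed(1)] fa[OF ed(2)] k(2)[OF ed(1)] k(2)[OF ed(2)] by simp
  qed
  then show "\<exists>k<r ^ N. good_coloring (\<lambda>i. k div r ^ i mod r)" using k(1) by blast
qed

lemma wp_check_coloring:
  assumes "inp s" and small_a: "\<forall>v<N. arr s 5 v < r"
  shows "wp B check_coloring (\<lambda>s' t. reg s' 0 = (if good_coloring (arr s 5) then 1 else reg s 0) \<and>
     t \<le> 50 * N + 70 * m + 30) s"
proof -
  let ?P1 = "\<lambda>j. \<forall>v<j. A0 (3 + v) = 0 \<or> A0 (3 + v) = arr s 5 v + 1"
  let ?P2 = "\<lambda>j. \<forall>e<j. arr s 5 (U e) \<noteq> arr s 5 (W e)"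
  let ?L1 = "FOR 7 1 (Asg 9 (col_exp 7) ;;
       IF (Var 9) (IF (Var 9 \<doteq> Get 5 (Var 7) \<oplus> Num 1) (Asg 9 (Num 0)) (Asg 11 (Num 0))) (Asg 9 (Num 0)))"
  let ?L2 = "FOR 8 3 (load_edge ;;
       IF (Get 5 (Var 9) \<doteq> Get 5 (Var 10)) (Asg 11 (Num 0)) (Asg 9 (Num 0)))"
  have L1: "wp B ?L1 (\<lambda>s' t. reg s' 11 = (if ?P1 N then 1 else 0) \<and> t \<le> N * 45 + 6) (set_reg 11 1 s)"
  proof (rule wp_FOR[where T = 37 and I = "\<lambda>j s'. reg s' 11 = (if ?P1 j then 1 else 0)"], goal_cases)
    case (7 j s')
    have j: "j < N" using 7 assms by (simp add: inp_simps)
    have fr: "arr s' 0 = A0" "arr s' 5 = arr s 5" using 7(5) assms(1) by (simp_all add: frame_def inp_def)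
    have sm: "arr s 5 j + 1 < B" "3 + j < B" using small_a j rN by (auto intro!: small)
    have P: "?P1 (Suc j) \<longleftrightarrow> ?P1 j \<and> (A0 (3 + j) = 0 \<or> A0 (3 + j) = arr s 5 j + 1)"
      by (auto simp: less_Suc_eq)
    show ?case
      unfolding P using 7(2,3) fr sm small[of 0] small[of 1] small[of 3] by (auto simp: col_exp_def)
  qed (use assms small[of N] small[of 1] in \<open>auto simp: inp_simps\<close>)
  have L2: "wp B ?L2 (\<lambda>s'' t. reg s'' 11 = (if ?P1 N \<and> ?P2 m then 1 else 0) \<and> t \<le> m * 68 + 6) s'"
    if s': "inp s'" "arr s' 5 = arr s 5" "reg s' 11 = (if ?P1 N then 1 else 0)" for s'
  proof (rule wp_FOR[where T = 60 and I = "\<lambda>j s'. reg s' 11 = (if ?P1 N \<and> ?P2 j then 1 else 0)"], goal_cases)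
    case (7 j s'')
    have j: "j < m" using 7 s' by (simp add: inp_simps)
    have inp: "inp s''" using inp_frame[OF 7(5) s'(1)] by (simp add: load_edge_def)
    have fr: "arr s'' 5 = arr s 5" using 7(5) s'(2) by (simp add: frame_def load_edge_def)
    have P: "?P2 (Suc j) \<longleftrightarrow> ?P2 j \<and> arr s 5 (U j) \<noteq> arr s 5 (W j)"
      by (auto simp: less_Suc_eq)
    show ?case
      unfolding wp.simps(3) P
      by (rule wp_mono[OF wp_load_edge[OF inp 7(3) j]])
        (use 7(2) fr small[of 0] small[of 1] in auto)
  next
    case (8 s t)
    then show ?case using s' by (simp add: inp_simps)
  qed (use s' small[of m] small[of 1] in \<open>auto simp: inp_simps load_edge_def\<close>)
  have good: "good_coloring (arr s 5) \<longleftrightarrow> ?P1 N \<and> ?P2 m" by (simp add: good_coloring_def)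
  have "wp B (?L1 ;; ?L2 ;; IF (Var 11) (Asg 0 (Num 1)) (Asg 9 (Num 0)))
    (\<lambda>s' t. reg s' 0 = (if good_coloring (arr s 5) then 1 else reg s 0) \<and> 2 + t \<le> 50 * N + 70 * m + 30) (set_reg 11 1 s)"
    unfolding wp.simps(3)
  proof (rule wp_mono[OF L1], goal_cases)
    case (1 s1 t1)
    have i1: "inp s1" by (rule inp_frame[OF 1(1)]) (use assms(1) in \<open>auto simp: inp_def col_exp_def\<close>)
    have f1: "arr s1 5 = arr s 5" "reg s1 0 = reg s 0" using 1(1) by (simp_all add: frame_def col_exp_def)
    show ?case
    proof (rule wp_mono[OF L2[OF i1 f1(1)]], goal_cases)
      case 1
      then show ?case using \<open>reg s1 11 = (if ?P1 N then 1 else 0) \<and> t1 \<le> N * 45 + 6\<close> by simp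
    next
      case (2 s2 t2)
      have "reg s2 0 = reg s 0" using 2(1) f1 by (simp add: frame_def load_edge_def)
      then show ?case unfolding good
        using 2(2) \<open>reg s1 11 = (if ?P1 N then 1 else 0) \<and> t1 \<le> N * 45 + 6\<close> small[of 0] small[of 1] by auto
    qed
  qed
  then show ?thesis unfolding check_coloring_def using small[of 1] by (intro wp_Asg_Num) simp
qed

lemma wp_brute:
  assumes "inp s"
  shows "wp B brute (\<lambda>s' t. (reg s' 0 \<noteq> 0 \<longleftrightarrow> precol_extendible {0..<N} E r p) \<and>
     t \<le> r ^ N * (500 * (3 + N + 2 * m))) s"
proof -
  let ?s = "set_reg 0 0 s"
  let ?g = "\<lambda>k. good_coloring (\<lambda>i. k div r ^ i mod r)"
  have inp: "inp ?s" using assms by (simp add: inp_def)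
  have r0: "r > 0" using precol by (simp add: precol_instance_def)
  have rr: "reg ?s 2 = r" "reg ?s 1 = N" using inp by (simp_all only: inp_simps)
  have "wp B (ENUM 5 2 1 check_coloring) (\<lambda>s' t. (reg s' 0 \<noteq> 0 \<longleftrightarrow> precol_extendible {0..<N} E r p) \<and>
     2 + t \<le> r ^ N * (500 * (3 + N + 2 * m))) ?s"
  proof (rule wp_ENUM[where I = "\<lambda>k s. reg s 0 \<noteq> 0 \<longleftrightarrow> (\<exists>k'<k. ?g k')" and T = "50 * N + 70 * m + 30"], goal_cases)
    case (11 s')
    then show ?case by (simp add: frame_def)
  next
    case (12 k s')
    have i: "inp s'" by (rule inp_frame[OF 12(3) inp]) auto
    have "\<forall>v<N. arr s' 5 v < r" using 12(4) r0 unfolding rr by simp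
    moreover have "good_coloring (arr s' 5) = ?g k"
      unfolding good_coloring_def using 12(4) edge_in unfolding rr by simp
    ultimately show ?case
      by (intro wp_mono[OF wp_check_coloring[OF i]]) (use 12(2) in \<open>auto simp: less_Suc_eq frame_def\<close>)
  next
    case (13 s' t)
    have "2 + t \<le> r ^ N * (50 * N + 70 * m + 30 + 50 * N + 50) + 50 * N + 52" using 13(3) unfolding rr by simp
    also have "\<dots> \<le> r ^ N * (50 * N + 70 * m + 30 + 50 * N + 50) + r ^ N * (50 * N + 52)"
      using r0 by simp
    also have "\<dots> = r ^ N * (150 * N + 70 * m + 132)" by (simp add: algebra_simps)
    also have "\<dots> \<le> r ^ N * (500 * (3 + N + 2 * m))" by (intro mult_left_mono) auto
    finally show ?case using 13(1) good_coloring_iff unfolding rr by simp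
  qed (use r0 rN small[of 1] small[of N] small[of r] rr in auto)
  then show ?thesis unfolding brute_def using small[of 0] by (intro wp_Asg_Num) simp
qed

end

section \<open>Setting up the counting problem\<close>

lemma index_eq:
  fixes K :: nat
  assumes "j < K" "j' < K"
  shows "i * K + j = i' * K + j' \<longleftrightarrow> i = i' \<and> j = j'"
proof
  assume eq: "i * K + j = i' * K + j'"
  have "(i * K + j) div K = i" "(i * K + j) mod K = j" "(i' * K + j') div K = i'" "(i' * K + j') mod K = j'"
    using assms by simp_all
  then show "i = i' \<and> j = j'" using eq by metis
qed simp

text \<open>
  Array \<open>6\<close> is the adjacency matrix of the types, \<open>7\<close> and \<open>8\<close> hold the number of uncolored vertices
  and a flag for precolored vertices of each type, \<open>9\<close> the demands, \<open>10\<close> the powers of \<open>3\<close>, \<open>20\<close> the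
  part of the code of each color that is given by the precoloring (\<open>11\<close> flags the digits already
  set), \<open>12\<close> the number of colors with a given such part, \<open>13\<close> the current \<open>x\<close>, \<open>14\<close> the part of a
  code that is given by the precoloring, \<open>15\<close> flags inadmissible codes. Variable \<open>12\<close> holds \<open>3\<^sup>K\<close>.
\<close>

definition adjacency :: scom where
  "adjacency = FOR 8 3 (load_edge ;;
     Asg 9 (Get 1 (Var 9) \<ominus> Num 1) ;; Asg 10 (Get 1 (Var 10) \<ominus> Num 1) ;;
     Put 6 (Var 9 \<otimes> Var 4 \<oplus> Var 10) (Num 1) ;; Put 6 (Var 10 \<otimes> Var 4 \<oplus> Var 9) (Num 1))"

definition tally :: scom where
  "tally = FOR 7 1 (Asg 9 (Get 1 (Var 7) \<ominus> Num 1) ;; Asg 10 (col_exp 7) ;;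
     IF (Var 10) (Put 8 (Var 9) (Num 1)) (Put 7 (Var 9) (Get 7 (Var 9) \<oplus> Num 1)))"

definition demands :: scom where
  "demands = FOR 19 4 (IF (Get 6 (Var 19 \<otimes> Var 4 \<oplus> Var 19)) (Put 9 (Var 19) (Get 7 (Var 19)))
     (IF (Get 8 (Var 19)) (Put 9 (Var 19) (Num 0))
       (IF (Get 7 (Var 19)) (Put 9 (Var 19) (Num 1)) (Put 9 (Var 19) (Num 0)))))"

definition powers3 :: scom where
  "powers3 = Asg 12 (Num 1) ;; FOR 19 4 (Put 10 (Var 19) (Var 12) ;; Asg 12 (Num 3 \<otimes> Var 12))"

definition masks :: scom where
  "masks = FOR 7 1 (Asg 9 (Get 1 (Var 7) \<ominus> Num 1) ;; Asg 10 (col_exp 7) ;;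
     IF (Var 10) (IF (Get 11 (Var 10 \<otimes> Var 4 \<oplus> Var 9)) (Asg 10 (Num 0))
       (Put 11 (Var 10 \<otimes> Var 4 \<oplus> Var 9) (Num 1) ;;
        Put 20 (Var 10) (Get 20 (Var 10) \<oplus> Get 10 (Var 9)))) (Asg 10 (Num 0)))"

text \<open>Array 13 receives the same numbers as array 12: they are the start
  \<open>count mc\<close> of the local search.\<close>

definition mask_counts :: scom where
  "mask_counts = FOR 7 2 (Asg 9 (Get 20 (Var 7 \<oplus> Num 1)) ;;
     Put 12 (Var 9) (Get 12 (Var 9) \<oplus> Num 1) ;; Put 13 (Var 9) (Get 13 (Var 9) \<oplus> Num 1))"

text \<open>The machine operations include no remainder, so \<open>y mod 3\<close> is formed as
  \<open>y - 3 * (y div 3)\<close>.\<close>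

definition trit_exp :: "nat \<Rightarrow> exp" where
  "trit_exp i = (Var 18 \<oslash> Get 10 (Var i)) \<ominus> Num 3 \<otimes> ((Var 18 \<oslash> Get 10 (Var i)) \<oslash> Num 3)"

text \<open>What remains after small graphs have gone to exhaustive search.
  \<open>4 ^ K \<le> N\<close> bounds \<open>3 ^ K\<close>, the length of the tables over codes, by
  \<open>N\<close>, so that codes are words.\<close>

locale structured_input = graph_input +
  fixes K :: nat and ty :: "nat \<Rightarrow> nat"
  assumes types: "types_inv ty K" and typed: "v < N \<Longrightarrow> ty v \<noteq> 0" and pow4: "4 ^ K \<le> N"
begin

definition \<tau> :: "nat \<Rightarrow> nat" where "\<tau> v = ty v - 1"

definition adjacent :: "nat \<Rightarrow> nat \<Rightarrow> nat \<Rightarrow> bool" where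
  "adjacent n i j \<longleftrightarrow> (\<exists>e<n. \<tau> (U e) = i \<and> \<tau> (W e) = j \<or> \<tau> (W e) = i \<and> \<tau> (U e) = j)"

lemma adjacent_Suc: "adjacent (Suc n) i j \<longleftrightarrow> adjacent n i j \<or>
    (\<tau> (U n) = i \<and> \<tau> (W n) = j \<or> \<tau> (W n) = i \<and> \<tau> (U n) = j)"
  unfolding adjacent_def less_Suc_eq by blast

lemma adjacent_0 [simp]: "\<not> adjacent 0 i j"
  by (simp add: adjacent_def)

lemma \<tau>_less: "v < N \<Longrightarrow> \<tau> v < K"
  using types typed[of v] unfolding types_inv_def \<tau>_def by fastforce

text \<open>One edge between two types forces all of them: an end point may be exchanged for the
  representative of its type, and the representative for any other vertex of the type, as long as
  the other end point is neither of the two.\<close>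

lemma adjacent_edge:
  assumes uv: "u < N" "v < N" "u \<noteq> v" and adj: "adjacent m (\<tau> u) (\<tau> v)"
  shows "u \<in> nbh E v"
proof -
  obtain rep where rep: "\<And>i v. i \<in> {1..K} \<Longrightarrow> v < N \<Longrightarrow> ty v = i \<Longrightarrow> same_type E v (rep i)"
    "\<And>i. i \<in> {1..K} \<Longrightarrow> ty (rep i) = i"
    using types unfolding types_inv_def by blast
  have st: "same_type E w (rep (ty w))" "ty (rep (ty w)) = ty w" if "w < N" for w
    using rep(1)[of "ty w" w] rep(2)[of "ty w"] that typed[OF that] types
    by (auto simp: types_inv_def Suc_le_eq)
  have swap: "z \<in> nbh E w \<longleftrightarrow> z \<in> nbh E (rep (ty w))" if "w < N" "z \<noteq> w" "z \<noteq> rep (ty w)" for w z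
    using st(1)[OF that(1)] that(2,3) unfolding same_type_def by blast
  have sym: "z \<in> nbh E w \<longleftrightarrow> w \<in> nbh E z" for w z by (rule nbh_props(4))
  obtain x y where xy: "x < N" "y < N" "x \<in> nbh E y" "x \<noteq> y" "ty x = ty u" "ty y = ty v"
  proof -
    obtain e where e: "e < m" "\<tau> (U e) = \<tau> u \<and> \<tau> (W e) = \<tau> v \<or> \<tau> (W e) = \<tau> u \<and> \<tau> (U e) = \<tau> v"
      using adj by (auto simp: adjacent_def)
    note ed = edge_in[OF e(1)]
    have inj: "ty a = ty b" if "\<tau> a = \<tau> b" "a < N" "b < N" for a b
      using that typed[of a] typed[of b] by (simp add: \<tau>_def)
    have "U e \<in> nbh E (W e)" "W e \<in> nbh E (U e)" using e(1) by (auto simp: nbh_edge)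
    then show thesis using e(2) that[of "U e" "W e"] that[of "W e" "U e"] ed inj uv by metis
  qed
  let ?a = "rep (ty u)" and ?b = "rep (ty v)"
  show ?thesis
  proof (cases "ty u = ty v")
    case False
    \<comment> \<open>For different types the exchanges never collide: the edge between
      \<open>x\<close> and \<open>y\<close> becomes one between \<open>?a\<close> and
      \<open>y\<close>, then \<open>?a\<close> and \<open>?b\<close>, then \<open>u\<close> and
      \<open>?b\<close>, and finally \<open>u\<close> and \<open>v\<close>.\<close>
    have ne: "?a \<noteq> ?b" "y \<noteq> ?a" "x \<noteq> ?b" "u \<noteq> ?b" "v \<noteq> ?a"
      using False st(2)[OF uv(1)] st(2)[OF uv(2)] xy by metis+
    have "y \<in> nbh E x" using xy sym by blast
    then have "y \<in> nbh E ?a" using swap[OF xy(1), of y] xy ne by auto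
    then have "?a \<in> nbh E y" using sym by blast
    moreover have "y \<noteq> ?a" using ne by simp
    ultimately have "?a \<in> nbh E ?b" using swap[OF xy(2), of ?a] xy ne by auto
    then have "?b \<in> nbh E ?a" using sym by blast
    then have "?b \<in> nbh E u" using swap[OF uv(1), of ?b] ne by auto
    then have "u \<in> nbh E ?b" using sym by blast
    then show ?thesis using swap[OF uv(2), of u] uv ne by auto
  next
    case True
    \<comment> \<open>Within one type an exchange could collide with the representative. A neighbor
      \<open>z\<close> of \<open>?a\<close> inside the type is found first; by way of
      \<open>z\<close>, every other vertex of the type becomes a neighbor of
      \<open>?a\<close>.\<close>
    have "\<exists>z<N. z \<noteq> ?a \<and> ty z = ty u \<and> z \<in> nbh E ?a"
    proof (cases "x = ?a")
      case True
      then show ?thesis using xy sym \<open>ty u = ty v\<close> by metis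
    next
      case xa: False
      show ?thesis
      proof (cases "y = ?a")
        case True
        then show ?thesis using xy xa \<open>ty u = ty v\<close> by metis
      next
        case False
        then have "y \<in> nbh E ?a" using swap[OF xy(1), of y] xy sym by metis
        then show ?thesis using False xy \<open>ty u = ty v\<close> by metis
      qed
    qed
    then obtain z where z: "z < N" "z \<noteq> ?a" "ty z = ty u" "z \<in> nbh E ?a" by blast
    have all: "w \<in> nbh E ?a" if w: "w < N" "w \<noteq> ?a" "ty w = ty u" for w
    proof (cases "w = z")
      case False
      then have "z \<in> nbh E w" using swap[OF w(1), of z] z w by auto
      then have "w \<in> nbh E z" using sym by blast
      then show ?thesis using swap[OF z(1), of w] z w False by auto
    qed (use z in simp)
    show ?thesis
    proof (cases "v = ?a \<or> u = ?a")
      case True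
      then show ?thesis using all[of u] all[of v] uv sym \<open>ty u = ty v\<close> by metis
    next
      case False
      then show ?thesis using all[of u] swap[OF uv(2), of u] uv \<open>ty u = ty v\<close> by auto
    qed
  qed
qed

sublocale typed_instance N K r E p \<tau> "adjacent m"
proof
  show "precol_instance {0..<N} E r p" by (rule precol)
  show "\<And>v. v < N \<Longrightarrow> \<tau> v < K" by (rule \<tau>_less)
  show "adjacent m i j \<longleftrightarrow> adjacent m j i" for i j by (auto simp: adjacent_def)
  fix u v assume uv: "u < N" "v < N"
  have "{v, u} \<in> E \<longleftrightarrow> u \<noteq> v \<and> adjacent m (\<tau> u) (\<tau> v)"
  proof
    assume "{v, u} \<in> E"
    then have n: "u \<in> nbh E v" by (simp add: nbh_def)
    then show "u \<noteq> v \<and> adjacent m (\<tau> u) (\<tau> v)"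
      using nbh_props(3) unfolding nbh_edge adjacent_def by blast
  next
    assume "u \<noteq> v \<and> adjacent m (\<tau> u) (\<tau> v)"
    then show "{v, u} \<in> E" using adjacent_edge[OF uv] by (simp add: nbh_def)
  qed
  then show "{u, v} \<in> E \<longleftrightarrow> u \<noteq> v \<and> adjacent m (\<tau> u) (\<tau> v)" by (simp add: insert_commute)
qed

lemma K_less: "K < N"
proof -
  have "K < 4 ^ K" by (induction K) auto
  then show ?thesis using pow4 by simp
qed

lemma pow3_le: "3 ^ K \<le> N"
proof -
  have "(3 :: nat) ^ K \<le> 4 ^ K" by (rule power_mono) auto
  then show ?thesis using pow4 by simp
qed

text \<open>With D the input length, \<open>a * b + c\<close> is at most 10 D^2, within the bound of
  12 D^2. This serves matrix indices as well as sums, over the codes, of entries up to 4 D.\<close>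

lemma product_small:
  assumes "a \<le> 3 + N + 2 * m" "b \<le> 5 * (3 + N + 2 * m)" "c \<le> 5 * (3 + N + 2 * m)"
  shows "a * b + c < B"
proof -
  let ?D = "3 + N + 2 * m"
  have "a * b \<le> ?D * (5 * ?D)" using assms by (intro mult_mono) auto
  moreover have "c \<le> ?D * (5 * ?D)"
    using assms(3) by (rule le_trans) simp
  ultimately have "a * b + c \<le> ?D * (5 * ?D) + ?D * (5 * ?D)" by (rule add_mono)
  also have "D * (5 * D) + D * (5 * D) \<le> 12 * (D * D)" for D :: nat by simp
  finally show ?thesis using B by simp
qed

definition typed_state :: "state \<Rightarrow> bool" where
  "typed_state s \<longleftrightarrow> inp s \<and> reg s 4 = K \<and> arr s 1 = ty"

lemma typed_state_frame:
  "frame X Y s s' \<Longrightarrow> typed_state s \<Longrightarrow> 1 \<notin> X \<Longrightarrow> 2 \<notin> X \<Longrightarrow> 3 \<notin> X \<Longrightarrow> 4 \<notin> X \<Longrightarrow>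
   0 \<notin> Y \<Longrightarrow> 1 \<notin> Y \<Longrightarrow> typed_state s'"
  using inp_frame[of X Y s s'] by (simp add: typed_state_def frame_def)

lemma typed_state_simps:
  "typed_state s \<Longrightarrow> arr s 0 = A0" "typed_state s \<Longrightarrow> reg s 1 = N" "typed_state s \<Longrightarrow> reg s (Suc 0) = N"
  "typed_state s \<Longrightarrow> reg s 2 = r" "typed_state s \<Longrightarrow> reg s 3 = m" "typed_state s \<Longrightarrow> reg s 4 = K"
  "typed_state s \<Longrightarrow> arr s 1 = ty" "typed_state s \<Longrightarrow> arr s (Suc 0) = ty" "typed_state s \<Longrightarrow> inp s"
  by (simp_all add: typed_state_def inp_def)

lemma wp_adjacency:
  assumes "typed_state s" "arr s 6 = (\<lambda>_. 0)"
  shows "wp B adjacency (\<lambda>s' t. (\<forall>i<K. \<forall>j<K. arr s' 6 (i * K + j) \<noteq> 0 \<longleftrightarrow> adjacent m i j) \<and>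
    t \<le> m * 70 + 6) s"
  unfolding adjacency_def
proof (rule wp_FOR[where T = 62 and I = "\<lambda>n s'. \<forall>i<K. \<forall>j<K. arr s' 6 (i * K + j) \<noteq> 0 \<longleftrightarrow> adjacent n i j"],
    goal_cases)
  case (7 n s')
  have n: "n < m" using 7 assms by (simp add: typed_state_simps)
  have ts: "typed_state s'"
    by (rule typed_state_frame[OF 7(5) assms(1)]) (auto simp: load_edge_def)
  note e = edge_in[OF n]
  have t: "\<tau> (U n) < K" "\<tau> (W n) < K" using e \<tau>_less by simp_all
  have sm: "\<tau> (U n) * K + \<tau> (W n) < B" "\<tau> (W n) * K + \<tau> (U n) < B"
    using t K_less by (auto intro!: product_small)
  then have sm': "\<tau> (U n) * K < B" "\<tau> (W n) * K < B" by simp_all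
  have ty: "ty (U n) - Suc 0 = \<tau> (U n)" "ty (W n) - Suc 0 = \<tau> (W n)" by (simp_all add: \<tau>_def)
  show ?case
    unfolding wp.simps(3)
    by (rule wp_mono[OF wp_load_edge[OF typed_state_simps(9)[OF ts] 7(3) n]])
      (use 7(2) ts t sm sm' small[of 1] in \<open>auto simp: typed_state_simps ty adjacent_Suc index_eq\<close>)
next
  case (8 s' t)
  then show ?case using assms by (simp add: typed_state_simps)
qed (use assms small[of m] small[of 1] in \<open>auto simp: typed_state_simps load_edge_def\<close>)

text \<open>Counts restricted to the first \<open>n\<close> vertices serve as loop invariants; at
  \<open>n = N\<close> they become the quantities in \<open>dem\<close>.\<close>

definition free_count :: "nat \<Rightarrow> nat \<Rightarrow> nat" where
  "free_count n i = card {v. v < n \<and> \<tau> v = i \<and> p v = None}"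

definition pre_exists :: "nat \<Rightarrow> nat \<Rightarrow> bool" where
  "pre_exists n i \<longleftrightarrow> (\<exists>v<n. \<tau> v = i \<and> p v \<noteq> None)"

lemma free_count_Suc: "free_count (Suc n) i = free_count n i + (if \<tau> n = i \<and> p n = None then 1 else 0)"
proof -
  have "{v. v < Suc n \<and> \<tau> v = i \<and> p v = None} = {v. v < n \<and> \<tau> v = i \<and> p v = None} \<union>
     (if \<tau> n = i \<and> p n = None then {n} else {})"
    by (auto simp: less_Suc_eq)
  then show ?thesis by (simp add: free_count_def)
qed

lemma free_count_le: "free_count n i \<le> n"
proof -
  have "free_count n i \<le> card {..<n}" unfolding free_count_def by (rule card_mono) auto
  then show ?thesis by simp
qed

lemma pre_exists_Suc: "pre_exists (Suc n) i \<longleftrightarrow> pre_exists n i \<or> \<tau> n = i \<and> p n \<noteq> None"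
  unfolding pre_exists_def less_Suc_eq by blast

lemma wp_tally:
  assumes "typed_state s" "arr s 7 = (\<lambda>_. 0)" "arr s 8 = (\<lambda>_. 0)"
  shows "wp B tally (\<lambda>s' t. (\<forall>i<K. arr s' 7 i = free_count N i \<and> (arr s' 8 i \<noteq> 0 \<longleftrightarrow> pre_exists N i)) \<and>
    t \<le> N * 40 + 6) s"
  unfolding tally_def
proof (rule wp_FOR[where T = 32 and I = "\<lambda>n s'. \<forall>i<K. arr s' 7 i = free_count n i \<and>
    (arr s' 8 i \<noteq> 0 \<longleftrightarrow> pre_exists n i)"], goal_cases)
  case (7 n s')
  have n: "n < N" using 7 assms by (simp add: typed_state_simps)
  have ts: "typed_state s'"
    by (rule typed_state_frame[OF 7(5) assms(1)]) (auto simp: col_exp_def)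
  have t: "\<tau> n < K" using n \<tau>_less by simp
  have ty: "ty n - Suc 0 = \<tau> n" by (simp add: \<tau>_def)
  have sm: "free_count n (\<tau> n) + 1 < B" "3 + n < B" using free_count_le[of n "\<tau> n"] n by (auto intro!: small)
  show ?case
    using 7(2,3) ts t sm small[of 1] small[of 3] col_cases(1)[OF n]
    by (auto simp: typed_state_simps ty free_count_Suc pre_exists_Suc col_exp_def)
next
  case (8 s' t)
  then show ?case using assms by (simp add: typed_state_simps)
qed (use assms small[of N] small[of 1] in \<open>auto simp: typed_state_simps col_exp_def free_count_def pre_exists_def\<close>)

lemma wp_demands:
  assumes "typed_state s"
    and adj: "\<forall>i<K. \<forall>j<K. arr s 6 (i * K + j) \<noteq> 0 \<longleftrightarrow> adjacent m i j"
    and tal: "\<forall>i<K. arr s 7 i = free_count N i \<and> (arr s 8 i \<noteq> 0 \<longleftrightarrow> pre_exists N i)"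
  shows "wp B demands (\<lambda>s' t. (\<forall>i<K. arr s' 9 i = dem i) \<and> t \<le> K * 40 + 6) s"
  unfolding demands_def
proof (rule wp_FOR[where T = 32 and I = "\<lambda>n s'. \<forall>i<n. arr s' 9 i = dem i"], goal_cases)
  case (7 i s')
  have i: "i < K" using 7 assms by (simp add: typed_state_simps)
  have ts: "typed_state s'"
    by (rule typed_state_frame[OF 7(5) assms(1)]) auto
  have fr: "arr s' 6 = arr s 6" "arr s' 7 = arr s 7" "arr s' 8 = arr s 8"
    using 7(5) by (simp_all add: frame_def)
  have sm: "i * K + i < B" using i K_less by (auto intro!: product_small)
  then have sm': "i * K < B" by simp
  have "finite (free i)" by (simp add: free_def)
  then have d: "dem i = (if adjacent m i i then free_count N i else if pre_exists N i \<or> free_count N i = 0 then 0 else 1)"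
    by (auto simp: dem_def free_count_def pre_exists_def free_def)
  have a: "arr s 6 (i * K + i) \<noteq> 0 \<longleftrightarrow> adjacent m i i" using adj i by simp
  have tl: "arr s 7 i = free_count N i" "arr s 8 i \<noteq> 0 \<longleftrightarrow> pre_exists N i" using tal i by simp_all
  show ?case
    using 7(2,3) ts sm sm' small[of 1] small[of 0] a tl
    by (auto simp: typed_state_simps fr d less_Suc_eq)
next
  case (8 s' t)
  then show ?case using assms by (simp add: typed_state_simps)
qed (use assms small[of K] small[of 1] K_less in \<open>auto simp: typed_state_simps\<close>)

lemma wp_powers3:
  assumes "typed_state s"
  shows "wp B powers3 (\<lambda>s' t. (\<forall>i<K. arr s' 10 i = 3 ^ i) \<and> reg s' 12 = 3 ^ K \<and> t \<le> K * 20 + 8) s"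
  unfolding powers3_def
proof (rule wp_Asg_Num)
  show "wp B (FOR 19 4 (Put 10 (Var 19) (Var 12) ;; Asg 12 (Num 3 \<otimes> Var 12)))
     (\<lambda>s' t. (\<forall>i<K. arr s' 10 i = 3 ^ i) \<and> reg s' 12 = 3 ^ K \<and> 2 + t \<le> K * 20 + 8) (set_reg 12 1 s)"
  proof (rule wp_FOR[where T = 12 and I = "\<lambda>n s'. (\<forall>i<n. arr s' 10 i = 3 ^ i) \<and> reg s' 12 = 3 ^ n"], goal_cases)
    case (7 i s')
    have i: "i < K" using 7 assms by (simp add: typed_state_simps)
    have "(3 :: nat) ^ Suc i \<le> 3 ^ K" using i by (intro power_increasing) auto
    then have sm: "3 * 3 ^ i < B" using pow3_le by (auto intro!: small)
    show ?case using 7(2,3) sm small[of 3] by (auto simp: less_Suc_eq)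
  next
    case (8 s' t)
    then show ?case using assms by (simp add: typed_state_simps)
  qed (use assms small[of K] small[of 1] K_less in \<open>auto simp: typed_state_simps\<close>)
qed (use small[of 1] in simp)

definition used_by :: "nat \<Rightarrow> nat \<Rightarrow> nat \<Rightarrow> bool" where
  "used_by n c i \<longleftrightarrow> (\<exists>v<n. \<tau> v = i \<and> p v = Some c)"

definition mc_by :: "nat \<Rightarrow> nat \<Rightarrow> nat" where
  "mc_by n c = (\<Sum>i<K. if used_by n c i then 3 ^ i else 0)"

lemma used_by_Suc: "used_by (Suc n) c i \<longleftrightarrow> used_by n c i \<or> \<tau> n = i \<and> p n = Some c"
  unfolding used_by_def less_Suc_eq by blast

text \<open>A second vertex with the same type and color must not add its power of 3 again, which is
  why \<open>masks\<close> keeps a flag for every digit of every color.\<close>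

lemma mc_by_Suc:
  assumes "n < N"
  shows "mc_by (Suc n) c = mc_by n c + (if p n = Some c \<and> \<not> used_by n c (\<tau> n) then 3 ^ \<tau> n else 0)"
proof (cases "p n = Some c \<and> \<not> used_by n c (\<tau> n)")
  case True
  have t: "\<tau> n \<in> {..<K}" using \<tau>_less[OF assms] by simp
  have "mc_by (Suc n) c = 3 ^ \<tau> n + (\<Sum>i\<in>{..<K} - {\<tau> n}. if used_by (Suc n) c i then 3 ^ i else 0)"
    unfolding mc_by_def using sum.remove[OF _ t, of "\<lambda>i. if used_by (Suc n) c i then (3 :: nat) ^ i else 0"] True
    by (simp add: used_by_Suc)
  also have "(\<Sum>i\<in>{..<K} - {\<tau> n}. if used_by (Suc n) c i then 3 ^ i else 0)
      = (\<Sum>i\<in>{..<K} - {\<tau> n}. if used_by n c i then 3 ^ i else 0)"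
    by (rule sum.cong) (auto simp: used_by_Suc)
  also have "\<dots> = mc_by n c"
    unfolding mc_by_def using sum.remove[OF _ t, of "\<lambda>i. if used_by n c i then (3 :: nat) ^ i else 0"] True by simp
  finally show ?thesis using True by simp
next
  case False
  then have "used_by (Suc n) c i \<longleftrightarrow> used_by n c i" for i by (auto simp: used_by_Suc)
  then show ?thesis using False by (auto simp: mc_by_def)
qed

lemma mc_by_N: "mc_by N c = mc c"
  by (simp add: mc_by_def mc_def used_by_def used_def)

lemma mc_by_less: "mc_by n c < 3 ^ K"
  unfolding mc_by_def by (rule sum_pow3_less)

lemma wp_masks:
  assumes "typed_state s" "arr s 11 = (\<lambda>_. 0)" "arr s 20 = (\<lambda>_. 0)" and p3: "\<forall>i<K. arr s 10 i = 3 ^ i"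
  shows "wp B masks (\<lambda>s' t. (\<forall>c>0. arr s' 20 c = mc c) \<and> t \<le> N * 60 + 6) s"
  unfolding masks_def
proof (rule wp_FOR[where T = 52 and I = "\<lambda>n s'. \<forall>c>0. arr s' 20 c = mc_by n c \<and>
    (\<forall>i<K. arr s' 11 (c * K + i) \<noteq> 0 \<longleftrightarrow> used_by n c i)"], goal_cases)
  case (7 n s')
  have n: "n < N" using 7 assms by (simp add: typed_state_simps)
  have ts: "typed_state s'"
    by (rule typed_state_frame[OF 7(5) assms(1)]) (auto simp: col_exp_def)
  have fr: "arr s' 10 = arr s 10" using 7(5) by (simp add: frame_def col_exp_def)
  have t: "\<tau> n < K" using n \<tau>_less by simp
  have ty: "ty n - Suc 0 = \<tau> n" by (simp add: \<tau>_def)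
  have 3: "3 + n < B" using n by (auto intro!: small)
  show ?case
  proof (cases "p n")
    case None
    then have "A0 (3 + n) = 0" using col_cases(1)[OF n] by simp
    then show ?thesis
      using 7(2,3) ts 3 small[of 1] small[of 3] small[of 0] None
      by (simp add: typed_state_simps col_exp_def mc_by_Suc[OF n] used_by_Suc)
  next
    case (Some c)
    have c: "A0 (3 + n) = c" "c > 0" "c \<le> r"
      using col[OF n] col_cases(1,3)[OF n] Some by auto
    have sm: "c * K + \<tau> n < B" using c(3) t K_less rN by (auto intro!: product_small)
    then have sm': "c * K < B" by simp
    have e3: "arr s 10 (\<tau> n) = 3 ^ \<tau> n" using p3 t by simp
    have "(3 :: nat) ^ \<tau> n \<le> 3 ^ K" using t by (intro power_increasing) auto
    then have "mc_by n c + 3 ^ \<tau> n \<le> 2 * N" using mc_by_less[of n c] pow3_le by linarith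
    then have sm3: "mc_by n c + 3 ^ \<tau> n < B" by (intro small) simp
    have u: "arr s' 11 (c * K + \<tau> n) \<noteq> 0 \<longleftrightarrow> used_by n c (\<tau> n)" "arr s' 20 c = mc_by n c"
      using 7(2) c(2) t by simp_all
    show ?thesis
    proof (cases "used_by n c (\<tau> n)")
      case True
      have ub: "used_by (Suc n) c' i \<longleftrightarrow> used_by n c' i" for c' i using True Some by (auto simp: used_by_Suc)
      show ?thesis
        using 7(2,3) ts 3 small[of 1] small[of 3] small[of 0] Some True c u sm sm'
        by (simp add: typed_state_simps col_exp_def mc_by_Suc[OF n] ub ty)
    next
      case False
      show ?thesis
        using 7(2,3) ts 3 small[of 1] small[of 3] small[of 0] Some False c u sm sm' sm3 e3 t
        by (auto simp: typed_state_simps col_exp_def mc_by_Suc[OF n] used_by_Suc ty fr index_eq)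
    qed
  qed
next
  case (8 s' t)
  then show ?case using assms by (simp add: typed_state_simps mc_by_N)
qed (use assms small[of N] small[of 1] in \<open>auto simp: typed_state_simps col_exp_def mc_by_def used_by_def\<close>)

lemma wp_mask_counts:
  assumes "typed_state s" "arr s 12 = (\<lambda>_. 0)" "arr s 13 = (\<lambda>_. 0)" and mc: "\<forall>c>0. arr s 20 c = mc c"
  shows "wp B mask_counts (\<lambda>s' t. (\<forall>j. arr s' 12 j = count mc j \<and> arr s' 13 j = count mc j) \<and> t \<le> N * 40 + 6) s"
  unfolding mask_counts_def
proof (rule wp_FOR[where T = 32 and I = "\<lambda>n s'. \<forall>j. arr s' 12 j = card {c \<in> {1..n}. mc c = j} \<and>
    arr s' 13 j = card {c \<in> {1..n}. mc c = j}"], goal_cases)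
  case (7 n s')
  have n: "n < r" using 7 assms by (simp add: typed_state_simps)
  have fr: "arr s' 20 = arr s 20" using 7(5) by (simp add: frame_def)
  have Suc: "card {c \<in> {1..Suc n}. mc c = j} = card {c \<in> {1..n}. mc c = j} + (if mc (Suc n) = j then 1 else 0)" for j
  proof -
    have "{c \<in> {1..Suc n}. mc c = j} = {c \<in> {1..n}. mc c = j} \<union> (if mc (Suc n) = j then {Suc n} else {})"
      by (auto simp: le_Suc_eq)
    then show ?thesis by simp
  qed
  have "card {c \<in> {1..n}. mc c = j} \<le> card {1..n}" for j by (rule card_mono) auto
  then have le: "card {c \<in> {1..n}. mc c = j} \<le> n" for j by simp
  have sm: "card {c \<in> {1..n}. mc c = mc (Suc n)} + 1 < B" "n + 1 < B"
    using le[of "mc (Suc n)"] n rN by (auto intro!: small)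
  have m: "arr s 20 (Suc n) = mc (Suc n)" using mc by simp
  show ?case
    unfolding Suc using 7(2,3) fr m sm small[of 1] by auto
next
  case (8 s' t)
  have "r * 40 \<le> N * 40" using rN by simp
  then show ?case using 8 assms by (simp add: typed_state_simps count_def)
qed (use assms small[of r] small[of 1] rN in \<open>auto simp: typed_state_simps\<close>)

lemma ev_trit_exp: "arr s 10 (reg s i) = 3 ^ reg s i \<Longrightarrow> ev (trit_exp i) s = trit (reg s 18) (reg s i)"
  by (simp add: trit_exp_def trit_def minus_mult_div_eq_mod)

lemma safe_trit_exp: "reg s 18 < 3 ^ K \<Longrightarrow> safe B (trit_exp i) s"
proof -
  assume a: "reg s 18 < 3 ^ K"
  have le: "3 * (reg s 18 div x div 3) \<le> reg s 18" for x
  proof -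
    have "3 * (reg s 18 div x div 3) \<le> reg s 18 div x" by simp
    then show ?thesis using div_le_dividend[of "reg s 18" x] le_trans by blast
  qed
  have "3 * (reg s 18 div x div 3) \<le> 12 * (3 + N + 2 * m)" for x
    by (rule le_trans[OF le]) (use less_le_trans[OF a pow3_le] in simp)
  then show ?thesis using small small[of 3] by (simp add: trit_exp_def)
qed

lemma ecost_trit_exp [simp]: "ecost (trit_exp i) = 13"
  by (simp add: trit_exp_def)

end

section \<open>Tables of forced parts and bad codes\<close>

definition conflict_scan :: scom where
  "conflict_scan = FOR 23 4 (IF (Var 19 \<doteq> Var 23) (Asg 9 (Num 0))
     (IF (trit_exp 23) (IF (Get 6 (Var 19 \<otimes> Var 4 \<oplus> Var 23)) (Put 15 (Var 18) (Num 1)) (Asg 9 (Num 0)))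
       (Asg 9 (Num 0))))"

definition code_info :: scom where
  "code_info = FOR 19 4 (Asg 10 (trit_exp 19) ;;
     IF (Var 10 \<doteq> Num 1) (Put 14 (Var 18) (Get 14 (Var 18) \<oplus> Get 10 (Var 19))) (Asg 9 (Num 0)) ;;
     IF (Var 10 \<doteq> Num 2) conflict_scan (Asg 9 (Num 0)))"

definition tables :: scom where
  "tables = FOR 18 12 code_info"

context structured_input
begin

definition conflict :: "nat \<Rightarrow> nat \<Rightarrow> nat \<Rightarrow> bool" where
  "conflict n i j \<longleftrightarrow> (\<exists>i'<n. i \<noteq> i' \<and> trit j i' \<noteq> 0 \<and> adjacent m i i')"

lemma conflict_Suc: "conflict (Suc n) i j \<longleftrightarrow> conflict n i j \<or> i \<noteq> n \<and> trit j n \<noteq> 0 \<and> adjacent m i n"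
  unfolding conflict_def less_Suc_eq by blast

definition bad_by :: "nat \<Rightarrow> nat \<Rightarrow> bool" where
  "bad_by n j \<longleftrightarrow> (\<exists>i<n. trit j i = 2 \<and> conflict K i j)"

lemma bad_by_Suc: "bad_by (Suc n) j \<longleftrightarrow> bad_by n j \<or> trit j n = 2 \<and> conflict K n j"
  unfolding bad_by_def less_Suc_eq by blast

lemma bad_by_K: "bad_by K j \<longleftrightarrow> bad j"
  unfolding bad_by_def bad_def conflict_def by blast

lemma pre_part_Suc: "pre_part (Suc n) j = pre_part n j + (if trit j n = 1 then 3 ^ n else 0)"
  by (simp add: pre_part_def)

definition adj_state :: "state \<Rightarrow> bool" where
  "adj_state s \<longleftrightarrow> typed_state s \<and> (\<forall>i<K. arr s 10 i = 3 ^ i) \<and> reg s 12 = 3 ^ K \<and>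
     (\<forall>i<K. \<forall>j<K. arr s 6 (i * K + j) \<noteq> 0 \<longleftrightarrow> adjacent m i j)"

lemma adj_state_frame:
  "frame X Y s s' \<Longrightarrow> adj_state s \<Longrightarrow> 1 \<notin> X \<Longrightarrow> 2 \<notin> X \<Longrightarrow> 3 \<notin> X \<Longrightarrow> 4 \<notin> X \<Longrightarrow> 12 \<notin> X \<Longrightarrow>
   0 \<notin> Y \<Longrightarrow> 1 \<notin> Y \<Longrightarrow> 6 \<notin> Y \<Longrightarrow> 10 \<notin> Y \<Longrightarrow> adj_state s'"
  using typed_state_frame[of X Y s s'] by (simp add: adj_state_def frame_def)

lemma mods_conflict_scan [simp]: "mv conflict_scan = {9, 23}" "ma conflict_scan = {15}"
  by (auto simp: conflict_scan_def)

lemma wp_conflict_scan: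
  assumes "adj_state s" "reg s 18 = j" "reg s 19 = i" "j < 3 ^ K" "i < K"
  shows "wp B conflict_scan (\<lambda>s' t. arr s' 15 = (arr s 15)(j := if conflict K i j then 1 else arr s 15 j) \<and>
    t \<le> K * 60 + 6) s"
  unfolding conflict_scan_def
proof (rule wp_FOR[where T = 52 and I = "\<lambda>n s'. arr s' 15 = (arr s 15)(j := if conflict n i j then 1 else arr s 15 j)"],
    goal_cases)
  case (7 n s')
  have as: "adj_state s'" by (rule adj_state_frame[OF 7(5) assms(1)]) auto
  have ts: "typed_state s'" using as by (simp add: adj_state_def)
  have n: "n < K" using 7 ts by (simp add: typed_state_simps)
  have rr: "reg s' 18 = j" "reg s' 19 = i" using 7(5) assms by (simp_all add: frame_def)
  have tr: "ev (trit_exp 23) s' = trit j n" "safe B (trit_exp 23) s'"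
    using ev_trit_exp[of s' 23] safe_trit_exp[of s' 23] as n 7(3) rr assms(4) by (simp_all add: adj_state_def)
  have sm: "i * K + n < B" using n assms(5) K_less by (auto intro!: product_small)
  then have sm': "i * K < B" by simp
  have a6: "arr s' 6 (i * K + n) \<noteq> 0 \<longleftrightarrow> adjacent m i n" using as n assms(5) by (simp add: adj_state_def)
  show ?case
    using 7(2,3) tr sm sm' a6 rr small[of 0] small[of 1]
    by (auto simp: conflict_Suc typed_state_simps[OF ts])
next
  case (8 s' t)
  then show ?case using assms by (simp add: typed_state_simps adj_state_def)
qed (use assms small[of K] small[of 1] K_less in \<open>auto simp: typed_state_simps conflict_def adj_state_def\<close>)

lemma mods_code_info [simp]: "mv code_info = {9, 10, 19, 23}" "ma code_info = {14, 15}"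
  by (auto simp: code_info_def)

lemma wp_code_info:
  assumes "adj_state s" "reg s 18 = j" "j < 3 ^ K" "arr s 14 j = 0"
  shows "wp B code_info (\<lambda>s' t. arr s' 14 = (arr s 14)(j := pre_part K j) \<and>
    arr s' 15 = (arr s 15)(j := if bad j then 1 else arr s 15 j) \<and> t \<le> K * (70 + K * 60) + 6) s"
  unfolding code_info_def
proof (rule wp_FOR[where T = "K * 60 + 62" and I = "\<lambda>n s'. arr s' 14 = (arr s 14)(j := pre_part n j) \<and>
    arr s' 15 = (arr s 15)(j := if bad_by n j then 1 else arr s 15 j)"], goal_cases)
  case (7 n s')
  have as: "adj_state s'" by (rule adj_state_frame[OF 7(5) assms(1)]) auto
  have ts: "typed_state s'" using as by (simp add: adj_state_def)
  have n: "n < K" using 7 ts by (simp add: typed_state_simps)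
  have rr: "reg s' 18 = j" using 7(5) assms by (simp_all add: frame_def)
  have tr: "ev (trit_exp 19) s' = trit j n" "safe B (trit_exp 19) s'"
    using ev_trit_exp[of s' 19] safe_trit_exp[of s' 19] as n 7(3) rr assms(3) by (simp_all add: adj_state_def)
  have p3: "arr s' 10 n = 3 ^ n" using as n by (simp add: adj_state_def)
  have "pre_part (Suc n) j < 3 ^ Suc n" unfolding pre_part_def by (rule sum_pow3_less)
  moreover have "(3 :: nat) ^ Suc n \<le> 3 ^ K" using n by (intro power_increasing) auto
  ultimately have "pre_part (Suc n) j \<le> N" using pow3_le by linarith
  then have pl: "pre_part (Suc n) j < B" by (intro small) simp
  let ?s1 = "set_reg 10 (trit j n) s'"
  let ?s2 = "if trit j n = 1 then set_arr 14 j (pre_part (Suc n) j) ?s1 else set_reg 9 0 ?s1"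
  have c2: "wp B (IF (Var 10 \<doteq> Num 2) conflict_scan (Asg 9 (Num 0)))
     (\<lambda>s'' t. arr s'' 14 = (arr s 14)(j := pre_part (Suc n) j) \<and>
       arr s'' 15 = (arr s 15)(j := if bad_by (Suc n) j then 1 else arr s 15 j) \<and> t \<le> K * 60 + 26) ?s2"
  proof (cases "trit j n = 2")
    case True
    have "adj_state ?s2" using as by (simp add: adj_state_def typed_state_def inp_def)
    moreover have "reg ?s2 18 = j" "reg ?s2 19 = n" using rr 7(3) by simp_all
    ultimately have "wp B conflict_scan (\<lambda>s'' t. arr s'' 15 = (arr ?s2 15)(j := if conflict K n j then 1 else arr ?s2 15 j) \<and>
      t \<le> K * 60 + 6) ?s2"
      by (rule wp_conflict_scan[OF _ _ _ assms(3) n])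
    note scan = this
    show ?thesis
    proof (rule wp_IF_true)
      show "safe B (Var 10 \<doteq> Num 2) ?s2" using small[of 1] small[of 2] by simp
      show "ev (Var 10 \<doteq> Num 2) ?s2 \<noteq> 0" using True by simp
    qed (rule wp_mono[OF scan], use 7(2) True in \<open>auto simp: frame_def bad_by_Suc pre_part_Suc\<close>)
  next
    case False
    then show ?thesis using 7(2) small[of 1] small[of 2] small[of 0]
      by (auto simp: bad_by_Suc pre_part_Suc)
  qed
  have pl1: "trit j n = 1 \<Longrightarrow> arr s' 14 j + arr s' 10 n < B \<and> arr s' 14 j + arr s' 10 n = pre_part (Suc n) j"
    using 7(2) p3 pl by (simp add: pre_part_Suc)
  show ?case
  proof (rule wp_seqI[where R = "\<lambda>s1 t1. s1 = ?s1 \<and> t1 = 14"], goal_cases)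
    case 1
    show ?case using tr by simp
  next
    case (2 s1 t1)
    show ?case
    proof (rule wp_seqI[where R = "\<lambda>s2 t2. s2 = ?s2 \<and> t2 \<le> 20"], goal_cases)
      case 1
      show ?case using 2 rr 7(3) pl1 small[of 0] small[of 1] by (cases "trit j n = 1") simp_all
    next
      case (2 s2 t2)
      then have s2: "s2 = ?s2" "t2 \<le> 20" by simp_all
      show ?case unfolding s2(1) by (rule wp_mono[OF c2]) (use s2(2) \<open>s1 = ?s1 \<and> t1 = 14\<close> in auto)
    qed
  qed
next
  case (8 s' t)
  then show ?case using assms by (simp add: typed_state_simps adj_state_def bad_by_K)
qed (use assms small[of K] small[of 1] K_less in \<open>auto simp: typed_state_simps pre_part_def bad_by_def adj_state_def\<close>)

lemma wp_tables:
  assumes "adj_state s" "arr s 14 = (\<lambda>_. 0)" "arr s 15 = (\<lambda>_. 0)"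
  shows "wp B tables (\<lambda>s' t. (\<forall>j<3 ^ K. arr s' 14 j = pre_part K j \<and> (arr s' 15 j \<noteq> 0 \<longleftrightarrow> bad j)) \<and>
    t \<le> 3 ^ K * (K * (70 + K * 60) + 14) + 6) s"
  unfolding tables_def
proof (rule wp_FOR[where T = "K * (70 + K * 60) + 6" and I = "\<lambda>n s'. \<forall>j.
    arr s' 14 j = (if j < n then pre_part K j else 0) \<and> (arr s' 15 j \<noteq> 0 \<longleftrightarrow> j < n \<and> bad j)"], goal_cases)
  case (7 n s')
  have as: "adj_state s'" by (rule adj_state_frame[OF 7(5) assms(1)]) auto
  have n: "n < 3 ^ K" using 7 assms by (simp add: adj_state_def)
  show ?case
    by (rule wp_mono[OF wp_code_info[OF as 7(3) n]])
      (use 7(2) in \<open>auto simp: less_Suc_eq\<close>)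
next
  case (8 s' t)
  have "3 ^ K * (K * (70 + K * 60) + 6 + 8) + 6 = 3 ^ K * (K * (70 + K * 60) + 14) + 6" by simp
  then show ?case using 8 assms unfolding adj_state_def by metis
qed (use assms small[of "3 ^ K"] small[of 1] pow3_le in \<open>auto simp: adj_state_def\<close>)

text \<open>Uncolored vertices are counted once, in their own type. As an improving round gains at
  least one unit, this limits the number of such rounds to \<open>N\<close>; it also keeps sums of
  demands below the word limit.\<close>

lemma sum_dem_le: "(\<Sum>i<K. dem i) \<le> N"
proof -
  have "dem i \<le> card (free i)" for i
    by (auto simp: dem_def free_def Suc_le_eq card_gt_0_iff)
  then have "(\<Sum>i<K. dem i) \<le> (\<Sum>i<K. card (free i))" by (rule sum_mono)
  also have "\<dots> = card (\<Union>i<K. free i)"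
    by (rule card_UN_disjoint[symmetric]) (auto simp: free_def)
  also have "\<dots> \<le> card {0..<N}" by (rule card_mono) (auto simp: free_def)
  finally show ?thesis by simp
qed

text \<open>\<open>x j\<close> is one summand in the equation of its class, whose right side counts
  colors. Hence the entries of a feasible \<open>x\<close> are words.\<close>

lemma feas_le:
  assumes "feas x" "j < 3 ^ K"
  shows "x j \<le> r"
proof -
  have A: "pre_part K j < 3 ^ K" unfolding pre_part_def by (rule sum_pow3_less)
  have "x j = (if pre_part K j = pre_part K j then x j else 0)" by simp
  also have "\<dots> \<le> (\<Sum>j'<3 ^ K. if pre_part K j' = pre_part K j then x j' else 0)"
    by (rule member_le_sum) (use assms(2) in auto)
  also have "\<dots> = count mc (pre_part K j)" using assms(1) A by (simp add: feas_def)
  also have "\<dots> \<le> card {1..r}" unfolding count_def by (rule card_mono) auto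
  finally show ?thesis by simp
qed

lemma feas_cong:
  assumes "\<And>j. j < 3 ^ K \<Longrightarrow> x j = y j"
  shows "feas x \<longleftrightarrow> feas y"
proof -
  have "(\<Sum>j<3 ^ K. if pre_part K j = A then x j else 0) = (\<Sum>j<3 ^ K. if pre_part K j = A then y j else 0)" for A
    by (rule sum.cong) (use assms in auto)
  then show ?thesis unfolding feas_def using assms served_cong[OF assms] by simp
qed

end

section \<open>Local search\<close>

text \<open>
  A candidate is the current \<open>x\<close> plus the digits in array \<open>16\<close> minus the radius \<open>G\<close> in variable
  \<open>13\<close>, stored in array \<open>17\<close>; truncation at \<open>0\<close> is harmless since the candidate is checked afterwards.
  Arrays \<open>18\<close> and \<open>19\<close> hold its class sizes and what it supplies to each type. Variable \<open>15\<close> is the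
  total supply of \<open>x\<close>.
\<close>

definition make_candidate :: scom where
  "make_candidate = FOR 18 12 (Put 17 (Var 18) (Get 13 (Var 18) \<oplus> Get 16 (Var 18) \<ominus> Var 13) ;;
     Put 18 (Var 18) (Num 0))"

definition clear_served :: scom where
  "clear_served = FOR 19 4 (Put 19 (Var 19) (Num 0))"

context structured_input
begin

text \<open>Everything the search reads but never writes, so that one frame lemma carries it along.
  \<open>G \<le> Suc N\<close> makes the base \<open>Suc (2 * G)\<close> of the digits a
  word.\<close>

definition search_state :: "nat \<Rightarrow> state \<Rightarrow> bool" where
  "search_state G s \<longleftrightarrow> typed_state s \<and> (\<forall>i<K. arr s 10 i = 3 ^ i) \<and> reg s 12 = 3 ^ K \<and>
     (\<forall>i<K. arr s 9 i = dem i) \<and> (\<forall>j. arr s 12 j = count mc j) \<and>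
     (\<forall>j<3 ^ K. arr s 14 j = pre_part K j \<and> (arr s 15 j \<noteq> 0 \<longleftrightarrow> bad j)) \<and>
     reg s 13 = G \<and> reg s 14 = Suc (2 * G) \<and> G \<le> Suc N"

lemma search_state_frame:
  "frame X Y s s' \<Longrightarrow> search_state G s \<Longrightarrow> X \<inter> {1, 2, 3, 4, 12, 13, 14} = {} \<Longrightarrow>
   Y \<inter> {0, 1, 9, 10, 12, 14, 15} = {} \<Longrightarrow> search_state G s'"
  using typed_state_frame[of X Y s s'] by (simp add: search_state_def frame_def)

lemma search_state_simps:
  assumes "search_state G s"
  shows "typed_state s" "reg s 12 = 3 ^ K" "reg s 13 = G" "reg s 14 = Suc (2 * G)" "G \<le> Suc N"
    "reg s 4 = K" "reg s 1 = N" "i < K \<Longrightarrow> arr s 10 i = 3 ^ i" "i < K \<Longrightarrow> arr s 9 i = dem i"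
    "arr s 12 j = count mc j" "j < 3 ^ K \<Longrightarrow> arr s 14 j = pre_part K j"
    "j < 3 ^ K \<Longrightarrow> arr s 15 j \<noteq> 0 \<longleftrightarrow> bad j" "inp s"
  using assms by (simp_all add: search_state_def typed_state_simps)

definition candidate :: "nat \<Rightarrow> (nat \<Rightarrow> nat) \<Rightarrow> (nat \<Rightarrow> nat) \<Rightarrow> nat \<Rightarrow> nat" where
  "candidate G x a j = x j + a j - G"

lemma K3_small: "3 ^ K < B"
  using pow3_le by (intro small) simp

lemma wp_make_candidate:
  assumes s: "search_state G s" and x: "\<forall>j<3 ^ K. arr s 13 j \<le> r" and a: "\<forall>j<3 ^ K. arr s 16 j \<le> 2 * G"
  shows "wp B make_candidate (\<lambda>s' t. (\<forall>j<3 ^ K. arr s' 17 j = candidate G (arr s 13) (arr s 16) j \<and> arr s' 18 j = 0) \<and>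
    t \<le> 3 ^ K * 24 + 6) s"
  unfolding make_candidate_def
proof (rule wp_FOR[where T = 16 and I = "\<lambda>n s'. \<forall>j<n. arr s' 17 j = candidate G (arr s 13) (arr s 16) j \<and> arr s' 18 j = 0"],
    goal_cases)
  case (7 n s')
  have n: "n < 3 ^ K" using 7(1) search_state_simps(2)[OF s] by simp
  have fr: "arr s' 13 = arr s 13" "arr s' 16 = arr s 16" "reg s' 13 = G"
    using 7(5) search_state_simps(3)[OF s] by (simp_all add: frame_def)
  have "arr s 13 n \<le> r" "arr s 16 n \<le> 2 * G" using x a n by simp_all
  then have sm: "arr s 13 n + arr s 16 n < B"
    using rN search_state_simps(5)[OF s] by (intro small) simp
  show ?case using 7(2,3) fr sm small[of 0] by (auto simp: less_Suc_eq candidate_def)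
next
  case (8 s' t)
  then show ?case using search_state_simps(2)[OF s] by simp
qed (use K3_small search_state_simps(2)[OF s] small[of 1] in auto)

lemma wp_clear_served:
  assumes "search_state G s"
  shows "wp B clear_served (\<lambda>s' t. (\<forall>i<K. arr s' 19 i = 0) \<and> t \<le> K * 12 + 6) s"
  unfolding clear_served_def
proof (rule wp_FOR[where T = 4 and I = "\<lambda>n s'. \<forall>i<n. arr s' 19 i = 0"], goal_cases)
  case (7 n s')
  then show ?case using small[of 0] by (auto simp: less_Suc_eq)
next
  case (8 s' t)
  then show ?case using search_state_simps(6)[OF assms] by simp
qed (use search_state_simps(6)[OF assms] small[of K] small[of 1] K_less in auto)

end

definition add_served :: scom where
  "add_served = FOR 19 4 (IF (trit_exp 19 \<doteq> Num 2)
     (Put 19 (Var 19) (Get 19 (Var 19) \<oplus> Get 17 (Var 18))) (Asg 9 (Num 0)))"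

definition accumulate :: scom where
  "accumulate = FOR 18 12 (IF (Get 15 (Var 18)) (IF (Get 17 (Var 18)) (Asg 11 (Num 0)) (Asg 9 (Num 0))) (Asg 9 (Num 0)) ;;
     Asg 10 (Get 14 (Var 18)) ;; Put 18 (Var 10) (Get 18 (Var 10) \<oplus> Get 17 (Var 18)) ;; add_served)"

definition check_classes :: scom where
  "check_classes = FOR 18 12 (IF (Get 18 (Var 18) \<doteq> Get 12 (Var 18)) (Asg 9 (Num 0)) (Asg 11 (Num 0)))"

definition check_demands :: scom where
  "check_demands = FOR 19 4 (IF (Get 9 (Var 19) \<prec> Get 19 (Var 19)) (Asg 11 (Num 0)) (Asg 9 (Num 0)))"

text \<open>A strictly larger supply is required. The new \<open>x\<close> takes effect at once, so
  the remaining candidates of the round are formed around it.\<close>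

definition adopt :: scom where
  "adopt = Asg 17 (Num 0) ;; FOR 19 4 (Asg 17 (Var 17 \<oplus> Get 19 (Var 19))) ;;
     IF (Var 15 \<prec> Var 17) (FOR 18 12 (Put 13 (Var 18) (Get 17 (Var 18))) ;; Asg 15 (Var 17)) (Asg 9 (Num 0))"

definition try_candidate :: scom where
  "try_candidate = Asg 11 (Num 1) ;; make_candidate ;; clear_served ;; accumulate ;;
     check_classes ;; check_demands ;; IF (Var 11) adopt (Asg 9 (Num 0))"

lemma mods_search [simp]:
  "mv make_candidate = {18}" "ma make_candidate = {17, 18}"
  "mv clear_served = {19}" "ma clear_served = {19}"
  "mv add_served = {9, 19}" "ma add_served = {19}"
  "mv accumulate = {9, 10, 11, 18, 19}" "ma accumulate = {18, 19}"
  "mv check_classes = {9, 11, 18}" "ma check_classes = {}"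
  "mv check_demands = {9, 11, 19}" "ma check_demands = {}"
  "mv adopt = {9, 15, 17, 18, 19}" "ma adopt = {13}"
  "mv try_candidate = {9, 10, 11, 15, 17, 18, 19}" "ma try_candidate = {13, 17, 18, 19}"
  by (auto simp: make_candidate_def clear_served_def add_served_def accumulate_def check_classes_def
      check_demands_def adopt_def try_candidate_def)

context structured_input
begin

lemma wp_add_served:
  assumes s: "search_state G s" and j: "reg s 18 = j" "j < 3 ^ K"
    and bnd: "\<forall>i<K. arr s 19 i + arr s 17 j < B"
  shows "wp B add_served (\<lambda>s' t. (\<forall>i<K. arr s' 19 i = arr s 19 i + arr s 17 j * uses j i) \<and>
    t \<le> K * 60 + 6) s"
  unfolding add_served_def
proof (rule wp_FOR[where T = 52 and I = "\<lambda>n s'. \<forall>i<K. arr s' 19 i = (if i < n then arr s 19 i + arr s 17 j * uses j i else arr s 19 i)"],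
    goal_cases)
  case (7 n s')
  have ss: "search_state G s'" by (rule search_state_frame[OF 7(5) s]) auto
  have n: "n < K" using 7(1) search_state_simps(6)[OF s] by simp
  have fr: "arr s' 17 = arr s 17" "reg s' 18 = j" using 7(5) j by (simp_all add: frame_def)
  have tr: "ev (trit_exp 19) s' = trit j n" "safe B (trit_exp 19) s'"
    using ev_trit_exp[of s' 19] safe_trit_exp[of s' 19] search_state_simps(8)[OF ss n] 7(3) fr j by simp_all
  have b: "arr s 19 n + arr s 17 j < B" using bnd n by simp
  show ?case using 7(2,3) tr fr b n small[of 0] small[of 1] small[of 2]
    by (auto simp: less_Suc_eq uses_def)
next
  case (8 s' t)
  then show ?case using search_state_simps(6)[OF s] by simp
qed (use search_state_simps(6)[OF s] small[of K] small[of 1] K_less in auto)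

lemma wp_accumulate:
  assumes s: "search_state G s" and y: "\<forall>j<3 ^ K. arr s 17 j \<le> 4 * (3 + N + 2 * m)"
    and z: "\<forall>j<3 ^ K. arr s 18 j = 0" "\<forall>i<K. arr s 19 i = 0" "reg s 11 = 1"
  shows "wp B accumulate (\<lambda>s' t. reg s' 11 = (if \<forall>j<3 ^ K. bad j \<longrightarrow> arr s 17 j = 0 then 1 else 0) \<and>
     (\<forall>A<3 ^ K. arr s' 18 A = (\<Sum>j<3 ^ K. if pre_part K j = A then arr s 17 j else 0)) \<and>
     (\<forall>i<K. arr s' 19 i = served (arr s 17) i) \<and> t \<le> 3 ^ K * (70 + K * 60) + 6) s"
  unfolding accumulate_def
proof (rule wp_FOR[where T = "62 + K * 60" and I = "\<lambda>n s'. reg s' 11 = (if \<forall>j<n. bad j \<longrightarrow> arr s 17 j = 0 then 1 else 0) \<and>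
     (\<forall>A<3 ^ K. arr s' 18 A = (\<Sum>j<n. if pre_part K j = A then arr s 17 j else 0)) \<and>
     (\<forall>i<K. arr s' 19 i = (\<Sum>j<n. arr s 17 j * uses j i))"], goal_cases)
  case (7 n s')
  let ?D = "3 + N + 2 * m"
  have ss: "search_state G s'" by (rule search_state_frame[OF 7(5) s]) auto
  have n: "n < 3 ^ K" using 7(1) search_state_simps(2)[OF s] by simp
  have nN: "n \<le> N" using n pow3_le by simp
  have fr: "arr s' 17 = arr s 17" using 7(5) by (simp add: frame_def)
  have A: "pre_part K n < 3 ^ K" unfolding pre_part_def by (rule sum_pow3_less)
  have yn: "arr s 17 n \<le> 4 * ?D" using y n by simp
  have "(\<Sum>j<n. if pre_part K j = A then arr s 17 j else 0) \<le> (\<Sum>j<n. 4 * ?D)" for A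
    by (rule sum_mono) (use y n in auto)
  then have s1: "(\<Sum>j<n. if pre_part K j = A then arr s 17 j else 0) \<le> n * (4 * ?D)" for A by simp
  have "(\<Sum>j<n. arr s 17 j * uses j i) \<le> (\<Sum>j<n. 4 * ?D)" for i
    by (rule sum_mono) (use y n in \<open>auto simp: uses_def\<close>)
  then have s2: "(\<Sum>j<n. arr s 17 j * uses j i) \<le> n * (4 * ?D)" for i by simp
  have tot: "n * (4 * ?D) + arr s 17 n < B" by (rule product_small) (use nN yn in auto)
  have b1: "arr s' 18 (pre_part K n) + arr s 17 n < B"
    using 7(2) A s1[of "pre_part K n"] tot by simp
  have b2: "arr s' 19 i + arr s 17 n < B" if "i < K" for i
    using 7(2) that s2[of i] tot by simp
  let ?ok = "if \<forall>j<Suc n. bad j \<longrightarrow> arr s 17 j = 0 then 1 else 0 :: nat"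
  have bd: "arr s' 15 n \<noteq> 0 \<longleftrightarrow> bad n" by (rule search_state_simps(12)[OF ss n])
  have okS: "(\<forall>j<Suc n. bad j \<longrightarrow> arr s 17 j = 0) \<longleftrightarrow> (\<forall>j<n. bad j \<longrightarrow> arr s 17 j = 0) \<and> (bad n \<longrightarrow> arr s 17 n = 0)"
    by (auto simp: less_Suc_eq)
  have r11: "reg s' 11 = (if \<forall>j<n. bad j \<longrightarrow> arr s 17 j = 0 then 1 else 0)" using 7(2) by simp
  show ?case
  proof (rule wp_seqI[where R = "\<lambda>s1 t1. frame {9, 11} {} s' s1 \<and> reg s1 11 = ?ok \<and> t1 \<le> 12"], goal_cases)
    case 1
    show ?case
      using bd r11 7(3) fr small[of 0] unfolding okS by (auto simp: frame_def)
  next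
    case (2 s1 t1)
    then have f1: "arr s1 17 = arr s 17" "reg s1 18 = n" "arr s1 14 n = pre_part K n" "arr s1 18 = arr s' 18"
      "arr s1 19 = arr s' 19" "reg s1 11 = ?ok"
      using fr 7(3) search_state_simps(11)[OF ss n] by (simp_all add: frame_def)
    have ss1: "search_state G s1" by (rule search_state_frame[OF conjunct1[OF 2] ss]) auto
    let ?s2 = "set_reg 10 (pre_part K n) s1"
    let ?s3 = "set_arr 18 (pre_part K n) (arr s' 18 (pre_part K n) + arr s 17 n) ?s2"
    show ?case
    proof (rule wp_seqI[where R = "\<lambda>s2 t2. s2 = ?s2 \<and> t2 \<le> 5"], goal_cases)
      case 1
      show ?case using f1 by simp
    next
      case (2 s2 t2)
      show ?case
      proof (rule wp_seqI[where R = "\<lambda>s3 t3. s3 = ?s3 \<and> t3 \<le> 10"], goal_cases)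
        case 1
        show ?case using f1 2 b1 by simp
      next
        case (2 s3 t3)
        have s3: "s3 = ?s3" using 2 by simp
        have ss3: "search_state G ?s3" by (rule search_state_frame[OF _ ss1, of "{10}" "{18}"]) (auto simp: frame_def)
        have bb: "\<forall>i<K. arr ?s3 19 i + arr ?s3 17 n < B" using b2 f1 by simp
        have r18: "reg ?s3 18 = n" using f1 by simp
        show ?case
          unfolding s3
        proof (rule wp_mono[OF wp_add_served[OF ss3 r18 n bb]], goal_cases)
          case (1 s4 t4)
          have "reg s4 11 = ?ok" "arr s4 18 = arr ?s3 18" using 1(1) f1 by (simp_all add: frame_def)
          moreover have "\<forall>A<3 ^ K. arr ?s3 18 A = (\<Sum>j<Suc n. if pre_part K j = A then arr s 17 j else 0)"
            using 7(2) f1(4) by simp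
          moreover have "\<forall>i<K. arr s4 19 i = (\<Sum>j<Suc n. arr s 17 j * uses j i)"
            using 1(2) f1 7(2) by simp
          moreover have "t1 + (t2 + (t3 + t4)) \<le> 62 + K * 60"
            using 1(2) \<open>s3 = ?s3 \<and> t3 \<le> 10\<close> \<open>s2 = ?s2 \<and> t2 \<le> 5\<close>
              \<open>frame {9, 11} {} s' s1 \<and> reg s1 11 = ?ok \<and> t1 \<le> 12\<close> by linarith
          ultimately show ?case by simp
        qed
      qed
    qed
  qed
next
  case (8 s' t)
  then show ?case using search_state_simps(2)[OF s] by (simp add: served_def)
qed (use K3_small search_state_simps(2)[OF s] small[of 1] z in auto)

lemma wp_check_classes:
  assumes s: "search_state G s" and r11: "reg s 11 = (if ok then 1 else 0)"
  shows "wp B check_classes (\<lambda>s' t. reg s' 11 = (if ok \<and> (\<forall>j<3 ^ K. arr s 18 j = count mc j) then 1 else 0) \<and>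
    t \<le> 3 ^ K * 30 + 6) s"
  unfolding check_classes_def
proof (rule wp_FOR[where T = 22 and I = "\<lambda>n s'. reg s' 11 = (if ok \<and> (\<forall>j<n. arr s 18 j = count mc j) then 1 else 0)"],
    goal_cases)
  case (7 n s')
  have fr: "arr s' 18 = arr s 18" "arr s' 12 n = count mc n"
    using 7(5) search_state_simps(10)[OF s] by (simp_all add: frame_def)
  have S: "(\<forall>j<Suc n. arr s 18 j = count mc j) \<longleftrightarrow> (\<forall>j<n. arr s 18 j = count mc j) \<and> arr s 18 n = count mc n"
    by (auto simp: less_Suc_eq)
  show ?case unfolding S using 7(2,3) fr small[of 0] small[of 1] by simp
next
  case (8 s' t)
  then show ?case using search_state_simps(2)[OF s] by simp
qed (use K3_small search_state_simps(2)[OF s] small[of 1] r11 in auto)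

lemma wp_check_demands:
  assumes s: "search_state G s" and r11: "reg s 11 = (if ok then 1 else 0)"
  shows "wp B check_demands (\<lambda>s' t. reg s' 11 = (if ok \<and> (\<forall>i<K. arr s 19 i \<le> dem i) then 1 else 0) \<and>
    t \<le> K * 30 + 6) s"
  unfolding check_demands_def
proof (rule wp_FOR[where T = 22 and I = "\<lambda>n s'. reg s' 11 = (if ok \<and> (\<forall>i<n. arr s 19 i \<le> dem i) then 1 else 0)"],
    goal_cases)
  case (7 n s')
  have n: "n < K" using 7(1) search_state_simps(6)[OF s] by simp
  have fr: "arr s' 19 = arr s 19" "arr s' 9 n = dem n"
    using 7(5) search_state_simps(9)[OF s n] by (simp_all add: frame_def)
  have S: "(\<forall>j<Suc n. arr s 19 j \<le> dem j) \<longleftrightarrow> (\<forall>j<n. arr s 19 j \<le> dem j) \<and> arr s 19 n \<le> dem n"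
    by (auto simp: less_Suc_eq)
  show ?case unfolding S using 7(2,3) fr small[of 0] small[of 1] by auto
next
  case (8 s' t)
  then show ?case using search_state_simps(6)[OF s] by simp
qed (use search_state_simps(6)[OF s] small[of K] small[of 1] K_less r11 in auto)

lemma wp_adopt:
  assumes s: "search_state G s" and le: "\<forall>i<K. arr s 19 i \<le> dem i"
  shows "wp B adopt (\<lambda>s' t.
     (if reg s 15 < (\<Sum>i<K. arr s 19 i)
      then (\<forall>j<3 ^ K. arr s' 13 j = arr s 17 j) \<and> reg s' 15 = (\<Sum>i<K. arr s 19 i)
      else arr s' 13 = arr s 13 \<and> reg s' 15 = reg s 15) \<and> t \<le> 3 ^ K * 20 + K * 20 + 30) s"
  unfolding adopt_def
proof (rule wp_Asg_Num)
  show "0 < B" by (rule small) simp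
  let ?S = "\<Sum>i<K. arr s 19 i"
  let ?s = "set_reg 17 0 s"
  have ss: "search_state G ?s" by (rule search_state_frame[OF _ s, of "{17}" "{}"]) (auto simp: frame_def)
  have L: "wp B (FOR 19 4 (Asg 17 (Var 17 \<oplus> Get 19 (Var 19)))) (\<lambda>s' t. reg s' 17 = ?S \<and> t \<le> K * 20 + 6) ?s"
  proof (rule wp_FOR[where T = 12 and I = "\<lambda>n s'. reg s' 17 = (\<Sum>i<n. arr s 19 i)"], goal_cases)
    case (7 n s')
    have n: "n < K" using 7(1) search_state_simps(6)[OF ss] by simp
    have fr: "arr s' 19 = arr s 19" using 7(5) by (simp add: frame_def)
    have "(\<Sum>i<Suc n. arr s 19 i) \<le> (\<Sum>i<K. arr s 19 i)" by (rule sum_mono2) (use n in auto)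
    also have "\<dots> \<le> (\<Sum>i<K. dem i)" by (rule sum_mono) (use le in auto)
    finally have "(\<Sum>i<n. arr s 19 i) + arr s 19 n < B" using sum_dem_le by (intro small) simp
    then show ?case using 7(2,3) fr by simp
  next
    case (8 s' t)
    then show ?case using search_state_simps(6)[OF ss] by simp
  qed (use search_state_simps(6)[OF ss] small[of K] small[of 1] K_less in auto)
  show "wp B (FOR 19 4 (Asg 17 (Var 17 \<oplus> Get 19 (Var 19))) ;;
     IF (Var 15 \<prec> Var 17) (FOR 18 12 (Put 13 (Var 18) (Get 17 (Var 18))) ;; Asg 15 (Var 17)) (Asg 9 (Num 0)))
     (\<lambda>s' t. (if reg s 15 < (\<Sum>i<K. arr s 19 i)
      then (\<forall>j<3 ^ K. arr s' 13 j = arr s 17 j) \<and> reg s' 15 = (\<Sum>i<K. arr s 19 i)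
      else arr s' 13 = arr s 13 \<and> reg s' 15 = reg s 15) \<and> 2 + t \<le> 3 ^ K * 20 + K * 20 + 30) ?s"
    unfolding wp.simps(3)
  proof (rule wp_mono[OF L], goal_cases)
    case (1 s1 t1)
    have f1: "reg s1 15 = reg s 15" "reg s1 17 = ?S" "arr s1 13 = arr s 13" "arr s1 17 = arr s 17" "t1 \<le> K * 20 + 6"
      using 1 by (simp_all add: frame_def)
    have ss1: "search_state G s1" by (rule search_state_frame[OF 1(1) ss]) auto
    show ?case
    proof (cases "reg s 15 < ?S")
      case True
      have C: "wp B (FOR 18 12 (Put 13 (Var 18) (Get 17 (Var 18)))) (\<lambda>s' t. (\<forall>j<3 ^ K. arr s' 13 j = arr s 17 j) \<and>
          t \<le> 3 ^ K * 13 + 6) s1"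
      proof (rule wp_FOR[where T = 5 and I = "\<lambda>n s'. \<forall>j<n. arr s' 13 j = arr s 17 j"], goal_cases)
        case (7 n s')
        have "arr s' 17 = arr s 17" using 7(5) f1 by (simp add: frame_def)
        then show ?case using 7(2,3) by (auto simp: less_Suc_eq)
      next
        case (8 s' t)
        then show ?case using search_state_simps(2)[OF ss1] by simp
      qed (use K3_small search_state_simps(2)[OF ss1] small[of 1] in auto)
      show ?thesis
      proof (rule wp_IF_true)
        show "wp B (FOR 18 12 (Put 13 (Var 18) (Get 17 (Var 18))) ;; Asg 15 (Var 17))
          (\<lambda>s1 t1a. (if reg s 15 < (\<Sum>i<K. arr s 19 i)
            then (\<forall>j<3 ^ K. arr s1 13 j = arr s 17 j) \<and> reg s1 15 = (\<Sum>i<K. arr s 19 i)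
            else arr s1 13 = arr s 13 \<and> reg s1 15 = reg s 15) \<and>
            2 + (t1 + (t1a + ecost (Var 15 \<prec> Var 17) + 1)) \<le> 3 ^ K * 20 + K * 20 + 30) s1"
          unfolding wp.simps(3)
          by (rule wp_mono[OF C]) (use f1 True in \<open>auto simp: frame_def\<close>)
      qed (use f1 True in auto)
    next
      case False
      show ?thesis
        by (rule wp_IF_false) (use f1 False small[of 0] in auto)
    qed
  qed
qed

lemma wp_try_candidate:
  assumes s: "search_state G s" and feas: "feas (arr s 13)" and a: "\<forall>j<3 ^ K. arr s 16 j \<le> 2 * G"
  defines "y \<equiv> candidate G (arr s 13) (arr s 16)"
  shows "wp B try_candidate (\<lambda>s' t.
     (if feas y \<and> reg s 15 < (\<Sum>i<K. served y i)
      then (\<forall>j<3 ^ K. arr s' 13 j = y j) \<and> reg s' 15 = (\<Sum>i<K. served y i)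
      else arr s' 13 = arr s 13 \<and> reg s' 15 = reg s 15) \<and> t \<le> 300 * (K + 1) * 3 ^ K) s"
proof -
  let ?Q = "\<lambda>s'. (if feas y \<and> reg s 15 < (\<Sum>i<K. served y i)
      then (\<forall>j<3 ^ K. arr s' 13 j = y j) \<and> reg s' 15 = (\<Sum>i<K. served y i)
      else arr s' 13 = arr s 13 \<and> reg s' 15 = reg s 15)"
  define Q where "Q s' \<longleftrightarrow> ?Q s'" for s' :: state
  let ?s = "set_reg 11 1 s"
  have xr: "\<forall>j<3 ^ K. arr s 13 j \<le> r" using feas_le[OF feas] by simp
  have ss: "search_state G ?s" by (rule search_state_frame[OF _ s, of "{11}" "{}"]) (auto simp: frame_def)
  have pos: "(3 :: nat) ^ K \<ge> 1" by simp
  have KQ: "K \<le> K * 3 ^ K" by simp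
  have M: "wp B make_candidate (\<lambda>s' t. (\<forall>j<3 ^ K. arr s' 17 j = y j \<and> arr s' 18 j = 0) \<and> t \<le> 3 ^ K * 24 + 6) ?s"
    using wp_make_candidate[OF ss] xr a by (simp add: y_def)
  have yl: "y j \<le> 4 * (3 + N + 2 * m)" if "j < 3 ^ K" for j
  proof -
    have "arr s 13 j \<le> r" "arr s 16 j \<le> 2 * G" using xr a that by simp_all
    then show ?thesis using rN search_state_simps(5)[OF s] by (simp add: y_def candidate_def)
  qed
  have "wp B (make_candidate ;; clear_served ;; accumulate ;; check_classes ;; check_demands ;;
      IF (Var 11) adopt (Asg 9 (Num 0))) (\<lambda>s' t. Q s' \<and> 2 + t \<le> 300 * (K + 1) * 3 ^ K) ?s"
    unfolding wp.simps(3)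
  proof (rule wp_mono[OF M], goal_cases)
    case (1 s1 t1)
    note p1 = 1(2)
    have ss1: "search_state G s1" by (rule search_state_frame[OF 1(1) ss]) auto
    have f1: "reg s1 11 = 1" "arr s1 13 = arr s 13" "reg s1 15 = reg s 15" using 1(1) by (simp_all add: frame_def)
    show ?case
    proof (rule wp_mono[OF wp_clear_served[OF ss1]], goal_cases)
      case (1 s2 t2)
      note p2 = 1(2)
      have ss2: "search_state G s2" by (rule search_state_frame[OF 1(1) ss1]) auto
      have f2: "reg s2 11 = 1" "arr s2 13 = arr s 13" "reg s2 15 = reg s 15" "arr s2 17 = arr s1 17" "arr s2 18 = arr s1 18"
        using 1(1) f1 by (simp_all add: frame_def)
      have y2: "\<And>j. j < 3 ^ K \<Longrightarrow> arr s2 17 j = y j" using f2 p1 by simp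
      have "\<forall>j<3 ^ K. arr s2 17 j \<le> 4 * (3 + N + 2 * m)" "\<forall>j<3 ^ K. arr s2 18 j = 0" "\<forall>i<K. arr s2 19 i = 0"
        using y2 yl f2 p1 p2 by simp_all
      note acc = wp_accumulate[OF ss2 this f2(1)]
      show ?case
      proof (rule wp_mono[OF acc], goal_cases)
        case (1 s3 t3)
        note p3 = 1(2)
        have ss3: "search_state G s3" by (rule search_state_frame[OF 1(1) ss2]) auto
        have f3: "arr s3 13 = arr s 13" "reg s3 15 = reg s 15" "arr s3 17 = arr s2 17"
          using 1(1) f2 by (simp_all add: frame_def)
        let ?ok1 = "\<forall>j<3 ^ K. bad j \<longrightarrow> arr s2 17 j = 0"
        have r3: "reg s3 11 = (if ?ok1 then 1 else 0)" using p3 by blast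
        show ?case
        proof (rule wp_mono[OF wp_check_classes[OF ss3 r3]], goal_cases)
          case (1 s4 t4)
          note p4 = 1(2)
          have ss4: "search_state G s4" by (rule search_state_frame[OF 1(1) ss3]) auto
          have f4: "arr s4 13 = arr s 13" "reg s4 15 = reg s 15" "arr s4 17 = arr s2 17" "arr s4 19 = arr s3 19"
            using 1(1) f3 by (simp_all add: frame_def)
          let ?ok2 = "?ok1 \<and> (\<forall>j<3 ^ K. arr s3 18 j = count mc j)"
          have r4: "reg s4 11 = (if ?ok2 then 1 else 0)" using p4 by blast
          show ?case
          proof (rule wp_mono[OF wp_check_demands[OF ss4 r4]], goal_cases)
            case (1 s5 t5)
            note p5 = 1(2)
            have ss5: "search_state G s5" by (rule search_state_frame[OF 1(1) ss4]) auto
            have f5: "arr s5 13 = arr s 13" "reg s5 15 = reg s 15" "arr s5 17 = arr s2 17" "arr s5 19 = arr s3 19"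
              using 1(1) f4 by (simp_all add: frame_def)
            let ?ok3 = "?ok2 \<and> (\<forall>i<K. arr s4 19 i \<le> dem i)"
            have sv: "\<And>i. i < K \<Longrightarrow> arr s3 19 i = served y i"
              using p3 served_cong[OF y2] by simp
            have cl: "arr s3 18 A = (\<Sum>j<3 ^ K. if pre_part K j = A then y j else 0)" if "A < 3 ^ K" for A
            proof -
              have "(\<Sum>j<3 ^ K. if pre_part K j = A then arr s2 17 j else 0) = (\<Sum>j<3 ^ K. if pre_part K j = A then y j else 0)"
                by (rule sum.cong) (use y2 in auto)
              then show ?thesis using p3 that by simp
            qed
            \<comment> \<open>The three tests of the program correspond in turn to the three
              conjuncts of \<open>feas\<close>.\<close>
            have "?ok3 \<longleftrightarrow> feas y" unfolding feas_def using y2 sv cl f4 by simp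
            then have r5: "reg s5 11 = (if feas y then 1 else 0)" using p5 by simp
            have tb: "t1 \<le> 3 ^ K * 24 + 6" "t2 \<le> K * 12 + 6" "t3 \<le> 3 ^ K * (70 + K * 60) + 6" "t4 \<le> 3 ^ K * 30 + 6"
              "t5 \<le> K * 30 + 6" using p1 p2 p3 p4 p5 by simp_all
            have "3 ^ K * (70 + K * 60) = 70 * 3 ^ K + 60 * (K * 3 ^ K)" by (simp add: algebra_simps)
            moreover have "300 * (K + 1) * 3 ^ K = 300 * 3 ^ K + 300 * (K * 3 ^ K)" by (simp add: algebra_simps)
            ultimately have time: "2 + (t1 + (t2 + (t3 + (t4 + (t5 + (t + 1 + 1)))))) \<le> 300 * (K + 1) * 3 ^ K"
              if "t \<le> 3 ^ K * 20 + K * 20 + 30" for t using tb that pos KQ by linarith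
            show ?case
            proof (cases "feas y")
              case True
              have dm: "\<forall>i<K. arr s5 19 i \<le> dem i" using sv f5 True by (simp add: feas_def)
              have eq: "(\<Sum>i<K. arr s3 19 i) = (\<Sum>i<K. served y i)" by (rule sum.cong) (use sv in auto)
              show ?thesis
                by (rule wp_IF_true, simp, use r5 True in simp, rule wp_mono[OF wp_adopt[OF ss5 dm]])
                  (use True f5 y2 time in \<open>simp add: Q_def eq split: if_splits\<close>)
            next
              case False
              show ?thesis
                by (rule wp_IF_false, simp, use r5 False in simp)
                  (use False f5 small[of 0] time[of 2] in \<open>simp add: Q_def\<close>)
            qed
          qed
        qed
      qed
    qed
  qed
  then show ?thesis
    unfolding try_candidate_def Q_def by (intro wp_Asg_Num) (use small[of 1] in auto)
qed

end

section \<open>Radius and running time of the search\<close>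

text \<open>For positive \<open>K\<close>, \<open>3 * 9 ^ K = 27 * 9 ^ (K - 1) \<le> 32 ^ K\<close>.
  The radius is rounded up to a power of 2 because doubling computes it.\<close>

lemma zero_sum_bound_le: "(3 * 9 ^ K) ^ K \<le> (2 :: nat) ^ (5 * (K * K))"
proof (cases "K = 0")
  case False
  then obtain k where k: "K = Suc k" by (cases K) auto
  have "(9 :: nat) ^ k \<le> 32 ^ k" by (rule power_mono) auto
  then have "3 * 9 ^ K \<le> (32 :: nat) ^ K" by (simp add: k)
  then have "(3 * 9 ^ K) ^ K \<le> ((32 :: nat) ^ K) ^ K" by (rule power_mono) simp
  also have "\<dots> = (2 ^ 5) ^ (K * K)" by (simp add: power_mult)
  also have "\<dots> = 2 ^ (5 * (K * K))" by (simp only: power_mult[symmetric])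
  finally show ?thesis .
qed simp

lemma time_sum:
  fixes P P' Q K N m work :: nat
  assumes PP: "P \<le> P'" and Q1: "1 \<le> Q" "1 \<le> P'" and work: "work = P' * ((K + 1) * (K + 1) * Q)"
    and t: "t1 \<le> m * 70 + 6" "t2 \<le> N * 40 + 6" "t3 \<le> K * 40 + 6" "t4 \<le> K * 20 + 8" "t5 \<le> N * 60 + 6"
    "t6 \<le> N * 40 + 6" "t7 \<le> Q * (K * (70 + K * 60) + 14) + 6" "t8 \<le> 5 * (K * K) * 20 + 8"
    "t9 \<le> N * (P * (500 * (K + 1) * Q) + 8) + K * 20 + 50"
  shows "t1 + t2 + t3 + t4 + t5 + t6 + t7 + t8 + t9 + 40 \<le> 1500 * work * (3 + N + 2 * m)"
proof -
  \<comment> \<open>Naming the products turns the estimate into linear arithmetic.\<close>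
  define KQ KKQ KK NW MW where defs: "KQ = K * Q" "KKQ = K * K * Q" "KK = K * K" "NW = N * work" "MW = m * work"
  have "1 * ((K + 1) * (K + 1) * Q) \<le> work"
    unfolding work by (rule mult_right_mono[OF Q1(2)]) simp
  moreover have "(K + 1) * (K + 1) * Q = KKQ + 2 * KQ + Q" by (simp add: defs algebra_simps)
  ultimately have w: "KKQ + 2 * KQ + Q \<le> work" by simp
  have KK: "KK \<le> KKQ" "K \<le> KQ" using Q1 by (simp_all add: defs)
  have sm: "1 \<le> work" "K \<le> work" "KK \<le> work" using w KK Q1(1) by linarith+
  have "Q * (K * (70 + K * 60) + 14) = 60 * KKQ + 70 * KQ + 14 * Q" by (simp add: defs algebra_simps)
  then have "t7 \<le> 60 * KKQ + 70 * KQ + 14 * Q + 6" using t(7) by simp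
  then have t7': "t7 \<le> 60 * work + 6" using w by linarith
  have "P * (500 * (K + 1) * Q) \<le> P' * (500 * ((K + 1) * (K + 1) * Q))"
    by (intro mult_mono[OF PP]) (auto simp: algebra_simps)
  also have "\<dots> = 500 * work" by (simp add: work algebra_simps)
  finally have "N * (P * (500 * (K + 1) * Q) + 8) \<le> N * (500 * work + 8)" by simp
  also have "\<dots> \<le> N * (508 * work)" by (rule mult_left_mono) (use sm in auto)
  finally have "t9 \<le> N * (508 * work) + K * 20 + 50" using t(9) by linarith
  then have t9': "t9 \<le> 508 * NW + K * 20 + 50" by (simp add: defs)
  have Nw: "N \<le> NW" "m \<le> MW" using sm by (simp_all add: defs)
  have t8': "t8 \<le> 100 * KK + 8" using t(8) by (simp add: defs)
  have "t1 + t2 + t3 + t4 + t5 + t6 + t7 + t8 + t9 + 40 \<le> 4500 * work + 1500 * NW + 3000 * MW"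
    using t(1-6) t7' t8' t9' Nw sm by linarith
  also have "\<dots> = 1500 * work * (3 + N + 2 * m)" by (simp add: defs algebra_simps)
  finally show ?thesis .
qed

text \<open>The number of rounds is fixed at \<open>N\<close>; rounds without progress do no harm,
  and the answer is read off by comparing total supply with total demand.\<close>

definition search :: scom where
  "search = Asg 15 (Num 0) ;; Asg 16 (Num 0) ;; FOR 19 4 (Asg 16 (Var 16 \<oplus> Get 9 (Var 19))) ;;
     FOR 24 1 (ENUM 16 14 12 try_candidate) ;; Asg 0 (Var 15 \<doteq> Var 16)"

text \<open>The radius \<open>2 ^ (5 * (K * K))\<close> may exceed a word and is therefore cut off
  at \<open>N + 1\<close>, which is still above \<open>r\<close>.\<close>

definition structured :: scom where
  "structured = adjacency ;; tally ;; demands ;; powers3 ;; masks ;; mask_counts ;; tables ;;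
     Asg 25 (Num 5 \<otimes> (Var 4 \<otimes> Var 4)) ;; Asg 26 (Var 1 \<oplus> Num 1) ;; capped_pow 13 25 26 ;;
     Asg 14 (Num 2 \<otimes> Var 13 \<oplus> Num 1) ;; search"

context structured_input
begin

definition total :: "(nat \<Rightarrow> nat) \<Rightarrow> nat" where
  "total x = (\<Sum>i<K. served x i)"

lemma total_cong: "(\<And>j. j < 3 ^ K \<Longrightarrow> x j = y j) \<Longrightarrow> total x = total y"
  unfolding total_def by (rule sum.cong) (auto intro: served_cong)

abbreviation "extendible \<equiv> precol_extendible {0..<N} E r p"
abbreviation "goal \<equiv> \<Sum>i<K. dem i"

lemma total_le: "feas x \<Longrightarrow> total x \<le> goal"
  unfolding total_def by (rule sum_mono) (simp add: feas_def)

text \<open>By \<open>improve\<close> a better \<open>y\<close> lies within \<open>G\<close> of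
  \<open>x\<close> in every coordinate, so the numbers \<open>y j + G - x j\<close> are digits in
  base \<open>Suc (2 * G)\<close> and together form the index \<open>k\<close>.\<close>

lemma improving_candidate:
  assumes ext: extendible and feas: "feas x" and less: "total x < goal"
    and G: "(3 * 9 ^ K) ^ K \<le> G \<or> r \<le> G"
  obtains k where "k < Suc (2 * G) ^ 3 ^ K"
    "feas (candidate G x (\<lambda>j. k div Suc (2 * G) ^ j mod Suc (2 * G)))"
    "total x < total (candidate G x (\<lambda>j. k div Suc (2 * G) ^ j mod Suc (2 * G)))"
proof -
  obtain y where y: "feas y" "total x < total y" "\<And>j. j < 3 ^ K \<Longrightarrow> y j \<le> x j + G"
    "\<And>j. j < 3 ^ K \<Longrightarrow> x j \<le> y j + G"
    by (rule improve[OF ext feas less[unfolded total_def] G]) (simp add: total_def)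
  obtain k where k: "k < Suc (2 * G) ^ 3 ^ K"
    "\<And>j. j < 3 ^ K \<Longrightarrow> k div Suc (2 * G) ^ j mod Suc (2 * G) = y j + G - x j"
  proof (rule number_with_digits[of "3 ^ K" "\<lambda>j. y j + G - x j" "Suc (2 * G)"])
    show "y j + G - x j < Suc (2 * G)" if "j < 3 ^ K" for j using y(3)[OF that] by simp
  next
    fix k
    assume "k < Suc (2 * G) ^ 3 ^ K" "\<And>j. j < 3 ^ K \<Longrightarrow> k div Suc (2 * G) ^ j mod Suc (2 * G) = y j + G - x j"
    then show thesis by (rule that)
  qed
  have eq: "candidate G x (\<lambda>j. k div Suc (2 * G) ^ j mod Suc (2 * G)) j = y j" if "j < 3 ^ K" for j
    using k(2)[OF that] y(4)[OF that] by (simp add: candidate_def)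
  show thesis
    by (rule that[OF k(1)]) (use y(1,2) feas_cong[OF eq] total_cong[OF eq] in simp_all)
qed

text \<open>Since \<open>x\<close> may be replaced in mid-round, the invariant is a disjunction:
  either the supply has grown already, or \<open>x\<close> is untouched and no candidate seen so far
  improves it. At the end the second case contradicts \<open>improving_candidate\<close> if an
  extension exists and the goal is not met.\<close>

lemma wp_round:
  assumes s: "search_state G s" and feas: "feas (arr s 13)" and tot: "reg s 15 = total (arr s 13)"
    and G: "(3 * 9 ^ K) ^ K \<le> G \<or> r \<le> G"
  shows "wp B (ENUM 16 14 12 try_candidate) (\<lambda>s' t. feas (arr s' 13) \<and> reg s' 15 = total (arr s' 13) \<and>
     reg s 15 \<le> reg s' 15 \<and> (extendible \<and> reg s 15 < goal \<longrightarrow> reg s 15 < reg s' 15) \<and>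
     t \<le> Suc (2 * G) ^ 3 ^ K * (500 * (K + 1) * 3 ^ K)) s"
proof -
  let ?b = "Suc (2 * G)"
  let ?c = "\<lambda>k. candidate G (arr s 13) (\<lambda>j. k div ?b ^ j mod ?b)"
  let ?I = "\<lambda>k s'. feas (arr s' 13) \<and> reg s' 15 = total (arr s' 13) \<and> reg s 15 \<le> reg s' 15 \<and>
    (reg s 15 < reg s' 15 \<or> arr s' 13 = arr s 13 \<and> (\<forall>k'<k. \<not> (feas (?c k') \<and> reg s 15 < total (?c k'))))"
  have rr: "reg s 14 = ?b" "reg s 12 = 3 ^ K" using search_state_simps[OF s] by simp_all
  have bB: "?b < B" using search_state_simps(5)[OF s] by (intro small) simp
  show ?thesis
  proof (rule wp_ENUM[where I = ?I and T = "300 * (K + 1) * 3 ^ K"], goal_cases)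
    case (11 s')
    then show ?case using feas tot by (simp add: frame_def)
  next
    case (12 k s')
    have ss: "search_state G s'" by (rule search_state_frame[OF 12(3) s]) auto
    have dig: "\<forall>j<3 ^ K. arr s' 16 j = k div ?b ^ j mod ?b" using 12(4) unfolding rr .
    have "k div ?b ^ j mod ?b < ?b" for j by simp
    then have a: "\<forall>j<3 ^ K. arr s' 16 j \<le> 2 * G" using dig less_Suc_eq_le by metis
    have f: "feas (arr s' 13)" using 12(2) by simp
    let ?y = "candidate G (arr s' 13) (arr s' 16)"
    show ?case
    proof (rule wp_mono[OF wp_try_candidate[OF ss f a]], goal_cases)
      case (1 s2 t)
      note p = 1(2)[folded total_def]
      have I2: "?I (Suc k) s2"
      proof (cases "feas ?y \<and> reg s' 15 < total ?y")
        case True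
        then have e: "\<And>j. j < 3 ^ K \<Longrightarrow> arr s2 13 j = ?y j" "reg s2 15 = total ?y" using p by simp_all
        then show ?thesis using True 12(2) feas_cong[OF e(1)] total_cong[OF e(1)] by simp
      next
        case False
        then have e: "arr s2 13 = arr s' 13" "reg s2 15 = reg s' 15" using p by auto
        have "\<not> (feas (?c k) \<and> reg s 15 < total (?c k))" if h: "arr s' 13 = arr s 13" "reg s 15 = reg s' 15"
        proof -
          have "\<And>j. j < 3 ^ K \<Longrightarrow> ?c k j = ?y j" using h(1) dig by (simp add: candidate_def)
          from feas_cong[OF this] total_cong[OF this] show ?thesis using False h(2) by simp
        qed
        then show ?thesis using 12(2) e by (auto simp: less_Suc_eq)
      qed
      have "?I (Suc k) s3" if "frame {20, 21, 22} {16} s2 s3" for s3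
      proof -
        have e: "arr s3 13 = arr s2 13" "reg s3 15 = reg s2 15" using that by (simp_all add: frame_def)
        show ?thesis unfolding e by (rule I2)
      qed
      then show ?case using p by blast
    qed
  next
    case (13 s' t)
    have I: "?I (?b ^ 3 ^ K) s'" using 13(1) unfolding rr .
    have "reg s 15 < reg s' 15" if h: "extendible" "reg s 15 < goal"
    proof (rule ccontr)
      assume "\<not> ?thesis"
      then have no: "\<forall>k'<?b ^ 3 ^ K. \<not> (feas (?c k') \<and> reg s 15 < total (?c k'))" using I by blast
      show False
        by (rule improving_candidate[OF h(1) feas _ G]) (use h(2) tot no in auto)
    qed
    moreover have "t \<le> ?b ^ 3 ^ K * (500 * (K + 1) * 3 ^ K)"
    proof -
      let ?P = "?b ^ 3 ^ K" and ?Q = "(3 :: nat) ^ K"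
      have pos: "?P \<ge> 1" "?Q \<ge> 1" by simp_all
      have "t \<le> ?P * (300 * (K + 1) * ?Q + 50 * ?Q + 50) + 50 * ?Q + 50" using 13(3) unfolding rr .
      also have "\<dots> \<le> ?P * (300 * (K + 1) * ?Q + 50 * ?Q + 50) + ?P * (50 * ?Q + 50)"
      proof -
        have "a + b + c \<le> a + P * (b + c)" if "1 \<le> P" for a b c P :: nat using that by (cases P) auto
        then show ?thesis using pos(1) by blast
      qed
      also have "\<dots> = ?P * (300 * (K + 1) * ?Q + 100 * ?Q + 100)" by (simp add: algebra_simps)
      also have "\<dots> \<le> ?P * (500 * (K + 1) * ?Q)"
      proof (rule mult_left_mono)
        have "500 * (K + 1) * ?Q = 500 * (K * ?Q) + 500 * ?Q" "300 * (K + 1) * ?Q = 300 * (K * ?Q) + 300 * ?Q"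
          by (simp_all add: algebra_simps)
        then show "300 * (K + 1) * ?Q + 100 * ?Q + 100 \<le> 500 * (K + 1) * ?Q" using pos(2) by linarith
      qed simp
      finally show ?thesis .
    qed
    ultimately show ?case using I by blast
  qed (use rr bB K3_small small[of 1] in auto)
qed

text \<open>If an extension exists, the supply after \<open>n\<close> rounds is at least
  \<open>n\<close> or equal to the goal, and the goal is at most \<open>N\<close>. Conversely a
  supply equal to the goal yields an extension by \<open>full_imp_extendible\<close>, whatever the
  radius.\<close>

lemma wp_search:
  assumes s: "search_state G s" and x: "arr s 13 = count mc"
    and G: "(3 * 9 ^ K) ^ K \<le> G \<or> r \<le> G"
  shows "wp B search (\<lambda>s' t. (reg s' 0 \<noteq> 0 \<longleftrightarrow> extendible) \<and>
     t \<le> N * (Suc (2 * G) ^ 3 ^ K * (500 * (K + 1) * 3 ^ K) + 8) + K * 20 + 50) s"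
proof -
  let ?s = "set_reg 16 0 (set_reg 15 0 s)"
  let ?TR = "Suc (2 * G) ^ 3 ^ K * (500 * (K + 1) * 3 ^ K)"
  have ss: "search_state G ?s" by (rule search_state_frame[OF _ s, of "{15, 16}" "{}"]) (auto simp: frame_def)
  have L: "wp B (FOR 19 4 (Asg 16 (Var 16 \<oplus> Get 9 (Var 19)))) (\<lambda>s' t. reg s' 16 = goal \<and> t \<le> K * 20 + 6) ?s"
  proof (rule wp_FOR[where T = 12 and I = "\<lambda>n s'. reg s' 16 = (\<Sum>i<n. dem i)"], goal_cases)
    case (7 n s')
    have n: "n < K" using 7(1) search_state_simps(6)[OF ss] by simp
    have ss': "search_state G s'" by (rule search_state_frame[OF 7(5) ss]) auto
    have "(\<Sum>i<Suc n. dem i) \<le> goal" by (rule sum_mono2) (use n in auto)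
    then have "(\<Sum>i<n. dem i) + dem n < B" using sum_dem_le by (intro small) simp
    then show ?case using 7(2,3) search_state_simps(9)[OF ss' n] by simp
  next
    case (8 s' t)
    then show ?case using search_state_simps(6)[OF ss] by simp
  qed (use search_state_simps(6)[OF ss] small[of K] small[of 1] K_less in auto)
  have R: "wp B (FOR 24 1 (ENUM 16 14 12 try_candidate)) (\<lambda>s' t. (reg s' 15 = reg s' 16 \<longleftrightarrow> extendible) \<and>
      t \<le> N * (?TR + 8) + 6) s1"
    if ss1: "search_state G s1" and f1: "reg s1 15 = 0" "reg s1 16 = goal" "arr s1 13 = count mc" for s1
  proof (rule wp_FOR[where T = ?TR and I = "\<lambda>n s'. feas (arr s' 13) \<and> reg s' 15 = total (arr s' 13) \<and>
      (extendible \<longrightarrow> n \<le> reg s' 15 \<or> reg s' 15 = goal)"], goal_cases)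
    case 6
    have "total (count mc) = 0" by (simp add: total_def feas_count_pre(2))
    then show ?case using f1 feas_count_pre(1) by simp
  next
    case (7 n s')
    have ss': "search_state G s'" by (rule search_state_frame[OF 7(5) ss1]) auto
    have f: "feas (arr s' 13)" and t: "reg s' 15 = total (arr s' 13)" using 7(2) by simp_all
    show ?case
    proof (rule wp_mono[OF wp_round[OF ss' f t G]], goal_cases)
      case (1 s2 t2)
      have "Suc n \<le> reg s2 15 \<or> reg s2 15 = goal" if e: extendible
      proof (cases "reg s' 15 = goal")
        case True
        then show ?thesis using 1(2) total_le[of "arr s2 13"] by simp
      next
        case False
        then have "reg s' 15 < goal" using total_le[OF f] t by simp
        then have "reg s' 15 < reg s2 15" using 1(2) e by blast
        then show ?thesis using 7(2) e False by simp
      qed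
      then show ?case using 1(2) by simp
    qed
  next
    case (8 s' t)
    have N: "reg s1 1 = N" using search_state_simps(7)[OF ss1] .
    have g: "reg s' 16 = goal" using 8(3) f1 by (simp add: frame_def)
    have "reg s' 15 = goal \<longleftrightarrow> extendible"
    proof
      assume "reg s' 15 = goal"
      then show extendible using full_imp_extendible[of "arr s' 13"] 8(1) by (simp add: total_def)
    next
      assume e: extendible
      then have "N \<le> reg s' 15 \<or> reg s' 15 = goal" using 8(1) unfolding N by blast
      then show "reg s' 15 = goal" using total_le[of "arr s' 13"] 8(1) sum_dem_le by auto
    qed
    then show ?case using 8(4) N g by simp
  qed (use search_state_simps(7)[OF ss1] small[of N] small[of 1] in auto)
  show ?thesis
    unfolding search_def
  proof (intro wp_Asg_Num)
    show "0 < B" "0 < B" by (rule small, simp)+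
    show "wp B (FOR 19 4 (Asg 16 (Var 16 \<oplus> Get 9 (Var 19))) ;; FOR 24 1 (ENUM 16 14 12 try_candidate) ;;
       Asg 0 (Var 15 \<doteq> Var 16)) (\<lambda>s' t. (reg s' 0 \<noteq> 0 \<longleftrightarrow> extendible) \<and> 2 + (2 + t) \<le> N * (?TR + 8) + K * 20 + 50) ?s"
      unfolding wp.simps(3)
    proof (rule wp_mono[OF L], goal_cases)
      case (1 s1 t1)
      have ss1: "search_state G s1" by (rule search_state_frame[OF 1(1) ss]) auto
      have f1: "reg s1 15 = 0" "reg s1 16 = goal" "arr s1 13 = count mc"
        using 1 x by (simp_all add: frame_def)
      show ?case
        by (rule wp_mono[OF R[OF ss1 f1]]) (use 1(2) small[of 1] in auto)
    qed
  qed
qed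

lemma mods_structured [simp]:
  "mv adjacency = {8, 9, 10}" "ma adjacency = {6}"
  "mv tally = {7, 9, 10}" "ma tally = {7, 8}"
  "mv demands = {19}" "ma demands = {9}"
  "mv powers3 = {12, 19}" "ma powers3 = {10}"
  "mv masks = {7, 9, 10}" "ma masks = {11, 20}"
  "mv mask_counts = {7, 9}" "ma mask_counts = {12, 13}"
  "mv tables = {9, 10, 18, 19, 23}" "ma tables = {14, 15}"
  by (auto simp: adjacency_def load_edge_def tally_def demands_def powers3_def masks_def
      mask_counts_def tables_def)

definition work :: nat where
  "work = Suc (2 * 2 ^ (5 * (K * K))) ^ 3 ^ K * ((K + 1) * (K + 1) * 3 ^ K)"

lemma structured_time:
  assumes "t1 \<le> m * 70 + 6" "t2 \<le> N * 40 + 6" "t3 \<le> K * 40 + 6" "t4 \<le> K * 20 + 8" "t5 \<le> N * 60 + 6"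
    "t6 \<le> N * 40 + 6" "t7 \<le> 3 ^ K * (K * (70 + K * 60) + 14) + 6" "t8 \<le> 5 * (K * K) * 20 + 8"
    "t9 \<le> N * (Suc (2 * G) ^ 3 ^ K * (500 * (K + 1) * 3 ^ K) + 8) + K * 20 + 50"
    and G: "G \<le> 2 ^ (5 * (K * K))"
  shows "t1 + t2 + t3 + t4 + t5 + t6 + t7 + t8 + t9 + 40 \<le> 1500 * work * (3 + N + 2 * m)"
  by (rule time_sum[OF _ _ _ work_def assms(1-9)]) (use G in \<open>auto intro!: power_mono\<close>)

lemma wp_structured:
  assumes ts: "typed_state s"
    and z: "arr s 6 = (\<lambda>_. 0)" "arr s 7 = (\<lambda>_. 0)" "arr s 8 = (\<lambda>_. 0)" "arr s 11 = (\<lambda>_. 0)"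
      "arr s 12 = (\<lambda>_. 0)" "arr s 13 = (\<lambda>_. 0)" "arr s 14 = (\<lambda>_. 0)" "arr s 15 = (\<lambda>_. 0)" "arr s 20 = (\<lambda>_. 0)"
  shows "wp B structured (\<lambda>s' t. (reg s' 0 \<noteq> 0 \<longleftrightarrow> extendible) \<and> t \<le> 1500 * work * (3 + N + 2 * m)) s"
  unfolding structured_def
proof (rule wp_seqI[OF wp_mono[where Q' = "\<lambda>s' t. frame (mv adjacency) (ma adjacency) s s' \<and>
      (\<forall>i<K. \<forall>j<K. arr s' 6 (i * K + j) \<noteq> 0 \<longleftrightarrow> adjacent m i j) \<and> t \<le> m * 70 + 6", OF wp_adjacency[OF ts z(1)]]],
    goal_cases)
  case (1 s' t)
  then show ?case by simp
next
  case (2 s1 t1)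
  note p1 = 2
  have f1: "frame {8, 9, 10} {6} s s1" using p1 by simp
  have ts1: "typed_state s1" by (rule typed_state_frame[OF f1 ts]) auto
  have z1: "arr s1 7 = (\<lambda>_. 0)" "arr s1 8 = (\<lambda>_. 0)" using f1 z by (simp_all add: frame_def)
  show ?case
    unfolding wp.simps(3)
  proof (rule wp_mono[OF wp_tally[OF ts1 z1]], goal_cases)
    case (1 s2 t2)
    note p2 = 1(2)
    have f2: "frame {7, 8, 9, 10} {6, 7, 8} s s2" using f1 1(1) by (simp add: frame_def)
    have ts2: "typed_state s2" by (rule typed_state_frame[OF f2 ts]) auto
    have a2: "\<forall>i<K. \<forall>j<K. arr s2 6 (i * K + j) \<noteq> 0 \<longleftrightarrow> adjacent m i j" using p1 1(1) by (simp add: frame_def)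
    have l2: "\<forall>i<K. arr s2 7 i = free_count N i \<and> (arr s2 8 i \<noteq> 0 \<longleftrightarrow> pre_exists N i)" using p2 by blast
    show ?case
    proof (rule wp_mono[OF wp_demands[OF ts2 a2 l2]], goal_cases)
      case (1 s3 t3)
      note p3 = 1(2)
      have f3: "frame {7, 8, 9, 10, 19} {6, 7, 8, 9} s s3" using f2 1(1) by (simp add: frame_def)
      have ts3: "typed_state s3" by (rule typed_state_frame[OF f3 ts]) auto
      have a3: "\<forall>i<K. \<forall>j<K. arr s3 6 (i * K + j) \<noteq> 0 \<longleftrightarrow> adjacent m i j" using a2 1(1) by (simp add: frame_def)
      show ?case
      proof (rule wp_mono[OF wp_powers3[OF ts3]], goal_cases)
        case (1 s4 t4)
        note p4 = 1(2) and g4 = 1(1)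
        have f4: "frame {7, 8, 9, 10, 12, 19} {6, 7, 8, 9, 10} s s4" using f3 g4 by (simp add: frame_def)
        have ts4: "typed_state s4" by (rule typed_state_frame[OF f4 ts]) auto
        have z4: "arr s4 11 = (\<lambda>_. 0)" "arr s4 20 = (\<lambda>_. 0)" using f4 z by (simp_all add: frame_def)
        have q4: "\<forall>i<K. arr s4 10 i = 3 ^ i" "reg s4 12 = 3 ^ K" using p4 by simp_all
        have as4: "adj_state s4" using ts4 a3 q4 g4 by (simp add: adj_state_def frame_def)
        have d4: "\<forall>i<K. arr s4 9 i = dem i" using p3 g4 by (simp add: frame_def)
        show ?case
        proof (rule wp_mono[OF wp_masks[OF ts4 z4 q4(1)]], goal_cases)
          case (1 s5 t5)
          note p5 = 1(2) and g5 = 1(1)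
          have f5: "frame {7, 8, 9, 10, 12, 19} {6, 7, 8, 9, 10, 11, 20} s s5" using f4 g5 by (simp add: frame_def)
          have ts5: "typed_state s5" by (rule typed_state_frame[OF f5 ts]) auto
          have z5: "arr s5 12 = (\<lambda>_. 0)" "arr s5 13 = (\<lambda>_. 0)" using f5 z by (simp_all add: frame_def)
          have m5: "\<forall>c>0. arr s5 20 c = mc c" using p5 by blast
          show ?case
          proof (rule wp_mono[OF wp_mask_counts[OF ts5 z5 m5]], goal_cases)
            case (1 s6 t6)
            note p6 = 1(2) and g6 = 1(1)
            have f46: "frame {7, 9, 10} {11, 12, 13, 20} s4 s6" using g5 g6 by (simp add: frame_def)
            have as6: "adj_state s6" by (rule adj_state_frame[OF f46 as4]) auto
            have z6: "arr s6 14 = (\<lambda>_. 0)" "arr s6 15 = (\<lambda>_. 0)" using f4 f46 z by (simp_all add: frame_def)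
            show ?case
            proof (rule wp_mono[OF wp_tables[OF as6 z6]], goal_cases)
              case (1 s7 t7)
              note p7 = 1(2) and g7 = 1(1)
              have as7: "adj_state s7" by (rule adj_state_frame[OF g7 as6]) auto
              have ts7: "typed_state s7" using as7 by (simp add: adj_state_def)
              note r7 = typed_state_simps[OF ts7]
              let ?s8 = "set_reg 26 (Suc N) (set_reg 25 (5 * (K * K)) s7)"
              have K5: "K * K < B" "5 * (K * K) < B"
              proof -
                show "K * K < B" using product_small[of K K 0] K_less by simp
                show "5 * (K * K) < B" using product_small[of K "5 * K" 0] K_less by (simp add: ac_simps)
              qed
              define G where "G = min (2 ^ (5 * (K * K))) (Suc N)"
              have cp: "wp B (capped_pow 13 25 26) (\<lambda>s' t. reg s' 13 = G \<and> t \<le> 5 * (K * K) * 20 + 8) ?s8"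
                unfolding G_def
                by (rule wp_mono[OF wp_capped_pow]) (use K5 small[of 1] small[of "2 * Suc N"] in auto)
              \<comment> \<open>If the minimum is \<open>Suc N\<close>, the second alternative
                applies because \<open>r < N\<close>.\<close>
              have big: "(3 * 9 ^ K) ^ K \<le> G \<or> r \<le> G"
                using zero_sum_bound_le[of K] rN by (auto simp: G_def min_def)
              \<comment> \<open>The successors are the form in which simplification leaves the cost of assignments.\<close>
              have "wp B (capped_pow 13 25 26 ;; Asg 14 (Num 2 \<otimes> Var 13 \<oplus> Num 1) ;; search)
                (\<lambda>s' t. (reg s' 0 \<noteq> 0 \<longleftrightarrow> extendible) \<and>
                  t1 + (t2 + (t3 + (t4 + (t5 + (t6 + (t7 + Suc (Suc (Suc (Suc (Suc (Suc (Suc (Suc (Suc (Suc (t)))))))))))))))) \<le> 1500 * work * (3 + N + 2 * m)) ?s8"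
                unfolding wp.simps(3)
              proof (rule wp_mono[OF cp], goal_cases)
                case (1 s8 t8)
                let ?s9 = "set_reg 14 (Suc (2 * G)) s8"
                have g8: "frame {0, 13, 14, 22, 25, 26} {} s7 ?s9" using 1(1) by (simp add: frame_def)
                have ss: "search_state G ?s9"
                  unfolding search_state_def
                proof (intro conjI)
                  show "typed_state ?s9" by (rule typed_state_frame[OF g8 ts7]) auto
                  show "\<forall>i<K. arr ?s9 10 i = 3 ^ i" "reg ?s9 12 = 3 ^ K"
                    using as7 g8 by (simp_all add: adj_state_def frame_def)
                  show "\<forall>i<K. arr ?s9 9 i = dem i" using d4 f46 g7 g8 by (simp add: frame_def)
                  show "\<forall>j. arr ?s9 12 j = count mc j" using p6 g7 g8 by (simp add: frame_def)
                  show "\<forall>j<3 ^ K. arr ?s9 14 j = pre_part K j \<and> (arr ?s9 15 j \<noteq> 0 \<longleftrightarrow> bad j)"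
                    using p7 g8 by (simp add: frame_def)
                  show "reg ?s9 13 = G" "reg ?s9 14 = Suc (2 * G)" "G \<le> Suc N" using 1(2) by (simp_all add: G_def)
                qed
                have x: "arr ?s9 13 = count mc" using p6 g7 g8 by (auto simp: frame_def)
                have GN: "G \<le> Suc N" by (simp add: G_def)
                have GB: "2 * G < B" "Suc (2 * G) < B" by (rule small, use GN in simp)+
                have "wp B search (\<lambda>s' t. (reg s' 0 \<noteq> 0 \<longleftrightarrow> extendible) \<and>
                  t1 + (t2 + (t3 + (t4 + (t5 + (t6 + (t7 + Suc (Suc (Suc (Suc (Suc (Suc (Suc (Suc (Suc (Suc (t8 + Suc (Suc (Suc (Suc (Suc (Suc (t)))))))))))))))))))))) \<le> 1500 * work * (3 + N + 2 * m)) ?s9"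
                proof (rule wp_mono[OF wp_search[OF ss x big]], goal_cases)
                  case (1 s10 t9)
                  have "t1 + t2 + t3 + t4 + t5 + t6 + t7 + t8 + t9 + 40 \<le> 1500 * work * (3 + N + 2 * m)"
                    by (rule structured_time[where G = G])
                      (use p1 p2 p3 p4 p5 p6 p7 1 \<open>reg s8 13 = G \<and> t8 \<le> 5 * (K * K) * 20 + 8\<close> in \<open>simp_all add: G_def\<close>)
                  then show ?case using 1 by simp
                qed
                then show ?case using 1(2) GB small[of 1] small[of 2] by simp
              qed
              then show ?case using r7 K5 small[of 1] small[of 5] small[of "Suc N"] by simp
            qed
          qed
        qed
      qed
    qed
  qed
qed

end

section \<open>The complete program\<close>

text \<open>Capping \<open>4 ^ K\<close> at \<open>N + 1\<close> does not change whether it exceeds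
  \<open>N\<close>, which is all the branch depends on.\<close>

definition solver :: scom where
  "solver = find_types ;; Asg 25 (Num 2 \<otimes> Var 4) ;; Asg 26 (Var 1 \<oplus> Num 1) ;; capped_pow 27 25 26 ;;
     IF (Var 1 \<prec> Var 27) brute structured"

definition main_program :: scom where
  "main_program = Asg 1 (Get 0 (Num 0)) ;; Asg 2 (Get 0 (Num 1)) ;; Asg 3 (Get 0 (Num 2)) ;;
     IF (Var 2 \<prec> Var 1) solver (Asg 0 (Num 1))"

text \<open>The summands pay for finding the types with all overheads, for exhaustive search on
  fewer than \<open>4 ^ k\<close> vertices, and for the local search with its tables.\<close>

definition time_factor :: "nat \<Rightarrow> nat" where
  "time_factor k = 1000 * (k + 2) + 500 * (4 ^ k) ^ 4 ^ k +
     1500 * (Suc (2 * 2 ^ (5 * (k * k))) ^ 3 ^ k * ((k + 1) * (k + 1) * 3 ^ k))"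

text \<open>The value \<open>r\<close> is a single input word and not bounded by the input length,
  so in this case no loop may run over the colors. As long as a vertex is uncolored, fewer than
  \<open>N \<le> r\<close> colors occur, and one is left for it.\<close>

lemma extendible_many_colors:
  assumes inst: "precol_instance {0..<N} E r p" and r: "N \<le> r"
  shows "precol_extendible {0..<N} E r p"
proof -
  have pp: "proper_partial_coloring {0..<N} E r p" and loop: "\<And>v. {v, v} \<notin> E"
    using inst by (auto simp: precol_instance_def simple_graph_def doubleton_eq_iff)
  have "\<exists>f. proper_partial_coloring {0..<N} E r f \<and> dom f = dom p \<union> X \<and> p \<subseteq>\<^sub>m f"
    if "finite X" "X \<subseteq> {0..<N} - dom p" for X
    using that
  proof (induction X rule: finite_induct)
    case empty
    then show ?case using pp by (intro exI[of _ p]) simp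
  next
    case (insert v X)
    then obtain f where f: "proper_partial_coloring {0..<N} E r f" "dom f = dom p \<union> X" "p \<subseteq>\<^sub>m f" by auto
    have v: "v < N" "v \<notin> dom f" using insert f(2) by auto
    have fr: "ran f \<subseteq> {1..r}" "dom f \<subseteq> {0..<N}" using f(1) by (simp_all add: proper_partial_coloring_def)
    have findom: "finite (dom f)" using fr(2) by (rule finite_subset) simp
    have "ran f = (\<lambda>u. the (f u)) ` dom f" by (force simp: ran_def)
    then have "card (ran f) \<le> card (dom f)" using findom by (simp add: card_image_le)
    also have "\<dots> < card {0..<N}" by (rule psubset_card_mono) (use fr(2) v in auto)
    finally have "card (ran f) < card {1..r}" using r by simp
    moreover have "finite (ran f)" using fr(1) by (rule finite_subset) simp
    ultimately have "\<not> {1..r} \<subseteq> ran f" using card_mono leD by blast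
    then obtain c where c: "c \<in> {1..r}" "c \<notin> ran f" by blast
    let ?f = "f(v \<mapsto> c)"
    have cf: "f u \<noteq> Some c" for u using c(2) ranI[of f u c] by auto
    have f_proper: "f u \<noteq> f w" if "u \<in> dom f" "w \<in> dom f" "{u, w} \<in> E" for u w
      using f(1) that unfolding proper_partial_coloring_def by blast
    have "proper_partial_coloring {0..<N} E r ?f"
      unfolding proper_partial_coloring_def
    proof (intro conjI ballI impI)
      show "dom ?f \<subseteq> {0..<N}" using fr(2) v by auto
      show "ran ?f \<subseteq> {1..r}" using fr(1) c(1) v(2) by (auto simp: ran_def)
    next
      fix u w assume uw: "u \<in> dom ?f" "w \<in> dom ?f" "{u, w} \<in> E"
      have ne: "u \<noteq> w" using uw(3) loop[of u] by auto
      consider "u = v" | "w = v" | "u \<noteq> v" "w \<noteq> v" by blast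
      then show "?f u \<noteq> ?f w"
      proof cases
        case 1
        then show ?thesis using ne cf[of w] by auto
      next
        case 2
        then show ?thesis using ne cf[of u] by auto
      next
        case 3
        then show ?thesis using uw f_proper[of u w] by auto
      qed
    qed
    moreover have "p \<subseteq>\<^sub>m ?f" using f(2,3) v(2) by (auto simp: map_le_def)
    moreover have "dom ?f = dom p \<union> insert v X" using f(2) by simp
    ultimately show ?case by blast
  qed
  from this[of "{0..<N} - dom p"] obtain f where
    f: "proper_partial_coloring {0..<N} E r f" "dom f = dom p \<union> ({0..<N} - dom p)" "p \<subseteq>\<^sub>m f" by auto
  have "dom p \<subseteq> {0..<N}" using pp by (simp add: proper_partial_coloring_def)
  then have "dom f = {0..<N}" using f(2) by auto
  then show ?thesis using f by (auto simp: precol_extendible_def)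
qed

context graph_input
begin

lemma wp_solver:
  assumes s: "inp s" and z: "\<And>a. a \<noteq> 0 \<Longrightarrow> arr s a = (\<lambda>_. 0)" and nd: "nd_at_most {0..<N} E k"
  shows "wp B solver (\<lambda>s' t. (reg s' 0 \<noteq> 0 \<longleftrightarrow> precol_extendible {0..<N} E r p) \<and>
     t + 50 \<le> time_factor k * (3 + N + 2 * m)) s"
  unfolding solver_def
proof (rule wp_seqI[OF wp_mono[where Q' = "\<lambda>s' t. frame (mv find_types) (ma find_types) s s' \<and>
      types_inv (arr s' 1) (reg s' 4) \<and> (\<forall>v<N. arr s' 1 v \<noteq> 0) \<and> t \<le> 600 * (k + 2) * (3 + N + 2 * m)",
      OF wp_find_types[OF s _ nd]]], goal_cases)
  case 1
  show ?case using z[of 1] by simp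
next
  case (2 s' t)
  then show ?case by simp
next
  case (3 s1 t1)
  define K where "K = reg s1 4"
  define ty where "ty = arr s1 1"
  let ?D = "3 + N + 2 * m"
  have f1: "frame {0, 4, 5, 6, 7, 8, 9, 10} {1, 2, 3, 4} s s1" using 3 by (simp add: mods_types)
  have i1: "inp s1" by (rule inp_frame[OF f1 s]) auto
  have T: "types_inv ty K" "\<forall>v<N. ty v \<noteq> 0" using 3 by (simp_all add: K_def ty_def)
  have Kk: "K \<le> k" "K \<le> N" using types_inv_le[OF T(1)] nd by auto
  let ?s2 = "set_reg 26 (Suc N) (set_reg 25 (2 * K) s1)"
  have cp: "wp B (capped_pow 27 25 26) (\<lambda>s' t. reg s' 27 = min (2 ^ (2 * K)) (Suc N) \<and> t \<le> 2 * K * 20 + 8) ?s2"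
    by (rule wp_mono[OF wp_capped_pow]) (use Kk small[of 1] small[of "2 * K"] small[of "2 * Suc N"] in auto)
  have four: "(2 :: nat) ^ (2 * K) = 4 ^ K" by (simp add: power_mult)
  have kD: "(k + 2) * ?D \<ge> K * 3 + 6"
  proof -
    have "K * 3 + 6 \<le> (k + 2) * 3" using Kk(1) by simp
    also have "\<dots> \<le> (k + 2) * ?D" by (rule mult_left_mono) auto
    finally show ?thesis .
  qed
  have time: "t1 + u + (2 * K * 20 + 8) + 100 \<le> time_factor k * ?D"
    if "u \<le> (500 * (4 ^ k) ^ 4 ^ k + 1500 * (Suc (2 * 2 ^ (5 * (k * k))) ^ 3 ^ k * ((k + 1) * (k + 1) * 3 ^ k))) * ?D" for u
  proof -
    define Y where "Y = 500 * (4 ^ k) ^ 4 ^ k + 1500 * (Suc (2 * 2 ^ (5 * (k * k))) ^ 3 ^ k * ((k + 1) * (k + 1) * 3 ^ k) :: nat)"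
    define X where "X = (k + 2) * ?D"
    have "time_factor k * ?D = 1000 * X + Y * ?D"
      by (simp add: time_factor_def X_def Y_def algebra_simps)
    moreover have "t1 \<le> 600 * (k + 2) * ?D" using 3 by blast
    then have "t1 \<le> 600 * X" by (simp only: X_def mult.assoc)
    moreover have "u \<le> Y * ?D" using that by (simp only: Y_def)
    moreover have "K * 3 + 6 \<le> X" using kD by (simp only: X_def)
    ultimately show ?thesis by linarith
  qed
  let ?R = "\<lambda>s' t. (reg s' 0 \<noteq> 0 \<longleftrightarrow> precol_extendible {0..<N} E r p) \<and>
     t1 + t + (2 * K * 20 + 8) + 90 \<le> time_factor k * ?D"
  have "wp B (IF (Var 1 \<prec> Var 27) brute structured) ?R s3"
    if f3: "frame {0, 22, 25, 26, 27} {} s1 s3" and r27: "reg s3 27 = min (4 ^ K) (Suc N)" for s3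
  proof -
    have i3: "inp s3" by (rule inp_frame[OF f3 i1]) auto
    show ?thesis
    proof (cases "4 ^ K \<le> N")
      case False
      have "r ^ N \<le> (4 ^ k) ^ 4 ^ k"
      proof -
        have "(4 :: nat) ^ K \<le> 4 ^ k" using Kk by (intro power_increasing) auto
        then have Nk: "N \<le> 4 ^ k" using False by linarith
        have "r ^ N \<le> (4 ^ k) ^ N" by (rule power_mono) (use Nk rN in auto)
        also have "\<dots> \<le> (4 ^ k) ^ 4 ^ k" by (rule power_increasing[OF Nk]) simp
        finally show ?thesis .
      qed
      then have "r ^ N * (500 * ?D) \<le> (4 ^ k) ^ 4 ^ k * (500 * ?D)" by (rule mult_right_mono) simp
      also have "\<dots> \<le> (500 * (4 ^ k) ^ 4 ^ k + 1500 * (Suc (2 * 2 ^ (5 * (k * k))) ^ 3 ^ k * ((k + 1) * (k + 1) * 3 ^ k))) * ?D"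
        by (simp add: algebra_simps)
      finally have tm: "t1 + r ^ N * (500 * ?D) + (2 * K * 20 + 8) + 100 \<le> time_factor k * ?D" by (rule time)
      show ?thesis
        by (rule wp_IF_true, simp, use False r27 inp_simps[OF i3] in simp, rule wp_mono[OF wp_brute[OF i3]])
          (use tm in simp)
    next
      case True
      interpret S: structured_input N r m B A0 E p U W K ty
        by unfold_locales (use T True in auto)
      have ts: "S.typed_state s3"
        unfolding S.typed_state_def using i3 f3 by (simp add: frame_def K_def ty_def)
      have z3: "arr s3 a = (\<lambda>_. 0)" if "a > 4" for a
        using z[of a] that f1 f3 by (simp add: frame_def)
      have "S.work \<le> Suc (2 * 2 ^ (5 * (k * k))) ^ 3 ^ k * ((k + 1) * (k + 1) * 3 ^ k)"
        unfolding S.work_def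
      proof (intro mult_mono)
        have "K * K \<le> k * k" using Kk(1) by (intro mult_mono) auto
        then have "(2 :: nat) ^ (5 * (K * K)) \<le> 2 ^ (5 * (k * k))" by (intro power_increasing) auto
        then have "Suc (2 * 2 ^ (5 * (K * K))) ^ 3 ^ K \<le> Suc (2 * 2 ^ (5 * (k * k))) ^ 3 ^ K"
          by (intro power_mono) auto
        also have "\<dots> \<le> Suc (2 * 2 ^ (5 * (k * k))) ^ 3 ^ k"
          by (intro power_increasing) (use Kk(1) in auto)
        finally show "Suc (2 * 2 ^ (5 * (K * K))) ^ 3 ^ K \<le> Suc (2 * 2 ^ (5 * (k * k))) ^ 3 ^ k" .
      qed (use Kk(1) in auto)
      then have "S.work * (1500 * ?D) \<le> (Suc (2 * 2 ^ (5 * (k * k))) ^ 3 ^ k * ((k + 1) * (k + 1) * 3 ^ k)) * (1500 * ?D)"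
        by (rule mult_right_mono) simp
      also have "\<dots> \<le> (500 * (4 ^ k) ^ 4 ^ k + 1500 * (Suc (2 * 2 ^ (5 * (k * k))) ^ 3 ^ k * ((k + 1) * (k + 1) * 3 ^ k))) * ?D"
      proof -
        have "b * (1500 * d) \<le> (a + 1500 * b) * d" for a b d :: nat by (simp add: algebra_simps)
        then show ?thesis .
      qed
      finally have tm: "t1 + S.work * (1500 * ?D) + (2 * K * 20 + 8) + 100 \<le> time_factor k * ?D" by (rule time)
      have eq: "1500 * S.work * ?D = S.work * (1500 * ?D)" by (simp add: ac_simps)
      show ?thesis
        by (rule wp_IF_false, simp, use True r27 inp_simps[OF i3] in simp,
            rule wp_mono[OF S.wp_structured[OF ts]])
          (use tm eq z3 in simp_all)
    qed
  qed
  note branch = this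
  show ?case
  proof (rule wp_Asg_seq)
    show "safe B (Num 2 \<otimes> Var 4) s1" using Kk small[of 2] small[of "2 * K"] by (simp add: K_def)
    show "wp B (Asg 26 (Var 1 \<oplus> Num 1) ;; capped_pow 27 25 26 ;; IF (Var 1 \<prec> Var 27) brute structured)
      (\<lambda>s' t. (reg s' 0 \<noteq> 0 \<longleftrightarrow> precol_extendible {0..<N} E r p) \<and>
        t1 + (ecost (Num 2 \<otimes> Var 4) + 1 + t) + 50 \<le> time_factor k * ?D) (set_reg 25 (ev (Num 2 \<otimes> Var 4) s1) s1)"
    proof (rule wp_Asg_seq)
      show "safe B (Var 1 \<oplus> Num 1) (set_reg 25 (ev (Num 2 \<otimes> Var 4) s1) s1)"
        using inp_simps[OF i1] small[of 1] small[of "Suc N"] by simp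
      have e: "set_reg 26 (ev (Var 1 \<oplus> Num 1) (set_reg 25 (ev (Num 2 \<otimes> Var 4) s1) s1)) (set_reg 25 (ev (Num 2 \<otimes> Var 4) s1) s1) = ?s2"
        using inp_simps[OF i1] by (simp add: K_def)
      show "wp B (capped_pow 27 25 26 ;; IF (Var 1 \<prec> Var 27) brute structured)
        (\<lambda>s' t. (reg s' 0 \<noteq> 0 \<longleftrightarrow> precol_extendible {0..<N} E r p) \<and>
          t1 + (ecost (Num 2 \<otimes> Var 4) + 1 + (ecost (Var 1 \<oplus> Num 1) + 1 + t)) + 50 \<le> time_factor k * ?D)
        (set_reg 26 (ev (Var 1 \<oplus> Num 1) (set_reg 25 (ev (Num 2 \<otimes> Var 4) s1) s1)) (set_reg 25 (ev (Num 2 \<otimes> Var 4) s1) s1))"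
        unfolding e wp.simps(3)
      proof (rule wp_mono[OF cp], goal_cases)
        case (1 s3 t3)
        have f3: "frame {0, 22, 25, 26, 27} {} s1 s3" using 1(1) by (simp add: frame_def)
        show ?case
          by (rule wp_mono[OF branch[OF f3]]) (use 1(2) four in auto)
      qed
    qed
  qed
qed

end

section \<open>Encoded inputs and the word limit\<close>

lemma concat_pairs:
  "length (concat (map (\<lambda>(u, v). [u, v]) es)) = 2 * length es"
  "e < length es \<Longrightarrow> concat (map (\<lambda>(u, v). [u, v]) es) ! (2 * e) = fst (es ! e)"
  "e < length es \<Longrightarrow> concat (map (\<lambda>(u, v). [u, v]) es) ! Suc (2 * e) = snd (es ! e)"
proof (induction es arbitrary: e)
  case (Cons a es)
  {
    case 1
    show ?case using Cons.IH(1) by (cases a) simp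
  next
    case 2
    then show ?case using Cons.IH(2)[of "e - 1"] by (cases a; cases e) auto
  next
    case 3
    then show ?case using Cons.IH(3)[of "e - 1"] by (cases a; cases e) auto
  }
qed simp_all

definition input_array :: "nat list \<Rightarrow> nat \<Rightarrow> nat" where
  "input_array xs i = (if i < length xs then xs ! i else 0)"

text \<open>The program handles values of 12 times the squared input length. In the fourth power of
  \<open>w\<close> two factors cover the square, and the product of the other two, at least 25,
  covers the 12. Inputs with \<open>0 < r < N\<close> have at least two vertices, hence length at
  least 5.\<close>

lemma word_limit_bounds:
  assumes "length xs \<ge> 3"
  shows "80 < word_limit 4 xs" "length xs < word_limit 4 xs" "x \<in> set xs \<Longrightarrow> x < word_limit 4 xs"
    "5 \<le> length xs \<Longrightarrow> 12 * (length xs * length xs) < word_limit 4 xs"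
proof -
  define w where "w = length xs + Max (set xs)"
  have w3: "3 \<le> w" using assms by (simp add: w_def)
  have lim: "word_limit 4 xs = w * w * (w * w)" by (simp add: word_limit_def w_def power4_eq_xxxx mult.assoc)
  have ww: "9 \<le> w * w" using mult_mono[OF w3 w3] by simp
  then show "80 < word_limit 4 xs" using mult_mono[OF ww ww] unfolding lim by simp
  have "w * 1 < w * w" using w3 by (intro mult_strict_left_mono) auto
  moreover have "w * w * 1 \<le> w * w * (w * w)" by (rule mult_left_mono) (use w3 in auto)
  ultimately have wl: "w < word_limit 4 xs" unfolding lim by linarith
  show "length xs < word_limit 4 xs" using wl by (simp add: w_def)
  show "x < word_limit 4 xs" if "x \<in> set xs"
  proof -
    have "x \<le> Max (set xs)" using that by simp
    then have "x \<le> w" by (simp add: w_def)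
    then show ?thesis using wl by simp
  qed
  show "12 * (length xs * length xs) < word_limit 4 xs" if l5: "5 \<le> length xs"
  proof -
    have wl: "length xs \<le> w" by (simp add: w_def)
    have lw: "length xs * length xs \<le> w * w" using wl by (intro mult_mono) auto
    have "25 \<le> length xs * length xs" using mult_mono[OF l5 l5] by simp
    then have "25 \<le> w * w" using lw by linarith
    then have "25 * (length xs * length xs) \<le> w * w * (w * w)" by (rule mult_mono[OF _ lw]) simp_all
    moreover have "0 < length xs * length xs" using \<open>25 \<le> length xs * length xs\<close> by linarith
    then have "12 * (length xs * length xs) < 25 * (length xs * length xs)" by linarith
    ultimately show ?thesis unfolding lim by linarith
  qed
qed

lemma graph_input_encodes:
  assumes enc: "encodes xs N E r p" and inst: "precol_instance {0..<N} E r p" and rN: "r < N"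
  obtains m U W where "graph_input N r m (word_limit 4 xs) (input_array xs) E p U W"
    "length xs = 3 + N + 2 * m" "xs ! 0 = N" "xs ! 1 = r" "xs ! 2 = m"
proof -
  obtain es where es: "distinct (map (\<lambda>(u, v). {u, v}) es)" "(\<lambda>(u, v). {u, v}) ` set es = E"
    "xs = [N, r, length es] @ map (\<lambda>v. case p v of None \<Rightarrow> 0 | Some c \<Rightarrow> c) [0..<N]
             @ concat (map (\<lambda>(u, v). [u, v]) es)"
    using enc by (auto simp: encodes_def)
  let ?cs = "map (\<lambda>v. case p v of None \<Rightarrow> 0 | Some c \<Rightarrow> c) [0..<N]"
  let ?c = "concat (map (\<lambda>(u, v). [u, v]) es)"
  define U where "U e = fst (es ! e)" for e
  define W where "W e = snd (es ! e)" for e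
  have len: "length xs = 3 + N + 2 * length es" using concat_pairs(1)[of es] by (simp add: es(3))
  have shift: "xs ! (3 + i) = (?cs @ ?c) ! i" for i by (simp add: es(3) nth_append)
  have pair: "(case es ! e of (u, v) \<Rightarrow> {u, v}) = {U e, W e}" for e
    by (simp add: U_def W_def split: prod.splits)
  have r0: "r > 0" using inst by (simp add: precol_instance_def)
  have "graph_input N r (length es) (word_limit 4 xs) (input_array xs) E p U W"
  proof
    show "precol_instance {0..<N} E r p" "r < N" by fact+
    show "input_array xs (3 + v) = (case p v of None \<Rightarrow> 0 | Some c \<Rightarrow> c)" if "v < N" for v
      using that shift[of v] len by (simp add: input_array_def nth_append)
    show "input_array xs (2 * e + (3 + N)) = U e" if "e < length es" for e
    proof -
      have "xs ! (3 + (N + 2 * e)) = U e"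
        unfolding shift using concat_pairs(2)[OF that] by (simp add: nth_append U_def)
      then show ?thesis using that len by (simp add: input_array_def ac_simps)
    qed
    show "input_array xs (2 * e + (4 + N)) = W e" if "e < length es" for e
    proof -
      have "xs ! (3 + (N + Suc (2 * e))) = W e"
        unfolding shift using concat_pairs(3)[OF that] by (simp add: nth_append W_def)
      moreover have "input_array xs (3 + (N + Suc (2 * e))) = xs ! (3 + (N + Suc (2 * e)))"
        using that len by (simp add: input_array_def)
      moreover have "2 * e + (4 + N) = 3 + (N + Suc (2 * e))" by simp
      ultimately show ?thesis by metis
    qed
    have "set es = (\<lambda>e. es ! e) ` {..<length es}" by (auto simp: set_conv_nth)
    then have "E = (\<lambda>e. case es ! e of (u, v) \<Rightarrow> {u, v}) ` {..<length es}"
      unfolding es(2)[symmetric] by (simp add: image_image)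
    then show "E = (\<lambda>e. {U e, W e}) ` {..<length es}" unfolding pair .
    show "inj_on (\<lambda>e. {U e, W e}) {..<length es}"
      using es(1) unfolding pair[symmetric] by (auto simp: distinct_conv_nth intro!: inj_onI)
    show "12 * ((3 + N + 2 * length es) * (3 + N + 2 * length es)) < word_limit 4 xs"
      using word_limit_bounds(4)[of xs] rN r0 unfolding len by simp
  qed
  moreover have "xs ! 0 = N" "xs ! 1 = r" "xs ! 2 = length es" by (simp_all add: es(3))
  ultimately show thesis using len that by blast
qed

section \<open>Growth of the running time\<close>

text \<open>\<open>k * k * 3 ^ k\<close> is dominated by \<open>k * 4 ^ k\<close> because eventually
  \<open>(k + 1) * 3 ^ k \<le> 4 ^ k\<close>; the finitely many exceptions go into the
  constant.\<close>

lemma exponent_bound: "\<exists>c. \<forall>k. (5 * (k * k) + 2) * 3 ^ k + 4 * k \<le> 5 * k * 4 ^ k + (c :: nat)"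
proof -
  let ?f = "\<lambda>k :: nat. (5 * (k * k) + 2) * 3 ^ k + 4 * k"
  \<comment> \<open>The induction starts at 8, where 9 * 6561 = 59049 \<le> 65536.\<close>
  have large: "(k + 1) * 3 ^ k \<le> (4 :: nat) ^ k" if "8 \<le> k" for k
    using that
  proof (induction k rule: dec_induct)
    case (step k)
    have "(Suc k + 1) * 3 ^ Suc k = (3 * (k + 2)) * 3 ^ k" by (simp add: algebra_simps)
    also have "\<dots> \<le> (4 * (k + 1)) * 3 ^ k" using step by (intro mult_right_mono) auto
    also have "\<dots> = 4 * ((k + 1) * 3 ^ k)" by (simp add: algebra_simps)
    also have "\<dots> \<le> 4 * 4 ^ k" by (rule mult_left_mono) (use step in auto)
    finally show ?case by simp
  qed simp
  have three: "4 * k \<le> (3 :: nat) ^ k" if "8 \<le> k" for k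
    using that by (induction k rule: dec_induct) auto
  have f: "?f k \<le> 5 * k * 4 ^ k" if "8 \<le> k" for k
  proof -
    have "?f k \<le> (5 * (k * k) + 2) * 3 ^ k + 3 ^ k" using three[OF that] by simp
    also have "\<dots> = (5 * (k * k) + 3) * 3 ^ k" by (simp add: algebra_simps)
    also have "\<dots> \<le> (5 * k * (k + 1)) * 3 ^ k" using that by (intro mult_right_mono) (auto simp: algebra_simps)
    also have "\<dots> = 5 * k * ((k + 1) * 3 ^ k)" by (simp add: algebra_simps)
    also have "\<dots> \<le> 5 * k * 4 ^ k" by (rule mult_left_mono[OF large[OF that]]) simp
    finally show ?thesis .
  qed
  have "?f k \<le> 5 * k * 4 ^ k + (\<Sum>i<8. ?f i)" for k
  proof (cases "8 \<le> k")
    case True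
    show ?thesis by (rule trans_le_add1[OF f[OF True]])
  next
    case False
    have "?f k \<le> (\<Sum>i<8. ?f i)" by (rule member_le_sum) (use False in auto)
    then show ?thesis by (rule trans_le_add2)
  qed
  then show ?thesis by blast
qed

text \<open>The exponent \<open>5 * k * 4 ^ k\<close> is 2.5 q times the binary logarithm of q, for
  q = 4^k. Typing and exhaustive search stay below this power up to numerical constants, the local
  search up to the factor \<open>2 ^ c\<close> as well.\<close>

lemma time_factor_bound: "\<exists>C. \<forall>k. time_factor k \<le> C * 2 ^ (5 * k * 4 ^ k)"
proof -
  obtain c :: nat where c: "\<And>k. (5 * (k * k) + 2) * 3 ^ k + 4 * k \<le> 5 * k * 4 ^ k + c"
    using exponent_bound by blast
  have "time_factor k \<le> (2500 + 1500 * 2 ^ c) * 2 ^ (5 * k * 4 ^ k)" for k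
  proof -
    define Z :: nat where "Z = 2 ^ (5 * k * 4 ^ k)"
    have pow: "(2 :: nat) ^ a \<le> Z" if "a \<le> 5 * k * 4 ^ k" for a
      unfolding Z_def using that by (rule power_increasing) simp
    have k4: "k \<le> k * 4 ^ k" by simp
    have "k + 2 \<le> 2 * 2 ^ k" by (induction k) auto
    also have "\<dots> \<le> 2 * Z" using pow[of k] k4 by simp
    finally have 1: "k + 2 \<le> 2 * Z" .
    have "((4 :: nat) ^ k) ^ 4 ^ k = (2 ^ (2 * k)) ^ 4 ^ k" by (simp add: power_mult)
    also have "\<dots> = 2 ^ (2 * k * 4 ^ k)" by (simp only: power_mult)
    also have "\<dots> \<le> Z" by (rule pow) simp
    finally have 2: "(4 ^ k) ^ 4 ^ k \<le> Z" .
    \<comment> \<open>The base of the digits is bounded by a power of 2, so that the choice of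
      \<open>3 ^ k\<close> digits multiplies the exponent by \<open>3 ^ k\<close>.\<close>
    have "Suc (2 * 2 ^ (5 * (k * k))) \<le> 2 ^ (5 * (k * k) + 2)" by simp
    then have "Suc (2 * 2 ^ (5 * (k * k))) ^ 3 ^ k \<le> (2 ^ (5 * (k * k) + 2)) ^ 3 ^ k"
      by (rule power_mono) simp
    also have "\<dots> = 2 ^ ((5 * (k * k) + 2) * 3 ^ k)" by (simp only: power_mult)
    finally have a: "Suc (2 * 2 ^ (5 * (k * k))) ^ 3 ^ k \<le> 2 ^ ((5 * (k * k) + 2) * 3 ^ k)" .
    have "(k + 1) * (k + 1) * 3 ^ k \<le> 2 ^ k * 2 ^ k * 4 ^ k"
    proof (intro mult_mono)
      show "k + 1 \<le> 2 ^ k" "k + 1 \<le> 2 ^ k" by (induction k) auto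
      show "(3 :: nat) ^ k \<le> 4 ^ k" by (rule power_mono) auto
    qed auto
    also have "\<dots> = (2 * 2 * 4) ^ k" by (simp only: power_mult_distrib)
    also have "\<dots> = (2 ^ 4) ^ k" by simp
    also have "\<dots> = 2 ^ (4 * k)" by (simp only: power_mult)
    finally have b: "(k + 1) * (k + 1) * 3 ^ k \<le> 2 ^ (4 * k)" .
    have "Suc (2 * 2 ^ (5 * (k * k))) ^ 3 ^ k * ((k + 1) * (k + 1) * 3 ^ k) \<le>
        2 ^ ((5 * (k * k) + 2) * 3 ^ k) * 2 ^ (4 * k)"
      by (rule mult_mono[OF a b]) auto
    also have "\<dots> = 2 ^ ((5 * (k * k) + 2) * 3 ^ k + 4 * k)" by (simp only: power_add)
    also have "\<dots> \<le> 2 ^ (5 * k * 4 ^ k + c)" by (rule power_increasing[OF c]) simp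
    also have "\<dots> = 2 ^ c * Z" by (simp add: power_add Z_def)
    finally have 3: "Suc (2 * 2 ^ (5 * (k * k))) ^ 3 ^ k * ((k + 1) * (k + 1) * 3 ^ k) \<le> 2 ^ c * Z" .
    have "time_factor k \<le> 1000 * (2 * Z) + 500 * Z + 1500 * (2 ^ c * Z)"
      unfolding time_factor_def by (intro add_mono mult_left_mono 1 2 3) auto
    also have "\<dots> = (2500 + 1500 * 2 ^ c) * Z" by (simp add: algebra_simps)
    finally show ?thesis by (simp only: Z_def)
  qed
  then show ?thesis by blast
qed

lemma exec_main_program:
  assumes inst: "precol_instance {0..<N} E r p" and nd: "nd_at_most {0..<N} E k"
    and enc: "encodes xs N E r p"
  shows "\<exists>t s. exec (word_limit 4 xs) (compile main_program) (init_state xs) t s \<and>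
    (reg s 0 \<noteq> 0 \<longleftrightarrow> precol_extendible {0..<N} E r p) \<and> t \<le> time_factor k * length xs"
proof -
  let ?B = "word_limit 4 xs"
  let ?s0 = "init_state xs"
  have len3: "3 \<le> length xs" and x0: "xs ! 0 = N" "xs ! 1 = r" "length xs \<ge> 3 + N"
    using enc by (auto simp: encodes_def)
  note lim = word_limit_bounds[OF len3]
  have A0: "arr ?s0 0 = input_array xs" by (auto simp: init_state_def input_array_def)
  have words: "words ?B ?s0"
    using lim(1-3) by (auto simp: words_def init_state_def)
  \<comment> \<open>Register 0 is the only nonzero one at the start, and it is the home of variable
    0.\<close>
  have view: "view ?s0 = ?s0"
    by (auto simp: view_def init_state_def fun_eq_iff)
  let ?s1 = "set_reg 3 (xs ! 2) (set_reg 2 r (set_reg 1 N ?s0))"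
  have tf: "2000 \<le> time_factor k" by (simp add: time_factor_def)
  have tf': "100 \<le> time_factor k * length xs"
    using mult_mono[OF tf len3] by simp
  have main: "wp ?B (IF (Var 2 \<prec> Var 1) solver (Asg 0 (Num 1)))
     (\<lambda>s' t. (reg s' 0 \<noteq> 0 \<longleftrightarrow> precol_extendible {0..<N} E r p) \<and> t + 40 \<le> time_factor k * length xs) ?s1"
  proof (cases "N \<le> r")
    case True
    show ?thesis
      by (rule wp_IF_false) (use True tf' extendible_many_colors[OF inst True] lim(1) in auto)
  next
    case False
    then obtain m U W where g: "graph_input N r m ?B (input_array xs) E p U W" "length xs = 3 + N + 2 * m" "xs ! 2 = m"
      using graph_input_encodes[OF enc inst] by (metis not_le)
    interpret graph_input N r m ?B "input_array xs" E p U W by (rule g(1))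
    have "inp ?s1" by (simp add: inp_def A0 g(3))
    moreover have "\<And>a. a \<noteq> 0 \<Longrightarrow> arr ?s1 a = (\<lambda>_. 0)" by (simp add: init_state_def)
    ultimately have "wp ?B solver (\<lambda>s' t. (reg s' 0 \<noteq> 0 \<longleftrightarrow> precol_extendible {0..<N} E r p) \<and>
       t + 50 \<le> time_factor k * (3 + N + 2 * m)) ?s1"
      using nd by (rule wp_solver)
    note sol = this
    show ?thesis
    proof (rule wp_IF_true)
      show "wp ?B solver (\<lambda>s1 t1. (reg s1 0 \<noteq> 0 \<longleftrightarrow> precol_extendible {0..<N} E r p) \<and>
        t1 + ecost (Var 2 \<prec> Var 1) + 1 + 40 \<le> time_factor k * length xs) ?s1"
        by (rule wp_mono[OF sol]) (simp add: g(2))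
    qed (use False in auto)
  qed
  have "wp ?B main_program (\<lambda>s' t. (reg s' 0 \<noteq> 0 \<longleftrightarrow> precol_extendible {0..<N} E r p) \<and> t \<le> time_factor k * length xs) ?s0"
    unfolding main_program_def
  proof (rule wp_Asg_seq)
    have B: "0 < ?B" "1 < ?B" "2 < ?B" using lim(1) by simp_all
    have vals: "input_array xs 0 = N" "input_array xs 1 = r" "input_array xs 2 = xs ! 2"
    proof -
      have "xs \<noteq> []" using len3 by auto
      then show "input_array xs 0 = N" "input_array xs 1 = r" "input_array xs 2 = xs ! 2"
        using x0 len3 by (simp_all add: input_array_def)
    qed
    have e1: "set_reg 1 (ev (Get 0 (Num 0)) ?s0) ?s0 = set_reg 1 N ?s0" using vals by (simp add: A0)
    show "safe ?B (Get 0 (Num 0)) ?s0" using B by simp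
    show "wp ?B (Asg 2 (Get 0 (Num 1)) ;; Asg 3 (Get 0 (Num 2)) ;; IF (Var 2 \<prec> Var 1) solver (Asg 0 (Num 1)))
      (\<lambda>s' t. (reg s' 0 \<noteq> 0 \<longleftrightarrow> precol_extendible {0..<N} E r p) \<and>
        ecost (Get 0 (Num 0)) + 1 + t \<le> time_factor k * length xs) (set_reg 1 (ev (Get 0 (Num 0)) ?s0) ?s0)"
      unfolding e1
    proof (rule wp_Asg_seq)
      have e2: "set_reg 2 (ev (Get 0 (Num 1)) (set_reg 1 N ?s0)) (set_reg 1 N ?s0) = set_reg 2 r (set_reg 1 N ?s0)"
        using vals by (simp add: A0)
      show "safe ?B (Get 0 (Num 1)) (set_reg 1 N ?s0)" using B by simp
      show "wp ?B (Asg 3 (Get 0 (Num 2)) ;; IF (Var 2 \<prec> Var 1) solver (Asg 0 (Num 1)))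
        (\<lambda>s' t. (reg s' 0 \<noteq> 0 \<longleftrightarrow> precol_extendible {0..<N} E r p) \<and>
          ecost (Get 0 (Num 0)) + 1 + (ecost (Get 0 (Num 1)) + 1 + t) \<le> time_factor k * length xs)
        (set_reg 2 (ev (Get 0 (Num 1)) (set_reg 1 N ?s0)) (set_reg 1 N ?s0))"
        unfolding e2
      proof (rule wp_Asg_seq)
        have e3: "set_reg 3 (ev (Get 0 (Num 2)) (set_reg 2 r (set_reg 1 N ?s0))) (set_reg 2 r (set_reg 1 N ?s0)) = ?s1"
          using vals by (simp add: A0)
        show "safe ?B (Get 0 (Num 2)) (set_reg 2 r (set_reg 1 N ?s0))" using B by simp
        show "wp ?B (IF (Var 2 \<prec> Var 1) solver (Asg 0 (Num 1)))
          (\<lambda>s' t. (reg s' 0 \<noteq> 0 \<longleftrightarrow> precol_extendible {0..<N} E r p) \<and>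
            ecost (Get 0 (Num 0)) + 1 + (ecost (Get 0 (Num 1)) + 1 + (ecost (Get 0 (Num 2)) + 1 + t)) \<le> time_factor k * length xs)
          (set_reg 3 (ev (Get 0 (Num 2)) (set_reg 2 r (set_reg 1 N ?s0))) (set_reg 2 r (set_reg 1 N ?s0)))"
          unfolding e3 by (rule wp_mono[OF main]) simp
      qed
    qed
  qed
  then have wp0: "wp ?B main_program (\<lambda>s' t. (reg s' 0 \<noteq> 0 \<longleftrightarrow> precol_extendible {0..<N} E r p) \<and>
      t \<le> time_factor k * length xs) (view ?s0)" unfolding view .
  have "words ?B (view ?s0)" unfolding view by (rule words)
  from wp_sound[OF wp0 this] obtain t s where "exec ?B (compile main_program) ?s0 t s"
    "reg (view s) 0 \<noteq> 0 \<longleftrightarrow> precol_extendible {0..<N} E r p" "t \<le> time_factor k * length xs" by blast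
  then show ?thesis by (intro exI[of _ t] exI[of _ s]) simp
qed

theorem theorem6:
  "\<exists>(P :: com) (d :: nat) (C :: real) (g :: nat \<Rightarrow> real).
     g \<in> o(\<lambda>q. real q) \<and>
     (\<forall>(k :: nat) (q :: nat) (N :: nat) (E :: nat set set) (r :: nat) (p :: nat \<rightharpoonup> nat) (xs :: nat list).
        q = 2 ^ (2 * k) \<longrightarrow>
        precol_instance {0..<N} E r p \<longrightarrow>
        nd_at_most {0..<N} E k \<longrightarrow>
        encodes xs N E r p \<longrightarrow>
        decides_within P d xs (precol_extendible {0..<N} E r p)
          (C * real q powr (2.5 * real q + g q) * real (length xs)))"
proof -
  obtain C where C: "\<And>k. time_factor k \<le> C * 2 ^ (5 * k * 4 ^ k)" using time_factor_bound by blast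
  \<comment> \<open>The lower-order term in the exponent is taken to be 0, as
    \<open>time_factor_bound\<close> leaves only a constant factor.\<close>
  have "decides_within (compile main_program) 4 xs (precol_extendible {0..<N} E r p)
      (real C * real q powr (2.5 * real q + (\<lambda>_. 0) q) * real (length xs))"
    if q: "q = 2 ^ (2 * k)" and h: "precol_instance {0..<N} E r p" "nd_at_most {0..<N} E k" "encodes xs N E r p"
    for k q N E r p xs
  proof -
    obtain t s where ts: "exec (word_limit 4 xs) (compile main_program) (init_state xs) t s"
      "reg s 0 \<noteq> 0 \<longleftrightarrow> precol_extendible {0..<N} E r p" "t \<le> time_factor k * length xs"
      using exec_main_program[OF h] by blast
    have q4: "real q = 4 ^ k" by (simp add: q power_mult)
    have "real q powr (2.5 * real q) = (2 powr (2 * real k)) powr (2.5 * 4 ^ k)"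
      by (simp add: q4 powr_powr[symmetric] powr_realpow)
    also have "\<dots> = 2 powr (real (5 * k * 4 ^ k))" by (simp add: powr_powr mult.assoc)
    also have "\<dots> = 2 ^ (5 * k * 4 ^ k)" by (rule powr_realpow) simp
    finally have pw: "real q powr (2.5 * real q + (\<lambda>_. 0) q) = 2 ^ (5 * k * 4 ^ k)" by simp
    have "t \<le> C * 2 ^ (5 * k * 4 ^ k) * length xs"
      by (rule le_trans[OF ts(3) mult_right_mono[OF C]]) simp
    then have "real t \<le> real (C * 2 ^ (5 * k * 4 ^ k) * length xs)" by (simp only: of_nat_le_iff)
    then have "real t \<le> real C * real q powr (2.5 * real q + (\<lambda>_. 0) q) * real (length xs)"
      unfolding pw by simp
    then show ?thesis using ts(1,2) unfolding decides_within_def by blast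
  qed
  moreover have "(\<lambda>_. 0) \<in> o(\<lambda>q :: nat. real q)" by simp
  ultimately show ?thesis by blast
qed

end
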